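(* Let $d\ge1$, let $X(\mathbb R)\subset\mathbb R^2$ be the real locus of a totally real affine plane cubic $X$ whose projectivization $\overline X\subset\mathbb P^2$ is smooth, and let $L$ be a linear functional on $\mathbb R[x,y]_{\le 2d}/\mathcal I(X)_{\le 2d}$. Then $L$ is a moment linear functional if and only if $L$ admits an almost flat extension.
   Context: Totally real means that the real points $X(\mathbb R)$ are Zariski dense in $X$. Write $R_{\le k}=\mathbb R[x,y]_{\le k}/\mathcal I(X)_{\le k}$, where $\mathcal I(X)$ is the ideal of real polynomials vanishing on $X$ and $\le k$ denotes elements of degree at most $k$. $L\in R_{\le 2d}^*$ is a moment linear functional if it is integration against a (positive) Borel measure supported on $X(\mathbb R)$; equivalently, $L$ lies in $\mathcal M_{2d}(X(\mathbb R))=\operatorname{cone}(\mathrm{ev}_A:A\in X(\mathbb R))$, the set of finite nonnegative combinations of the point evaluations $\mathrm{ev}_A(q)=q(A)$. For $L\in R_{\le 2k}^*$, $M_k(L)$ is the symmetric bilinear form $R_{\le k}\times R_{\le k}\to\mathbb R$, $(q_1,q_2)\mapsto L(q_1q_2)$. An almost flat extension of $L\in R_{\le2d}^*$ is any $\widetilde L\in R_{\le2d+4}^*$ such that: (1) $\widetilde L|_{R_{\le2d}}=L$; (2) $\operatorname{rank}M_{d+2}(\widetilde L)\le\operatorname{rank}M_d(L)+1$; (3) $M_{d+2}(\widetilde L)$ is positive semidefinite. *)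

theory Defs
  imports
    "HOL-Analysis.Analysis"
    "HOL-Computational_Algebra.Polynomial"
    "HOL-Library.Function_Algebras"
    "HOL-Library.Set_Algebras"
begin

text \<open>
  Bivariate polynomials in \<open>x, y\<close> are represented as polynomials in \<open>y\<close> over the polynomials
  in \<open>x\<close>: the coefficient of \<open>x^i * y^j\<close> in \<open>p\<close> is \<open>coeff (coeff p j) i\<close>.
\<close>

definition eval2 :: "'a::comm_semiring_0 poly poly \<Rightarrow> 'a \<times> 'a \<Rightarrow> 'a" where
  "eval2 p A = poly (poly p [:snd A:]) (fst A)"

definition complexify :: "real poly poly \<Rightarrow> complex poly poly" where
  "complexify = map_poly (map_poly complex_of_real)"

definition polys_le :: "nat \<Rightarrow> 'a::zero poly poly set" where
  "polys_le k = {p. \<forall>i j. coeff (coeff p j) i \<noteq> 0 \<longrightarrow> i + j \<le> k}"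


subsection \<open>Affine plane cubics\<close>

text \<open>
  A real affine plane curve \<open>X\<close> is given by an equation \<open>f\<close> with real coefficients; as a variety
  it is identified with its set of complex points.
\<close>

definition curve :: "real poly poly \<Rightarrow> (complex \<times> complex) set" where
  "curve f = {P. eval2 (complexify f) P = 0}"

definition real_points :: "real poly poly \<Rightarrow> (real \<times> real) set" where
  "real_points f = {A. eval2 f A = 0}"

definition vanishing_ideal :: "real poly poly \<Rightarrow> real poly poly set" where
  "vanishing_ideal f = {p. \<forall>P \<in> curve f. eval2 (complexify p) P = 0}"

definition plane_cubic :: "real poly poly \<Rightarrow> bool" where
  "plane_cubic f \<longleftrightarrow> f \<in> polys_le 3 \<and> f \<notin> polys_le 2"

definition zero_locus :: "real poly poly set \<Rightarrow> (complex \<times> complex) set" where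
  "zero_locus T = {P. \<forall>p \<in> T. eval2 (complexify p) P = 0}"

text \<open>
  Density is with respect to the Zariski topology of real varieties, whose closed sets are the
  \<open>zero_locus T\<close> for sets \<open>T\<close> of real polynomials.
\<close>

definition totally_real :: "real poly poly \<Rightarrow> bool" where
  "totally_real f \<longleftrightarrow>
     (\<forall>T. map_prod complex_of_real complex_of_real ` real_points f \<subseteq> zero_locus T
        \<longrightarrow> curve f \<subseteq> zero_locus T)"

text \<open>The homogenization of degree \<open>n\<close>, as a polynomial function of three complex variables.\<close>

definition homogenization ::
  "nat \<Rightarrow> real poly poly \<Rightarrow> complex \<Rightarrow> complex \<Rightarrow> complex \<Rightarrow> complex" where
  "homogenization n f x y z =
     (\<Sum>j\<le>n. \<Sum>i\<le>n - j. complex_of_real (coeff (coeff f j) i) * x ^ i * y ^ j * z ^ (n - i - j))"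

text \<open>
  For a cubic \<open>f\<close> the projectivization is the projective plane cubic cut out by
  \<open>homogenization 3 f\<close>; it is smooth if at none of its complex points, given by homogeneous
  coordinates, the three partial derivatives vanish simultaneously.
\<close>

definition smooth_projectivization :: "real poly poly \<Rightarrow> bool" where
  "smooth_projectivization f \<longleftrightarrow>
     (\<forall>x y z. (x, y, z) \<noteq> (0, 0, 0) \<longrightarrow> homogenization 3 f x y z = 0 \<longrightarrow>
        deriv (\<lambda>t. homogenization 3 f t y z) x \<noteq> 0 \<or>
        deriv (\<lambda>t. homogenization 3 f x t z) y \<noteq> 0 \<or>
        deriv (\<lambda>t. homogenization 3 f x y t) z \<noteq> 0)"


subsection \<open>The spaces \<open>R\<^sub>\<le>\<^sub>k\<close> and their functionals\<close>

definition ideal_le :: "real poly poly \<Rightarrow> nat \<Rightarrow> real poly poly set" where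
  "ideal_le f k = vanishing_ideal f \<inter> polys_le k"

definition residue_class :: "real poly poly \<Rightarrow> nat \<Rightarrow> real poly poly \<Rightarrow> real poly poly set" where
  "residue_class f k p = p +o ideal_le f k"

definition R_le :: "real poly poly \<Rightarrow> nat \<Rightarrow> real poly poly set set" where
  "R_le f k = residue_class f k ` polys_le k"

text \<open>
  Functionals are total functions on sets of polynomials, of which only the values on \<open>R_le f k\<close>
  are relevant.
\<close>

definition linear_functional ::
  "real poly poly \<Rightarrow> nat \<Rightarrow> (real poly poly set \<Rightarrow> real) \<Rightarrow> bool" where
  "linear_functional f k L \<longleftrightarrow>
     (\<forall>p \<in> polys_le k. \<forall>q \<in> polys_le k.
        L (residue_class f k (p + q)) = L (residue_class f k p) + L (residue_class f k q)) \<and>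
     (\<forall>c. \<forall>p \<in> polys_le k.
        L (residue_class f k (smult [:c:] p)) = c * L (residue_class f k p))"

definition moment_functional ::
  "real poly poly \<Rightarrow> nat \<Rightarrow> (real poly poly set \<Rightarrow> real) \<Rightarrow> bool" where
  "moment_functional f k L \<longleftrightarrow>
     (\<exists>\<mu> :: (real \<times> real) measure.
        sets \<mu> = sets borel \<and> emeasure \<mu> (- real_points f) = 0 \<and>
        (\<forall>p \<in> polys_le k. integrable \<mu> (eval2 p) \<and>
           L (residue_class f k p) = (\<integral>A. eval2 p A \<partial>\<mu>)))"

text \<open>
  The product of two classes of \<open>R_le f k\<close>, as an element of \<open>R_le f (2 * k)\<close>; the operations on
  the right are elementwise operations on sets.
\<close>

definition class_mult ::
  "real poly poly \<Rightarrow> nat \<Rightarrow> real poly poly set \<Rightarrow> real poly poly set \<Rightarrow> real poly poly set" where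
  "class_mult f k u v = u * v + ideal_le f (2 * k)"

text \<open>The bilinear form \<open>M\<^sub>k(L)\<close>, extended by zero outside of \<open>R_le f k\<close>.\<close>

definition moment_form ::
  "real poly poly \<Rightarrow> nat \<Rightarrow> (real poly poly set \<Rightarrow> real) \<Rightarrow>
   real poly poly set \<Rightarrow> real poly poly set \<Rightarrow> real" where
  "moment_form f k L u v =
     (if u \<in> R_le f k \<and> v \<in> R_le f k then L (class_mult f k u v) else 0)"

text \<open>
  The rank of a bilinear form \<open>B\<close> on a space \<open>V\<close> is the dimension of the image of the map
  \<open>u \<mapsto> B u\<close> from \<open>V\<close> to its dual.
\<close>

definition form_rank :: "'v set \<Rightarrow> ('v \<Rightarrow> 'v \<Rightarrow> real) \<Rightarrow> nat" where
  "form_rank V B = vector_space.dim (\<lambda>(c::real) \<phi> v. c * \<phi> v) (B ` V)"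

definition psd_form :: "'v set \<Rightarrow> ('v \<Rightarrow> 'v \<Rightarrow> real) \<Rightarrow> bool" where
  "psd_form V B \<longleftrightarrow> (\<forall>u \<in> V. 0 \<le> B u u)"

text \<open>
  In the first condition \<open>R_le f (2 * d)\<close> is regarded as a subspace of \<open>R_le f (2 * d + 4)\<close>
  through the canonical injection.
\<close>

definition almost_flat_extension ::
  "real poly poly \<Rightarrow> nat \<Rightarrow> (real poly poly set \<Rightarrow> real) \<Rightarrow> (real poly poly set \<Rightarrow> real) \<Rightarrow> bool" where
  "almost_flat_extension f d L L' \<longleftrightarrow>
     linear_functional f (2 * d + 4) L' \<and>
     (\<forall>p \<in> polys_le (2 * d). L' (residue_class f (2 * d + 4) p) = L (residue_class f (2 * d) p)) \<and>
     form_rank (R_le f (d + 2)) (moment_form f (d + 2) L')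
       \<le> form_rank (R_le f d) (moment_form f d L) + 1 \<and>
     psd_form (R_le f (d + 2)) (moment_form f (d + 2) L')"


subsection \<open>Well-definedness\<close>

lemma vector_space_functionals: "vector_space (\<lambda>(c::real) (\<phi> :: 'v \<Rightarrow> real) v. c * \<phi> v)"
  by unfold_locales (auto simp: fun_eq_iff algebra_simps)

lemma polys_le_0: "0 \<in> polys_le k"
  by (simp add: polys_le_def)

lemma polys_le_add:
  fixes p q :: "'a::comm_monoid_add poly poly"
  assumes "p \<in> polys_le k" "q \<in> polys_le k"
  shows "p + q \<in> polys_le k"
  using assms unfolding polys_le_def by (force simp: add_nonneg_eq_0_iff)

lemma polys_le_mult:
  fixes p q :: "'a::comm_semiring_0 poly poly"
  assumes "p \<in> polys_le k" "q \<in> polys_le l"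
  shows "p * q \<in> polys_le (k + l)"
  unfolding polys_le_def
proof (intro CollectI allI impI)
  fix i j assume "coeff (coeff (p * q) j) i \<noteq> 0"
  then have "(\<Sum>b\<le>j. \<Sum>a\<le>i. coeff (coeff p b) a * coeff (coeff q (j - b)) (i - a)) \<noteq> 0"
    by (simp add: coeff_mult coeff_sum)
  then obtain b a where ba: "b \<le> j" "a \<le> i"
    and nz: "coeff (coeff p b) a * coeff (coeff q (j - b)) (i - a) \<noteq> 0"
    by (meson atMost_iff sum.not_neutral_contains_not_neutral)
  from nz have "coeff (coeff p b) a \<noteq> 0" "coeff (coeff q (j - b)) (i - a) \<noteq> 0" by auto
  with assms have "a + b \<le> k" "(i - a) + (j - b) \<le> l" by (auto simp: polys_le_def)
  with ba show "i + j \<le> k + l" by simp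
qed

lemma complexify_add: "complexify (p + q) = complexify p + complexify q"
  by (simp add: complexify_def poly_eq_iff coeff_map_poly)

lemma complexify_mult: "complexify (p * q) = complexify p * complexify q"
  by (simp add: complexify_def poly_eq_iff coeff_map_poly coeff_mult coeff_sum)

lemma vanishing_ideal_0: "0 \<in> vanishing_ideal f"
  by (simp add: vanishing_ideal_def complexify_def eval2_def)

lemma vanishing_ideal_add:
  "p \<in> vanishing_ideal f \<Longrightarrow> q \<in> vanishing_ideal f \<Longrightarrow> p + q \<in> vanishing_ideal f"
  by (simp add: vanishing_ideal_def complexify_add eval2_def)

lemma vanishing_ideal_mult: "p \<in> vanishing_ideal f \<Longrightarrow> q * p \<in> vanishing_ideal f"
  by (simp add: vanishing_ideal_def complexify_mult eval2_def)

lemma class_mult_residue_class: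
  assumes "p \<in> polys_le k" "q \<in> polys_le k"
  shows "class_mult f k (residue_class f k p) (residue_class f k q) = residue_class f (2 * k) (p * q)"
proof -
  have mult: "a * b \<in> ideal_le f (2 * k)" if "a \<in> polys_le k" "b \<in> ideal_le f k" for a b
    using that polys_le_mult[of a k b k] vanishing_ideal_mult[of b f a]
    by (auto simp: ideal_le_def mult_2)
  have add: "a + b \<in> ideal_le f l" if "a \<in> ideal_le f l" "b \<in> ideal_le f l" for a b l
    using that polys_le_add vanishing_ideal_add by (auto simp: ideal_le_def)
  have zero: "0 \<in> ideal_le f l" for l
    by (simp add: ideal_le_def polys_le_0 vanishing_ideal_0)
  show ?thesis
  proof (intro equalityI subsetI)
    fix r assume "r \<in> class_mult f k (residue_class f k p) (residue_class f k q)"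
    then obtain a b c where a: "a \<in> ideal_le f k" and b: "b \<in> ideal_le f k"
      and c: "c \<in> ideal_le f (2 * k)" and r: "r = (p + a) * (q + b) + c"
      by (auto simp: class_mult_def residue_class_def elt_set_plus_def set_plus_def set_times_def)
    have "p * b + (q * a + (a * b + c)) \<in> ideal_le f (2 * k)"
      using a b c assms by (intro add mult) (auto simp: ideal_le_def)
    moreover have "r = p * q + (p * b + (q * a + (a * b + c)))"
      by (simp add: r algebra_simps)
    ultimately show "r \<in> residue_class f (2 * k) (p * q)"
      by (auto simp: residue_class_def elt_set_plus_def)
  next
    fix r assume "r \<in> residue_class f (2 * k) (p * q)"
    then obtain c where "c \<in> ideal_le f (2 * k)" "r = p * q + c"
      by (auto simp: residue_class_def elt_set_plus_def)
    moreover have "p \<in> residue_class f k p" "q \<in> residue_class f k q"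
      using zero by (force simp: residue_class_def elt_set_plus_def)+
    ultimately show "r \<in> class_mult f k (residue_class f k p) (residue_class f k q)"
      unfolding class_mult_def by (auto intro!: set_plus_intro set_times_intro)
  qed
qed

end

theory Submission
  imports Defs "HOL-Computational_Algebra.Polynomial_Factorial" "HOL-Computational_Algebra.Field_as_Ring"
    "HOL-Computational_Algebra.Fundamental_Theorem_Algebra"
begin

text \<open>
  The cubic is treated through the cone \<open>C\<close> of real zeros of its homogenization in \<open>\<real>\<^sup>3\<close>, so that
  points at infinity are points of \<open>C\<close> as well. Smoothness makes \<open>f\<close> prime, and counting dimensions
  then bounds the zeros on \<open>C\<close> of a form of degree \<open>k\<close> outside of the ideal of \<open>f\<close> by \<open>3 * k\<close>,
  tangential zeros counting twice.

  Let \<open>L\<close> be a moment functional of degree \<open>2 * d\<close>. If \<open>L\<close> vanishes on some form that is nonnegative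
  on \<open>C\<close> and nonzero modulo \<open>f\<close>, the representing measure lives on the zeros of this form; they are
  double, so there are at most \<open>3 * d\<close> of them. Otherwise subtract from \<open>L\<close> the largest multiple
  of the evaluation at an affine point \<open>A\<close> that leaves \<open>L\<close> nonnegative. The difference vanishes on
  such a form and is a sum of at most \<open>3 * d\<close> evaluations, some of them possibly at infinity. If
  there are fewer than \<open>3 * d\<close> of them, a general choice of \<open>A\<close> prevents this; if there are exactly
  \<open>3 * d\<close>, the points together with \<open>A\<close> can be perturbed until they are all affine. At most
  \<open>3 * d + 1\<close> evaluations satisfy at most one linear relation on polynomials of degree \<open>d\<close>, so the
  same sum of evaluations in degree \<open>2 * d + 4\<close> is an almost flat extension.

  Conversely, along \<open>d \<le> d + 1 \<le> d + 2\<close> the rank of the moment form of an almost flat extension grows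
  at most by one, so one of the two steps is flat, and a flat positive functional is a sum of
  evaluations; these lie on the curve because the functional vanishes on the multiples of \<open>f\<close>.
\<close>

text \<open>The obstacle is the line at infinity: sums of evaluations at affine points need not form
  a closed cone, because atoms can run off to infinity. On \<open>C\<close> the cone is closed. As
  \<open>2 * d\<close> is even, the weight of an atom can be absorbed into the length of its vector,
  and a long vector shows in the pure powers of its coordinates. The price is that atoms at infinity
  have to be removed again.

  The bound \<open>3 * d + 1\<close> exceeds by one the dimension \<open>3 * d\<close> of the
  polynomials of degree at most \<open>d\<close> modulo \<open>f\<close>. When it is attained, one
  relation among the evaluations is unavoidable; this is the unit of rank that an almost flat
  extension may gain.

  The general choice of \<open>A\<close>: to each point \<open>u\<close> at infinity belongs a form
  \<open>r\<close> of degree \<open>d\<close> such that \<open>\<phi> (g * r)\<close> is the value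
  of \<open>g\<close> at \<open>u\<close>, and \<open>A\<close> avoids the zeros of these finitely
  many \<open>r\<close>. If \<open>q\<close> of degree \<open>d\<close> vanishes at all atoms but
  \<open>A\<close>, its value at \<open>u\<close> is a nonzero multiple of the product of the values
  of \<open>q\<close> and \<open>r\<close> at \<open>A\<close>, so \<open>u\<close> is no atom.

  Total reality makes the real points infinite, and then the vanishing ideal is generated by
  \<open>f\<close>.\<close>

unbundle no fps_syntax

section \<open>Linear systems over the reals\<close>

text \<open>Gaussian elimination on the set of equations: equation \<open>j\<close> is solved for
  the unknown \<open>i0\<close>, which is substituted into the others.\<close>

lemma homogeneous_system_nontrivial_solution:
  fixes a :: "'i \<Rightarrow> 'j \<Rightarrow> real"
  assumes "finite J" "finite I" "card J < card I"
  shows "\<exists>c. (\<exists>i\<in>I. c i \<noteq> 0) \<and> (\<forall>j\<in>J. (\<Sum>i\<in>I. c i * a i j) = 0)"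
  using assms
proof (induction J arbitrary: I a rule: finite_induct)
  case empty
  then have "I \<noteq> {}" by auto
  then show ?case by (intro exI[of _ "\<lambda>_. 1"]) auto
next
  case (insert j J)
  show ?case
  proof (cases "\<forall>i\<in>I. a i j = 0")
    case True
    have "card J < card I" using insert by simp
    from insert.IH[OF insert.prems(1) this, of a] obtain c
      where "\<exists>i\<in>I. c i \<noteq> 0" "\<forall>j\<in>J. (\<Sum>i\<in>I. c i * a i j) = 0" by blast
    then show ?thesis using True by (intro exI[of _ c]) auto
  next
    case False
    then obtain i0 where i0: "i0 \<in> I" "a i0 j \<noteq> 0" by blast
    define b where "b i l = a i l - a i j / a i0 j * a i0 l" for i l
    have "card J < card (I - {i0})" using insert i0 by simp
    from insert.IH[OF _ this, of b] insert.prems obtain c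
      where c: "\<exists>i\<in>I - {i0}. c i \<noteq> 0" "\<forall>l\<in>J. (\<Sum>i\<in>I - {i0}. c i * b i l) = 0" by auto
    define c' where "c' i = (if i = i0 then - (\<Sum>i\<in>I - {i0}. c i * a i j) / a i0 j else c i)" for i
    have sum: "(\<Sum>i\<in>I. c' i * a i l) = (\<Sum>i\<in>I - {i0}. c i * b i l)" for l
    proof -
      have "(\<Sum>i\<in>I. c' i * a i l) = c' i0 * a i0 l + (\<Sum>i\<in>I - {i0}. c' i * a i l)"
        using i0 insert.prems by (simp add: sum.remove)
      also have "(\<Sum>i\<in>I - {i0}. c' i * a i l) = (\<Sum>i\<in>I - {i0}. c i * a i l)"
        by (intro sum.cong) (auto simp: c'_def)
      also have "c' i0 * a i0 l + \<dots> = (\<Sum>i\<in>I - {i0}. c i * b i l)"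
        by (simp add: c'_def b_def algebra_simps sum_subtractf sum_distrib_left sum_divide_distrib)
      finally show ?thesis .
    qed
    have "b i j = 0" for i using i0 by (simp add: b_def)
    then have "\<forall>l\<in>insert j J. (\<Sum>i\<in>I. c' i * a i l) = 0"
      using c(2) by (auto simp: sum)
    moreover have "\<exists>i\<in>I. c' i \<noteq> 0" using c(1) by (auto simp: c'_def)
    ultimately show ?thesis by blast
  qed
qed

text \<open>Induction on the rows: independence leaves a coordinate \<open>b0\<close> in which the
  new row differs from its projection to the old ones, and this coordinate yields the new dual
  vector. Later uses are dual forms of jet conditions, directions of perturbation, representers of
  evaluations and interpolating polynomials.\<close>

lemma dual_vectors_of_independent_rows:
  fixes a :: "'j \<Rightarrow> 'b \<Rightarrow> real"
  assumes "finite J" "finite B"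
    and "\<And>c. (\<And>b. b \<in> B \<Longrightarrow> (\<Sum>j\<in>J. c j * a j b) = 0) \<Longrightarrow> \<forall>j\<in>J. c j = 0"
  shows "\<exists>e. \<forall>j\<in>J. \<forall>l\<in>J. (\<Sum>b\<in>B. a j b * e l b) = (if j = l then 1 else 0)"
  using assms(1,3)
proof (induction J rule: finite_induct)
  case empty
  then show ?case by simp
next
  case (insert j0 J)
  have "\<forall>j\<in>J. c j = 0" if "\<And>b. b \<in> B \<Longrightarrow> (\<Sum>j\<in>J. c j * a j b) = 0" for c
  proof -
    define c' where "c' j = (if j = j0 then 0 else c j)" for j
    have "(\<Sum>j\<in>insert j0 J. c' j * a j b) = (\<Sum>j\<in>J. c j * a j b)" for b
      using insert.hyps by (auto simp: c'_def intro!: sum.cong)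
    then have "\<forall>j\<in>insert j0 J. c' j = 0" using that by (intro insert.prems) auto
    then show ?thesis using insert.hyps unfolding c'_def by (metis insertCI)
  qed
  then obtain e where e: "\<And>j l. j \<in> J \<Longrightarrow> l \<in> J \<Longrightarrow> (\<Sum>b\<in>B. a j b * e l b) = (if j = l then 1 else 0)"
    using insert.IH by blast
  \<comment> \<open>The only coefficients with which the old rows could combine to row
    \<open>j0\<close>.\<close>
  define p where "p j = (\<Sum>b\<in>B. a j0 b * e j b)" for j
  have "\<exists>b\<in>B. a j0 b \<noteq> (\<Sum>j\<in>J. p j * a j b)"
  proof (rule ccontr)
    assume *: "\<not> ?thesis"
    define c where "c j = (if j = j0 then 1 else - p j)" for j
    have "(\<Sum>j\<in>insert j0 J. c j * a j b) = a j0 b - (\<Sum>j\<in>J. p j * a j b)" for b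
    proof -
      have "(\<Sum>j\<in>J. c j * a j b) = - (\<Sum>j\<in>J. p j * a j b)"
        unfolding sum_negf[symmetric] using insert.hyps by (intro sum.cong) (auto simp: c_def)
      then show ?thesis using insert.hyps by (simp add: c_def)
    qed
    then have "\<forall>j\<in>insert j0 J. c j = 0" using * by (intro insert.prems) auto
    then show False by (simp add: c_def)
  qed
  then obtain b0 where b0: "b0 \<in> B" "a j0 b0 - (\<Sum>j\<in>J. p j * a j b0) \<noteq> 0" by auto
  define r where "r = a j0 b0 - (\<Sum>j\<in>J. p j * a j b0)"
  \<comment> \<open>The unit vector of \<open>b0\<close>, corrected so that the old rows annihilate
    it and scaled so that row \<open>j0\<close> takes the value 1 on it.\<close>
  define u where "u b = ((if b = b0 then 1 else 0) - (\<Sum>j\<in>J. a j b0 * e j b)) / r" for b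
  have au: "(\<Sum>b\<in>B. a i b * u b) = (a i b0 - (\<Sum>j\<in>J. a j b0 * (\<Sum>b\<in>B. a i b * e j b))) / r" for i
  proof -
    have "(\<Sum>b\<in>B. a i b * (\<Sum>j\<in>J. a j b0 * e j b)) = (\<Sum>j\<in>J. a j b0 * (\<Sum>b\<in>B. a i b * e j b))"
      unfolding sum_distrib_left by (subst sum.swap) (simp add: mult_ac)
    moreover have "(\<Sum>b\<in>B. a i b * (if b = b0 then 1 else 0)) = a i b0"
      using b0(1) assms(2) by (simp add: if_distrib[of "\<lambda>x. a i _ * x"] cong: if_cong)
    moreover have "(\<Sum>b\<in>B. a i b * u b)
        = ((\<Sum>b\<in>B. a i b * (if b = b0 then 1 else 0)) - (\<Sum>b\<in>B. a i b * (\<Sum>j\<in>J. a j b0 * e j b))) / r"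
      unfolding u_def sum_subtractf[symmetric] sum_divide_distrib
      by (intro sum.cong) (auto simp: right_diff_distrib)
    ultimately show ?thesis by simp
  qed
  have au_J: "(\<Sum>b\<in>B. a i b * u b) = 0" if "i \<in> J" for i
  proof -
    have "(\<Sum>j\<in>J. a j b0 * (\<Sum>b\<in>B. a i b * e j b)) = (\<Sum>j\<in>J. if i = j then a j b0 else 0)"
      by (intro sum.cong) (auto simp: e that)
    also have "\<dots> = a i b0" using that insert.hyps by simp
    finally show ?thesis unfolding au by simp
  qed
  have au_j0: "(\<Sum>b\<in>B. a j0 b * u b) = 1"
    unfolding au using b0(2) by (simp add: p_def[symmetric] r_def mult.commute)
  define e' where "e' l b = (if l = j0 then u b else e l b - p l * u b)" for l b
  have e'_ne: "(\<Sum>b\<in>B. a i b * e' l b) = (\<Sum>b\<in>B. a i b * e l b) - p l * (\<Sum>b\<in>B. a i b * u b)"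
    if "l \<noteq> j0" for i l
    using that by (simp add: e'_def algebra_simps sum_subtractf sum_distrib_left)
  have e'_eq: "(\<Sum>b\<in>B. a i b * e' j0 b) = (\<Sum>b\<in>B. a i b * u b)" for i
    by (simp add: e'_def)
  have "(\<Sum>b\<in>B. a j b * e' l b) = (if j = l then 1 else 0)"
    if jl: "j \<in> insert j0 J" "l \<in> insert j0 J" for j l
  proof (cases "l = j0")
    case True
    then show ?thesis using jl insert.hyps au_J au_j0 by (auto simp: e'_eq)
  next
    case False
    then show ?thesis using jl insert.hyps au_J au_j0 e by (auto simp: e'_ne p_def[symmetric])
  qed
  then show ?case by blast
qed

section \<open>Monomials and homogeneous evaluation\<close>

definition cf :: "'a::zero poly poly \<Rightarrow> nat \<times> nat \<Rightarrow> 'a" where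
  "cf p s = coeff (coeff p (snd s)) (fst s)"

definition mon :: "nat \<times> nat \<Rightarrow> real poly poly" where
  "mon s = monom (monom 1 (fst s)) (snd s)"

definition mons :: "nat \<Rightarrow> (nat \<times> nat) set" where
  "mons n = {s. fst s + snd s \<le> n}"

definition comb :: "(nat \<times> nat) set \<Rightarrow> (nat \<times> nat \<Rightarrow> real) \<Rightarrow> real poly poly" where
  "comb S c = (\<Sum>s\<in>S. smult [:c s:] (mon s))"

lemma poly_eq_cfI: "(\<And>s. cf p s = cf q s) \<Longrightarrow> p = q"
  unfolding cf_def poly_eq_iff by (metis fst_conv snd_conv)

lemma cf_0 [simp]: "cf 0 s = 0"
  by (simp add: cf_def)

lemma cf_add [simp]: "cf (p + q) s = cf p s + cf q s"
  by (simp add: cf_def)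

lemma cf_minus [simp]: "cf (- p) s = - cf p s" for p :: "real poly poly"
  by (simp add: cf_def)

lemma cf_diff [simp]: "cf (p - q) s = cf p s - cf q s" for p q :: "real poly poly"
  by (simp add: cf_def)

lemma cf_smult [simp]: "cf (smult [:c:] p) s = c * cf p s" for c :: real
  by (simp add: cf_def)

lemma cf_sum: "cf (\<Sum>i\<in>I. p i) s = (\<Sum>i\<in>I. cf (p i) s)"
  by (simp add: cf_def coeff_sum)

lemma cf_mon: "cf (mon s) t = (if s = t then 1 else 0)"
  by (auto simp: cf_def mon_def prod_eq_iff)

lemma mon_mult: "mon s * mon t = mon (fst s + fst t, snd s + snd t)"
  by (simp add: mon_def mult_monom)

lemma mon_0: "mon (0, 0) = 1"
  by (simp add: mon_def monom_0 one_pCons)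

lemma finite_mons [simp]: "finite (mons n)"
proof (rule finite_subset)
  show "mons n \<subseteq> {..n} \<times> {..n}" by (auto simp: mons_def)
qed auto

lemma polys_le_iff: "p \<in> polys_le n \<longleftrightarrow> (\<forall>s. cf p s \<noteq> 0 \<longrightarrow> s \<in> mons n)"
  by (auto simp: polys_le_def cf_def mons_def)

lemma mon_in_polys_le: "s \<in> mons n \<Longrightarrow> mon s \<in> polys_le n"
  by (auto simp: polys_le_iff cf_mon split: if_splits)

lemma polys_le_mono: "m \<le> n \<Longrightarrow> p \<in> polys_le m \<Longrightarrow> p \<in> polys_le n"
  by (fastforce simp: polys_le_def)

lemma polys_le_smult: "p \<in> polys_le n \<Longrightarrow> smult [:c:] p \<in> polys_le n" for c :: real
  by (auto simp: polys_le_iff)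

lemma polys_le_minus: "p \<in> polys_le n \<Longrightarrow> - p \<in> polys_le n" for p :: "real poly poly"
  by (auto simp: polys_le_iff)

lemma polys_le_diff: "p \<in> polys_le n \<Longrightarrow> q \<in> polys_le n \<Longrightarrow> p - q \<in> polys_le n"
  for p q :: "real poly poly"
  using polys_le_add[of p n "- q"] polys_le_minus[of q n] by simp

lemma polys_le_sum: "(\<And>i. i \<in> I \<Longrightarrow> p i \<in> polys_le n) \<Longrightarrow> (\<Sum>i\<in>I. p i) \<in> polys_le n"
  for p :: "'i \<Rightarrow> real poly poly"
  by (induction I rule: infinite_finite_induct) (auto intro: polys_le_add polys_le_0)

lemma one_in_polys_le: "1 \<in> (polys_le n :: real poly poly set)"
  using mon_in_polys_le[of "(0, 0)" n] by (simp add: mon_0 mons_def)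

lemma cf_comb: "finite S \<Longrightarrow> cf (comb S c) s = (if s \<in> S then c s else 0)"
  by (simp add: comb_def cf_sum cf_mon if_distrib[of "\<lambda>x. _ * x"] cong: if_cong)

lemma comb_in_polys_le: "S \<subseteq> mons n \<Longrightarrow> comb S c \<in> polys_le n"
  unfolding comb_def by (intro polys_le_sum polys_le_smult mon_in_polys_le) auto

lemma comb_cf: "p \<in> polys_le n \<Longrightarrow> comb (mons n) (cf p) = p"
  by (rule poly_eq_cfI) (auto simp: cf_comb polys_le_iff)

text \<open>Generic in the field: smoothness concerns complex points, while the geometry of the
  proof is real.\<close>

definition hg :: "nat \<Rightarrow> real poly poly \<Rightarrow> 'a::real_normed_field \<Rightarrow> 'a \<Rightarrow> 'a \<Rightarrow> 'a" where
  "hg n p x y z = (\<Sum>s\<in>mons n. of_real (cf p s) * (x ^ fst s * y ^ snd s * z ^ (n - fst s - snd s)))"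

lemma hg_add: "hg n (p + q) x y z = hg n p x y z + hg n q x y z"
  by (simp add: hg_def algebra_simps sum.distrib)

lemma hg_smult: "hg n (smult [:c:] p) x y z = of_real c * hg n p x y z"
  by (simp add: hg_def algebra_simps sum_distrib_left)

lemma hg_0: "hg n 0 x y z = 0"
  by (simp add: hg_def)

lemma hg_sum: "hg n (\<Sum>i\<in>I. p i) x y z = (\<Sum>i\<in>I. hg n (p i) x y z)"
  by (induction I rule: infinite_finite_induct) (auto simp: hg_0 hg_add)

lemma hg_mon: "s \<in> mons n \<Longrightarrow> hg n (mon s) x y z = x ^ fst s * y ^ snd s * z ^ (n - fst s - snd s)"
  by (simp add: hg_def cf_mon if_distrib[of "\<lambda>x. of_real x * _"] cong: if_cong)

lemma hg_mult:
  assumes "p \<in> polys_le m" "q \<in> polys_le n"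
  shows "hg (m + n) (p * q) x y z = hg m p x y z * hg n q x y z"
proof -
  have mm: "hg (m + n) (mon s * mon t) x y z = hg m (mon s) x y z * hg n (mon t) x y z"
    if "s \<in> mons m" "t \<in> mons n" for s t
  proof -
    have "m + n - (fst s + fst t) - (snd s + snd t) = (m - fst s - snd s) + (n - fst t - snd t)"
      using that by (auto simp: mons_def)
    moreover have "(fst s + fst t, snd s + snd t) \<in> mons (m + n)"
      using that by (auto simp: mons_def)
    ultimately show ?thesis
      using that by (simp add: mon_mult hg_mon power_add del: diff_diff_left)
  qed
  have "p * q = (\<Sum>s\<in>mons m. \<Sum>t\<in>mons n. smult [:cf p s * cf q t:] (mon s * mon t))"
  proof -
    have "p * q = comb (mons m) (cf p) * comb (mons n) (cf q)" using assms by (simp add: comb_cf)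
    also have "\<dots> = (\<Sum>s\<in>mons m. \<Sum>t\<in>mons n. smult [:cf p s * cf q t:] (mon s * mon t))"
      by (simp add: comb_def sum_product mult_ac)
    finally show ?thesis .
  qed
  then have "hg (m + n) (p * q) x y z
      = (\<Sum>s\<in>mons m. \<Sum>t\<in>mons n. of_real (cf p s * cf q t) * hg (m + n) (mon s * mon t) x y z)"
    by (simp add: hg_sum hg_smult)
  also have "\<dots> = (\<Sum>s\<in>mons m. \<Sum>t\<in>mons n. (of_real (cf p s) * hg m (mon s) x y z)
      * (of_real (cf q t) * hg n (mon t) x y z))"
    by (intro sum.cong) (auto simp: mm)
  also have "\<dots> = (\<Sum>s\<in>mons m. of_real (cf p s) * hg m (mon s) x y z)
      * (\<Sum>t\<in>mons n. of_real (cf q t) * hg n (mon t) x y z)"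
    by (simp add: sum_product)
  also have "\<dots> = hg m p x y z * hg n q x y z"
    by (simp add: hg_mon hg_def[of m p] hg_def[of n q])
  finally show ?thesis .
qed

lemma hg_scale: "hg n p (t * x) (t * y) (t * z) = t ^ n * hg n p x y z"
proof -
  have "t ^ n = t ^ fst s * t ^ snd s * t ^ (n - fst s - snd s)" if "s \<in> mons n" for s
    using that by (simp add: mons_def flip: power_add)
  then show ?thesis
    unfolding hg_def sum_distrib_left by (intro sum.cong) (auto simp: power_mult_distrib)
qed

lemma hg_of_real: "hg n p (of_real x) (of_real y) (of_real z) = of_real (hg n p x y z)"
  by (simp add: hg_def)

lemma homogenization_eq_hg: "homogenization n p x y z = hg n p x y z"
proof -
  have "hg n p x y z = (\<Sum>s\<in>prod.swap ` mons n. of_real (coeff (coeff p (fst s)) (snd s))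
      * (x ^ snd s * y ^ fst s * z ^ (n - snd s - fst s)))"
    by (subst sum.reindex) (auto simp: hg_def cf_def)
  also have "prod.swap ` mons n = (SIGMA j:{..n}. {..n - j})"
    by (force simp: mons_def image_iff)
  also have "(\<Sum>s\<in>(SIGMA j:{..n}. {..n - j}). of_real (coeff (coeff p (fst s)) (snd s))
      * (x ^ snd s * y ^ fst s * z ^ (n - snd s - fst s))) = homogenization n p x y z"
    by (simp add: homogenization_def sum.Sigma split_beta mult.assoc)
  finally show ?thesis by simp
qed

lemma hg_affine:
  assumes "p \<in> polys_le n"
  shows "hg n p a b 1 = eval2 p (a, b)"
proof -
  have "eval2 p (a, b) = eval2 (comb (mons n) (cf p)) (a, b)" using assms by (simp add: comb_cf)
  also have "\<dots> = (\<Sum>s\<in>mons n. cf p s * (a ^ fst s * b ^ snd s))"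
    by (simp add: eval2_def comb_def poly_sum mon_def poly_monom mult_ac)
  finally show ?thesis by (simp add: hg_def)
qed

lemma mons_1: "mons 1 = {(0, 0), (1, 0), (0, 1)}"
  by (auto simp: mons_def)

lemma mons_2: "mons 2 = {(0, 0), (1, 0), (0, 1), (2, 0), (1, 1), (0, 2)}"
  by (auto simp: mons_def)

text \<open>Explicit sums make it evident that the real partial derivatives embed into the complex
  ones. The truncated exponent \<open>fst s - 1\<close> is harmless, because the factor
  \<open>fst s\<close> vanishes with it.\<close>

definition hgx :: "nat \<Rightarrow> real poly poly \<Rightarrow> 'a::real_normed_field \<Rightarrow> 'a \<Rightarrow> 'a \<Rightarrow> 'a" where
  "hgx n p x y z = (\<Sum>s\<in>mons n. of_real (cf p s) *
     (of_nat (fst s) * x ^ (fst s - 1) * y ^ snd s * z ^ (n - fst s - snd s)))"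

definition hgy :: "nat \<Rightarrow> real poly poly \<Rightarrow> 'a::real_normed_field \<Rightarrow> 'a \<Rightarrow> 'a \<Rightarrow> 'a" where
  "hgy n p x y z = (\<Sum>s\<in>mons n. of_real (cf p s) *
     (x ^ fst s * (of_nat (snd s) * y ^ (snd s - 1)) * z ^ (n - fst s - snd s)))"

definition hgz :: "nat \<Rightarrow> real poly poly \<Rightarrow> 'a::real_normed_field \<Rightarrow> 'a \<Rightarrow> 'a \<Rightarrow> 'a" where
  "hgz n p x y z = (\<Sum>s\<in>mons n. of_real (cf p s) *
     (x ^ fst s * y ^ snd s * (of_nat (n - fst s - snd s) * z ^ (n - fst s - snd s - 1))))"

lemma hgx: "((\<lambda>t. hg n p t y z) has_field_derivative hgx n p x y z) (at x)"
  unfolding hg_def hgx_def by (auto intro!: derivative_eq_intros sum.cong)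

lemma hgy: "((\<lambda>t. hg n p x t z) has_field_derivative hgy n p x y z) (at y)"
  unfolding hg_def hgy_def by (auto intro!: derivative_eq_intros sum.cong)

lemma hgz: "((\<lambda>t. hg n p x y t) has_field_derivative hgz n p x y z) (at z)"
  unfolding hg_def hgz_def by (auto intro!: derivative_eq_intros sum.cong simp: mult_ac)

section \<open>Values and gradients of forms on real three-space\<close>

definition hev :: "nat \<Rightarrow> real poly poly \<Rightarrow> real ^ 3 \<Rightarrow> real" where
  "hev n p v = hg n p (v $ 1) (v $ 2) (v $ 3)"

definition grd :: "nat \<Rightarrow> real poly poly \<Rightarrow> real ^ 3 \<Rightarrow> real ^ 3" where
  "grd n p v = vector [hgx n p (v $ 1) (v $ 2) (v $ 3), hgy n p (v $ 1) (v $ 2) (v $ 3),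
     hgz n p (v $ 1) (v $ 2) (v $ 3)]"

lemma hev_add: "hev n (p + q) v = hev n p v + hev n q v"
  and hev_smult: "hev n (smult [:c:] p) v = c * hev n p v"
  and hev_0: "hev n 0 v = 0"
  by (simp_all add: hev_def hg_add hg_smult hg_0)

lemma hev_sum: "hev n (\<Sum>i\<in>I. p i) v = (\<Sum>i\<in>I. hev n (p i) v)"
  by (simp add: hev_def hg_sum)

lemma hev_comb: "hev n (comb S c) v = (\<Sum>s\<in>S. c s * hev n (mon s) v)"
  by (simp add: comb_def hev_sum hev_smult)

lemma hev_mult: "p \<in> polys_le m \<Longrightarrow> q \<in> polys_le n \<Longrightarrow> hev (m + n) (p * q) v = hev m p v * hev n q v"
  by (simp add: hev_def hg_mult)

lemma hev_scale: "hev n p (t *\<^sub>R v) = t ^ n * hev n p v"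
  by (simp add: hev_def hg_scale)

lemma hev_one: "hev n 1 v = v $ 3 ^ n"
  using hg_mon[of "(0, 0)" n "v $ 1" "v $ 2" "v $ 3"] by (simp add: hev_def mon_0 mons_def)

lemma grd_inner: "grd n p v \<bullet> h = hgx n p (v $ 1) (v $ 2) (v $ 3) * h $ 1
    + hgy n p (v $ 1) (v $ 2) (v $ 3) * h $ 2 + hgz n p (v $ 1) (v $ 2) (v $ 3) * h $ 3"
  by (simp add: grd_def inner_vec_def sum_3)

lemma has_derivative_hev: "(hev n p has_derivative (\<lambda>h. grd n p v \<bullet> h)) (at v)"
proof -
  have comp: "((\<lambda>v. v $ i) has_derivative (\<lambda>h. h $ i)) (at v)" for i :: 3
    by (rule bounded_linear_imp_has_derivative[OF bounded_linear_vec_nth])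
  have pow: "((\<lambda>v. v $ i ^ k) has_derivative (\<lambda>h. of_nat k * v $ i ^ (k - 1) * h $ i)) (at v)"
    for i :: 3 and k
    by (rule has_derivative_eq_rhs[OF has_derivative_power[OF comp]]) (simp add: mult_ac)
  have "hev n p = (\<lambda>v. \<Sum>s\<in>mons n. cf p s * (v $ 1 ^ fst s * v $ 2 ^ snd s * v $ 3 ^ (n - fst s - snd s)))"
    by (simp add: hev_def hg_def fun_eq_iff)
  moreover have "((\<lambda>v. v $ 1 ^ i * v $ 2 ^ j * v $ 3 ^ l) has_derivative
      (\<lambda>h. (of_nat i * v $ 1 ^ (i - 1) * v $ 2 ^ j * v $ 3 ^ l) * h $ 1
        + (v $ 1 ^ i * (of_nat j * v $ 2 ^ (j - 1)) * v $ 3 ^ l) * h $ 2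
        + (v $ 1 ^ i * v $ 2 ^ j * (of_nat l * v $ 3 ^ (l - 1))) * h $ 3)) (at v)" for i j l
    by (rule has_derivative_eq_rhs[OF has_derivative_mult[OF has_derivative_mult[OF pow pow] pow]])
      (simp add: algebra_simps)
  then have "((\<lambda>v. \<Sum>s\<in>mons n. cf p s * (v $ 1 ^ fst s * v $ 2 ^ snd s * v $ 3 ^ (n - fst s - snd s)))
      has_derivative (\<lambda>h. grd n p v \<bullet> h)) (at v)"
    by (intro has_derivative_eq_rhs[OF has_derivative_sum[OF has_derivative_mult_right]])
      (assumption, simp add: fun_eq_iff grd_inner hgx_def hgy_def hgz_def
         sum_distrib_right sum.distrib[symmetric] distrib_left mult.assoc del: diff_diff_left)
  ultimately show ?thesis by simp
qed

lemma grd_eqI: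
  assumes "(hev n p has_derivative (\<lambda>h. g \<bullet> h)) (at v)"
  shows "grd n p v = g"
proof -
  have "(\<lambda>h. grd n p v \<bullet> h) = (\<lambda>h. g \<bullet> h)"
    using has_derivative_hev assms by (rule has_derivative_unique)
  then have "\<forall>h. grd n p v \<bullet> h = g \<bullet> h" by (simp add: fun_eq_iff)
  then show ?thesis by (simp only: vector_eq_rdot)
qed

lemma grd_add: "grd n (p + q) v = grd n p v + grd n q v"
proof (rule grd_eqI)
  have "((\<lambda>v. hev n p v + hev n q v) has_derivative (\<lambda>h. grd n p v \<bullet> h + grd n q v \<bullet> h)) (at v)"
    by (rule has_derivative_add[OF has_derivative_hev has_derivative_hev])
  then show "(hev n (p + q) has_derivative (\<lambda>h. (grd n p v + grd n q v) \<bullet> h)) (at v)"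
    unfolding inner_add_left hev_add[abs_def] .
qed

lemma grd_smult: "grd n (smult [:c:] p) v = c *\<^sub>R grd n p v"
proof (rule grd_eqI)
  have "((\<lambda>v. c * hev n p v) has_derivative (\<lambda>h. c * (grd n p v \<bullet> h))) (at v)"
    by (rule has_derivative_mult_right[OF has_derivative_hev])
  then show "(hev n (smult [:c:] p) has_derivative (\<lambda>h. (c *\<^sub>R grd n p v) \<bullet> h)) (at v)"
    unfolding inner_scaleR_left hev_smult[abs_def] .
qed

lemma grd_0: "grd n 0 v = 0"
  using grd_smult[of n 0 0 v] by simp

lemma grd_sum: "grd n (\<Sum>i\<in>I. p i) v = (\<Sum>i\<in>I. grd n (p i) v)"
  by (induction I rule: infinite_finite_induct) (auto simp: grd_0 grd_add)

lemma grd_comb: "grd n (comb S c) v = (\<Sum>s\<in>S. c s *\<^sub>R grd n (mon s) v)"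
  by (simp add: comb_def grd_sum grd_smult)

lemma grd_mult:
  assumes "p \<in> polys_le m" "q \<in> polys_le n"
  shows "grd (m + n) (p * q) v = hev m p v *\<^sub>R grd n q v + hev n q v *\<^sub>R grd m p v"
proof (rule grd_eqI)
  have der: "((\<lambda>v. hev m p v * hev n q v) has_derivative
      (\<lambda>h. hev m p v * (grd n q v \<bullet> h) + (grd m p v \<bullet> h) * hev n q v)) (at v)"
    by (rule has_derivative_mult[OF has_derivative_hev has_derivative_hev])
  have eq: "(\<lambda>h. hev m p v * (grd n q v \<bullet> h) + (grd m p v \<bullet> h) * hev n q v)
      = (\<lambda>h. (hev m p v *\<^sub>R grd n q v + hev n q v *\<^sub>R grd m p v) \<bullet> h)"
    by (simp add: inner_add_left mult.commute)
  have "hev (m + n) (p * q) = (\<lambda>v. hev m p v * hev n q v)"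
    by (rule ext) (rule hev_mult[OF assms])
  with der[unfolded eq] show "(hev (m + n) (p * q) has_derivative
      (\<lambda>h. (hev m p v *\<^sub>R grd n q v + hev n q v *\<^sub>R grd m p v) \<bullet> h)) (at v)"
    by (simp only:)
qed

text \<open>Euler's identity, from differentiating along the ray through \<open>v\<close> in two
  ways. On the curve it makes the gradient of \<open>f\<close> orthogonal to the point
  itself.\<close>

lemma grd_euler: "grd n p v \<bullet> v = n * hev n p v"
proof -
  have "((\<lambda>t. t *\<^sub>R v) has_derivative (\<lambda>h. h *\<^sub>R v)) (at (1::real))"
    by (rule bounded_linear_imp_has_derivative[OF bounded_linear_scaleR_left])
  from has_derivative_compose[OF this has_derivative_hev]
  have "((\<lambda>t. hev n p (t *\<^sub>R v)) has_derivative (\<lambda>h. grd n p (1 *\<^sub>R v) \<bullet> (h *\<^sub>R v))) (at 1)" .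
  moreover have "((\<lambda>t. t ^ n * hev n p v) has_derivative (\<lambda>h. (n * hev n p v) * h)) (at (1::real))"
    using DERIV_cmult_right[OF DERIV_pow[of n "1::real"], of "hev n p v"]
    by (simp add: has_field_derivative_def)
  then have "((\<lambda>t. hev n p (t *\<^sub>R v)) has_derivative (\<lambda>h. (n * hev n p v) * h)) (at 1)"
    unfolding hev_scale .
  ultimately have "(\<lambda>h. grd n p (1 *\<^sub>R v) \<bullet> (h *\<^sub>R v)) = (\<lambda>h. (n * hev n p v) * h)"
    by (rule has_derivative_unique)
  from fun_cong[OF this, of 1] show ?thesis by simp
qed

lemma continuous_on_hev [continuous_intros]: "continuous_on S g \<Longrightarrow> continuous_on S (\<lambda>x. hev n p (g x))"
  unfolding hev_def hg_def
  by (intro continuous_on_sum continuous_on_mult continuous_on_power continuous_on_const continuous_on_component)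

lemma continuous_on_grd: "continuous_on S (grd n p)"
proof -
  have "continuous_on S (\<lambda>v. grd n p v $ i)" for i
  proof -
    have "i = 1 \<or> i = 2 \<or> i = 3" using exhaust_3 by blast
    then have "(\<lambda>v. grd n p v $ i) \<in> {\<lambda>v. hgx n p (v $ 1) (v $ 2) (v $ 3),
        \<lambda>v. hgy n p (v $ 1) (v $ 2) (v $ 3), \<lambda>v. hgz n p (v $ 1) (v $ 2) (v $ 3)}"
      by (auto simp: grd_def)
    then show "continuous_on S (\<lambda>v. grd n p v $ i)"
      unfolding hgx_def hgy_def hgz_def
      by (elim insertE emptyE; simp only:;
        intro continuous_on_sum continuous_on_mult continuous_on_power continuous_on_const
          continuous_on_component continuous_on_id)
  qed
  then show ?thesis
    using continuous_on_vec_lambda[of S "\<lambda>i v. grd n p v $ i"] by simp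
qed

text \<open>Mean value inequality on a ball where the gradient is within \<open>e\<close> of its
  value at \<open>v\<close>. Two arbitrary nearby points are compared, not one point with
  \<open>v\<close>, because \<open>perturb_points\<close> needs a contraction estimate.\<close>

lemma hev_strict_derivative:
  assumes "e > 0"
  shows "\<exists>r>0. \<forall>u\<in>ball v r. \<forall>w\<in>ball v r.
    \<bar>hev n p u - hev n p w - grd n p v \<bullet> (u - w)\<bar> \<le> e * norm (u - w)"
proof -
  have "isCont (grd n p) v"
    using continuous_on_grd[of UNIV n p] by (simp add: continuous_on_eq_continuous_at)
  then obtain r where r: "r > 0" "\<And>u. dist u v < r \<Longrightarrow> dist (grd n p u) (grd n p v) < e"
    using assms unfolding continuous_at_eps_delta by blast
  have "norm ((hev n p u - grd n p v \<bullet> u) - (hev n p w - grd n p v \<bullet> w)) \<le> e * norm (u - w)"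
    if "u \<in> ball v r" "w \<in> ball v r" for u w
  proof (rule differentiable_bound[OF convex_ball _ _ that(1) that(2)])
    fix x assume x: "x \<in> ball v r"
    show "((\<lambda>x. hev n p x - grd n p v \<bullet> x) has_derivative (\<lambda>h. (grd n p x - grd n p v) \<bullet> h)) (at x within ball v r)"
      by (rule has_derivative_at_withinI)
        (auto intro!: derivative_eq_intros has_derivative_hev simp: inner_diff_left)
    have "onorm (\<lambda>h. (grd n p x - grd n p v) \<bullet> h) \<le> norm (grd n p x - grd n p v)"
      by (rule onorm_le) (simp add: Cauchy_Schwarz_ineq2)
    also have "\<dots> \<le> e" using r(2)[of x] x by (simp add: dist_norm norm_minus_commute)
    finally show "onorm (\<lambda>h. (grd n p x - grd n p v) \<bullet> h) \<le> e" .
  qed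
  then show ?thesis using r(1) by (intro exI[of _ r]) (auto simp: inner_diff_right algebra_simps)
qed

text \<open>At a real point the complex partial derivatives are the real ones, so a vanishing real
  gradient would exhibit a singular complex point.\<close>

lemma smooth_projectivization_grd:
  assumes "smooth_projectivization f" "v \<noteq> 0" "hev 3 f v = 0"
  shows "grd 3 f v \<noteq> 0"
proof
  assume g: "grd 3 f v = 0"
  let ?x = "complex_of_real (v $ 1)" and ?y = "complex_of_real (v $ 2)" and ?z = "complex_of_real (v $ 3)"
  have "grd 3 f v $ 1 = 0" "grd 3 f v $ 2 = 0" "grd 3 f v $ 3 = 0" using g by simp_all
  then have 0: "hgx 3 f (v $ 1) (v $ 2) (v $ 3) = 0" "hgy 3 f (v $ 1) (v $ 2) (v $ 3) = 0"
    "hgz 3 f (v $ 1) (v $ 2) (v $ 3) = 0" by (simp_all add: grd_def)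
  have "hgx 3 f ?x ?y ?z = of_real (hgx 3 f (v $ 1) (v $ 2) (v $ 3))"
    "hgy 3 f ?x ?y ?z = of_real (hgy 3 f (v $ 1) (v $ 2) (v $ 3))"
    "hgz 3 f ?x ?y ?z = of_real (hgz 3 f (v $ 1) (v $ 2) (v $ 3))"
    by (simp_all add: hgx_def hgy_def hgz_def)
  then have "deriv (\<lambda>t. homogenization 3 f t ?y ?z) ?x = 0" "deriv (\<lambda>t. homogenization 3 f ?x t ?z) ?y = 0"
    "deriv (\<lambda>t. homogenization 3 f ?x ?y t) ?z = 0"
    unfolding homogenization_eq_hg by (metis DERIV_imp_deriv hgx hgy hgz 0 of_real_0)+
  moreover have "(?x, ?y, ?z) \<noteq> (0, 0, 0)"
    using assms(2) by (auto simp: vec_eq_iff forall_3)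
  moreover have "homogenization 3 f ?x ?y ?z = 0"
    using assms(3) by (simp add: homogenization_eq_hg hg_of_real hev_def)
  ultimately show False using assms(1) unfolding smooth_projectivization_def by blast
qed

section \<open>Irreducibility of a smooth cubic\<close>

text \<open>The part of degree \<open>k\<close> restricted to the line at infinity and dehomogenized
  by \<open>x = 1\<close>. It is multiplicative, so it serves as a leading term for the total
  degree.\<close>

definition top_form :: "nat \<Rightarrow> real poly poly \<Rightarrow> real poly" where
  "top_form k p = (\<Sum>j\<le>k. monom (cf p (k - j, j)) j)"

lemma coeff_top_form: "coeff (top_form k p) j = (if j \<le> k then cf p (k - j, j) else 0)"
  by (simp add: top_form_def coeff_sum)

lemma poly_top_form: "poly (top_form k p) t = hg k p 1 t 0"
proof -
  have "hg k p 1 t 0 = (\<Sum>s\<in>mons k. if fst s + snd s = k then cf p s * t ^ snd s else 0)"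
    unfolding hg_def by (intro sum.cong) (auto simp: mons_def)
  also have "\<dots> = (\<Sum>s\<in>{s \<in> mons k. fst s + snd s = k}. cf p s * t ^ snd s)"
    by (simp add: sum.inter_filter)
  also have "{s \<in> mons k. fst s + snd s = k} = (\<lambda>j. (k - j, j)) ` {..k}"
    by (force simp: mons_def)
  also have "(\<Sum>s\<in>\<dots>. cf p s * t ^ snd s) = (\<Sum>j\<le>k. cf p (k - j, j) * t ^ j)"
    by (subst sum.reindex) (auto simp: inj_on_def)
  finally show ?thesis by (simp add: top_form_def poly_sum poly_monom)
qed

lemma top_form_mult:
  "p \<in> polys_le m \<Longrightarrow> q \<in> polys_le n \<Longrightarrow> top_form (m + n) (p * q) = top_form m p * top_form n q"
  by (simp add: poly_eq_poly_eq_iff[symmetric] fun_eq_iff poly_top_form hg_mult)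

lemma top_form_eq_0_iff: "p \<in> polys_le (Suc k) \<Longrightarrow> top_form (Suc k) p = 0 \<longleftrightarrow> p \<in> polys_le k"
proof
  assume p: "p \<in> polys_le (Suc k)" and 0: "top_form (Suc k) p = 0"
  show "p \<in> polys_le k"
    unfolding polys_le_iff
  proof (intro allI impI)
    fix s assume s: "cf p s \<noteq> 0"
    then have le: "fst s + snd s \<le> Suc k" using p by (auto simp: polys_le_iff mons_def)
    have "fst s + snd s \<noteq> Suc k"
    proof
      assume eq: "fst s + snd s = Suc k"
      have "coeff (top_form (Suc k) p) (snd s) = 0" using 0 by simp
      moreover have "(Suc k - snd s, snd s) = s" using eq by (auto simp: prod_eq_iff)
      ultimately show False using s eq by (auto simp: coeff_top_form split: if_splits)
    qed
    with le show "s \<in> mons k" by (simp add: mons_def)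
  qed
next
  assume "p \<in> polys_le k"
  then have "cf p (Suc k - j, j) = 0" if "j \<le> Suc k" for j
    using that by (force simp: polys_le_iff mons_def)
  then show "top_form (Suc k) p = 0"
    by (simp add: poly_eq_iff coeff_top_form)
qed

lemma top_form_eq_0: "p \<in> polys_le m \<Longrightarrow> m < n \<Longrightarrow> top_form n p = 0"
  using top_form_eq_0_iff[of p "n - 1"] polys_le_mono[of m "n - 1" p] polys_le_mono[of m n p]
  by (cases n) auto

lemma ex_polys_le: "\<exists>n. p \<in> polys_le n" for p :: "real poly poly"
proof
  let ?N = "degree p + (\<Sum>j\<le>degree p. degree (coeff p j))"
  show "p \<in> polys_le ?N"
    unfolding polys_le_def
  proof (intro CollectI allI impI)
    fix i j assume nz: "coeff (coeff p j) i \<noteq> 0"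
    then have "coeff p j \<noteq> 0" by auto
    then have j: "j \<le> degree p" by (rule le_degree)
    have "i \<le> degree (coeff p j)" using nz by (rule le_degree)
    also have "\<dots> \<le> (\<Sum>j\<le>degree p. degree (coeff p j))" using j by (intro member_le_sum) auto
    finally show "i + j \<le> ?N" using j by simp
  qed
qed

lemma ex_total_degree:
  assumes "p \<noteq> 0"
  shows "\<exists>n. p \<in> polys_le n \<and> top_form n p \<noteq> 0"
proof -
  define n where "n = (LEAST n. p \<in> polys_le n)"
  have n: "p \<in> polys_le n" unfolding n_def using ex_polys_le by (rule LeastI_ex)
  have "top_form n p \<noteq> 0"
  proof (cases n)
    case 0
    show ?thesis
    proof
      assume "top_form n p = 0"
      then have "coeff (top_form n p) 0 = 0" by simp
      then have "cf p (0, 0) = 0" using 0 by (simp add: coeff_top_form)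
      moreover have "cf p s \<noteq> 0 \<Longrightarrow> s = (0, 0)" for s
        using n 0 by (cases s) (force simp: polys_le_iff mons_def)
      ultimately have "p = 0" by (intro poly_eq_cfI) (metis cf_0)
      with assms show False by simp
    qed
  next
    case (Suc k)
    have "p \<notin> polys_le k" using not_less_Least[of k "\<lambda>n. p \<in> polys_le n"] Suc by (simp add: n_def)
    then show ?thesis using top_form_eq_0_iff n Suc by blast
  qed
  with n show ?thesis by blast
qed

lemma binary_quadratic_form_zero:
  fixes a b c :: complex
  shows "\<exists>s t. (s, t) \<noteq> (0, 0) \<and> a * s\<^sup>2 + b * s * t + c * t\<^sup>2 = 0"
proof (cases "a = 0")
  case True
  then show ?thesis by (intro exI[of _ 1] exI[of _ 0]) auto
next
  case False
  define w where "w = csqrt (b\<^sup>2 - 4 * a * c)"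
  have "w\<^sup>2 = b\<^sup>2 - 4 * a * c" by (simp add: w_def)
  then have "a * ((w - b) / (2 * a))\<^sup>2 + b * ((w - b) / (2 * a)) + c = 0"
    using False by (simp add: field_simps power2_eq_square) algebra
  then show ?thesis by (intro exI[of _ "(w - b) / (2 * a)"] exI[of _ 1]) auto
qed

text \<open>On a line parametrized by two of its points a conic becomes a binary quadratic form,
  which has a complex zero.\<close>

lemma line_meets_conic:
  "\<exists>x y z :: complex. (x, y, z) \<noteq> (0, 0, 0) \<and> hg 1 g x y z = 0 \<and> hg 2 h x y z = 0"
proof -
  define a b c where "a = complex_of_real (cf g (1, 0))" and "b = complex_of_real (cf g (0, 1))"
    and "c = complex_of_real (cf g (0, 0))"
  have lin: "hg 1 g x y z = a * x + b * y + c * z" for x y z :: complex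
    unfolding hg_def mons_1 by (simp add: a_def b_def c_def)
  \<comment> \<open>Two independent points of the line, by cases on a nonzero coefficient. The
    choice made for \<open>a = b = 0\<close> also covers the zero form.\<close>
  obtain p1 p2 p3 q1 q2 q3 where pq: "a * p1 + b * p2 + c * p3 = 0" "a * q1 + b * q2 + c * q3 = 0"
    and ind: "\<And>s t. s * p1 + t * q1 = 0 \<Longrightarrow> s * p2 + t * q2 = 0 \<Longrightarrow> s * p3 + t * q3 = 0 \<Longrightarrow> s = 0 \<and> t = 0"
  proof (cases "a = 0")
    case False
    then show ?thesis by (intro that[of "- b / a" 1 0 "- c / a" 0 1]) auto
  next
    case a: True
    show ?thesis
    proof (cases "b = 0")
      case True
      then show ?thesis using a by (intro that[of 1 0 0 0 1 0]) auto
    next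
      case False
      then show ?thesis by (intro that[of 1 "- a / b" 0 0 "- c / b" 1]) auto
    qed
  qed
  define k where "k i j = complex_of_real (cf h (i, j))" for i j
  have quad: "hg 2 h x y z = k 0 0 * z\<^sup>2 + k 1 0 * (x * z) + k 0 1 * (y * z) + k 2 0 * x\<^sup>2
      + k 1 1 * (x * y) + k 0 2 * y\<^sup>2" for x y z :: complex
    unfolding hg_def mons_2 by (simp add: k_def numeral_2_eq_2)
  let ?q = "\<lambda>s t. hg 2 h (s * p1 + t * q1) (s * p2 + t * q2) (s * p3 + t * q3)"
  obtain A B C where "\<And>s t. ?q s t = A * s\<^sup>2 + B * s * t + C * t\<^sup>2"
  proof
    show "?q s t = (k 0 0 * p3\<^sup>2 + k 1 0 * (p1 * p3) + k 0 1 * (p2 * p3) + k 2 0 * p1\<^sup>2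
      + k 1 1 * (p1 * p2) + k 0 2 * p2\<^sup>2) * s\<^sup>2
      + (k 0 0 * (2 * p3 * q3) + k 1 0 * (p1 * q3 + q1 * p3) + k 0 1 * (p2 * q3 + q2 * p3)
      + k 2 0 * (2 * p1 * q1) + k 1 1 * (p1 * q2 + q1 * p2) + k 0 2 * (2 * p2 * q2)) * s * t
      + (k 0 0 * q3\<^sup>2 + k 1 0 * (q1 * q3) + k 0 1 * (q2 * q3) + k 2 0 * q1\<^sup>2
      + k 1 1 * (q1 * q2) + k 0 2 * q2\<^sup>2) * t\<^sup>2" for s t
      unfolding quad by (simp add: power2_eq_square algebra_simps)
  qed
  then obtain s t where st: "(s, t) \<noteq> (0, 0)" "?q s t = 0"
    using binary_quadratic_form_zero by metis
  have "hg 1 g (s * p1 + t * q1) (s * p2 + t * q2) (s * p3 + t * q3)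
      = s * (a * p1 + b * p2 + c * p3) + t * (a * q1 + b * q2 + c * q3)"
    unfolding lin by (simp add: algebra_simps)
  also have "\<dots> = 0" by (simp only: pq) simp
  finally show ?thesis using st ind[of s t]
    by (intro exI[of _ "s * p1 + t * q1"] exI[of _ "s * p2 + t * q2"] exI[of _ "s * p3 + t * q3"]) auto
qed

text \<open>At a common zero of both factors the product rule kills all partial derivatives. The
  common zero may be complex, which is why smoothness at complex points is used.\<close>

lemma smooth_not_line_times_conic:
  assumes "smooth_projectivization (g * h)" "g \<in> polys_le 1" "h \<in> polys_le 2"
  shows False
proof -
  obtain x y z :: complex where xyz: "(x, y, z) \<noteq> (0, 0, 0)" "hg 1 g x y z = 0" "hg 2 h x y z = 0"
    using line_meets_conic by blast
  have prod: "homogenization 3 (g * h) a b c = hg 1 g a b c * hg 2 h a b c" for a b c :: complex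
    using hg_mult[OF assms(2,3)] by (simp add: homogenization_eq_hg numeral_3_eq_3)
  have "((\<lambda>t. hg 1 g t y z * hg 2 h t y z) has_field_derivative 0) (at x)"
    "((\<lambda>t. hg 1 g x t z * hg 2 h x t z) has_field_derivative 0) (at y)"
    "((\<lambda>t. hg 1 g x y t * hg 2 h x y t) has_field_derivative 0) (at z)"
    using DERIV_mult[OF hgx[of 1 g y z x] hgx[of 2 h y z x]] DERIV_mult[OF hgy[of 1 g x z y] hgy[of 2 h x z y]]
      DERIV_mult[OF hgz[of 1 g x y z] hgz[of 2 h x y z]] xyz by simp_all
  then have "deriv (\<lambda>t. homogenization 3 (g * h) t y z) x = 0" "deriv (\<lambda>t. homogenization 3 (g * h) x t z) y = 0"
    "deriv (\<lambda>t. homogenization 3 (g * h) x y t) z = 0"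
    unfolding prod by (auto intro: DERIV_imp_deriv)
  moreover have "homogenization 3 (g * h) x y z = 0" by (simp add: prod xyz del: One_nat_def)
  ultimately show False using assms(1) xyz(1) unfolding smooth_projectivization_def by blast
qed

text \<open>Top forms multiply, so the degrees of two factors add up to 3. A factorization into
  nonconstants would consist of a line and a conic.\<close>

lemma smooth_cubic_prime:
  assumes "plane_cubic f" "smooth_projectivization f"
  shows "prime_elem f"
proof (rule irreducible_imp_prime_elem, rule irreducibleI)
  have f3: "f \<in> polys_le 3" "top_form 3 f \<noteq> 0"
    using assms(1) top_form_eq_0_iff[of f 2]
    by (auto simp: plane_cubic_def eval_nat_numeral)
  show "f \<noteq> 0"
  proof
    assume "f = 0"
    then have "top_form 3 f = 0" by (simp add: top_form_def)
    with f3(2) show False by simp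
  qed
  show "\<not> f dvd 1"
  proof
    assume "f dvd 1"
    then obtain c where "f = [:[:c:]:]" by (auto simp: is_unit_poly_iff)
    then have "f = smult [:c:] 1" by simp
    then have "f \<in> polys_le 2" using polys_le_smult[OF one_in_polys_le] by metis
    with assms(1) show False by (simp add: plane_cubic_def)
  qed
  fix g h assume f: "f = g * h"
  with \<open>f \<noteq> 0\<close> have "g \<noteq> 0" "h \<noteq> 0" by auto
  then obtain a b where g: "g \<in> polys_le a" "top_form a g \<noteq> 0" and h: "h \<in> polys_le b" "top_form b h \<noteq> 0"
    using ex_total_degree by meson
  have "top_form (a + b) f \<noteq> 0" using top_form_mult[OF g(1) h(1)] g h f by simp
  moreover have "f \<in> polys_le (a + b)" using polys_le_mult[OF g(1) h(1)] f by simp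
  ultimately have ab: "a + b = 3"
    using f3 top_form_eq_0 by (metis linorder_neqE_nat)
  have unit: "p dvd 1" if "p \<in> polys_le 0" "p \<noteq> 0" for p :: "real poly poly"
  proof -
    have "p = [:[:cf p (0, 0):]:]"
    proof (rule poly_eq_cfI)
      fix s
      have "[:[:cf p (0, 0):]:] = smult [:cf p (0, 0):] (mon (0, 0))" by (simp add: mon_0)
      then have "cf [:[:cf p (0, 0):]:] s = cf p (0, 0) * cf (mon (0, 0)) s" by (simp only: cf_smult)
      then show "cf p s = cf [:[:cf p (0, 0):]:] s"
        using that(1) by (cases s) (auto simp: cf_mon polys_le_iff mons_def)
    qed
    with that(2) show ?thesis
      by (metis is_unit_pCons_iff is_unit_poly_iff pCons_0_0 dvd_field_iff)
  qed
  have "a \<noteq> 1" using smooth_not_line_times_conic[of g h] assms(2) f g h ab by auto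
  moreover have "b \<noteq> 1"
    using smooth_not_line_times_conic[of h g] assms(2) f g h ab by (auto simp: mult.commute)
  ultimately have "a = 0 \<or> b = 0" using ab by linarith
  then show "g dvd 1 \<or> h dvd 1" using unit g h \<open>g \<noteq> 0\<close> \<open>h \<noteq> 0\<close> by auto
qed

section \<open>Intersections of a smooth cubic with real curves\<close>

definition lin :: "real ^ 3 \<Rightarrow> real poly poly" where
  "lin a = smult [:a $ 1:] (mon (1, 0)) + smult [:a $ 2:] (mon (0, 1)) + smult [:a $ 3:] 1"

lemma lin_in_polys_le: "lin a \<in> polys_le 1"
  unfolding lin_def
  by (intro polys_le_add polys_le_smult mon_in_polys_le one_in_polys_le) (auto simp: mons_def)

lemma hev_lin: "hev 1 (lin a) v = a \<bullet> v"
proof -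
  have "hev 1 (mon (1, 0)) v = v $ 1" "hev 1 (mon (0, 1)) v = v $ 2"
    by (auto simp: hev_def hg_mon mons_def)
  then show ?thesis
    unfolding lin_def hev_add hev_smult hev_one by (simp add: inner_vec_def sum_3)
qed

lemma grd_lin: "grd 1 (lin a) v = a"
proof (rule grd_eqI)
  have "hev 1 (lin a) = (\<lambda>v. a \<bullet> v)" by (rule ext) (rule hev_lin)
  then show "(hev 1 (lin a) has_derivative (\<lambda>h. a \<bullet> h)) (at v)"
    by (simp only:) (rule bounded_linear_imp_has_derivative[OF bounded_linear_inner_right])
qed

lemma cf_eq_0: "p \<in> polys_le n \<Longrightarrow> s \<notin> mons n \<Longrightarrow> cf p s = 0"
  unfolding polys_le_iff by blast

section \<open>Linear dependence by counting monomials\<close>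

lemma polys_dependent:
  fixes g :: "'i \<Rightarrow> real poly poly"
  assumes "finite I" "card (mons n) < card I" "\<And>i. i \<in> I \<Longrightarrow> g i \<in> polys_le n"
  shows "\<exists>c. (\<exists>i\<in>I. c i \<noteq> 0) \<and> (\<Sum>i\<in>I. smult [:c i:] (g i)) = 0"
proof -
  obtain c where c: "\<exists>i\<in>I. c i \<noteq> 0" "\<forall>s\<in>mons n. (\<Sum>i\<in>I. c i * cf (g i) s) = 0"
    using homogeneous_system_nontrivial_solution[OF finite_mons assms(1,2), of "\<lambda>i. cf (g i)"] by blast
  have "(\<Sum>i\<in>I. smult [:c i:] (g i)) = 0"
  proof (rule poly_eq_cfI)
    fix s
    have "(\<Sum>i\<in>I. smult [:c i:] (g i)) \<in> polys_le n"
      by (intro polys_le_sum polys_le_smult assms(3))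
    then have "cf (\<Sum>i\<in>I. smult [:c i:] (g i)) s = 0" if "s \<notin> mons n"
      using that by (rule cf_eq_0)
    then show "cf (\<Sum>i\<in>I. smult [:c i:] (g i)) s = cf 0 s"
      using c(2) by (cases "s \<in> mons n") (auto simp: cf_sum)
  qed
  with c(1) show ?thesis by blast
qed

lemma comb_eq_0: "finite S \<Longrightarrow> comb S c = 0 \<Longrightarrow> s \<in> S \<Longrightarrow> c s = 0"
  using cf_comb[of S c s] by simp

lemma mult_comb: "p * comb S c = (\<Sum>s\<in>S. smult [:c s:] (p * mon s))"
  by (simp add: comb_def sum_distrib_left)

lemma card_mons: "2 * card (mons n) = (n + 1) * (n + 2)"
proof (induction n)
  case 0
  have "mons 0 = {(0, 0)}" by (auto simp: mons_def)
  then show ?case by simp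
next
  case (Suc n)
  have "mons (Suc n) = mons n \<union> (\<lambda>j. (Suc n - j, j)) ` {..Suc n}"
  proof (intro equalityI subsetI)
    fix s assume s: "s \<in> mons (Suc n)"
    show "s \<in> mons n \<union> (\<lambda>j. (Suc n - j, j)) ` {..Suc n}"
    proof (cases "fst s + snd s = Suc n")
      case True
      then have "s = (Suc n - snd s, snd s)" "snd s \<le> Suc n" by (auto simp: prod_eq_iff)
      then show ?thesis by blast
    qed (use s in \<open>auto simp: mons_def\<close>)
  qed (auto simp: mons_def)
  moreover have "mons n \<inter> (\<lambda>j. (Suc n - j, j)) ` {..Suc n} = {}"
    by (auto simp: mons_def)
  moreover have "card ((\<lambda>j. (Suc n - j, j)) ` {..Suc n}) = Suc (Suc n)"
    by (subst card_image) (auto intro: inj_onI)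
  ultimately have "card (mons (Suc n)) = card (mons n) + Suc (Suc n)"
    by (simp only: card_Un_disjoint[OF finite_mons finite_imageI[OF finite_atMost]])
  then show ?case using Suc.IH by simp
qed

text \<open>The vectors represent pairwise distinct points of the projective plane; collinearity
  refers to pairs of vectors on a line through the origin. Three of the points may well lie on one
  projective line.\<close>

definition noncollinear :: "'i set \<Rightarrow> ('i \<Rightarrow> real ^ 3) \<Rightarrow> bool" where
  "noncollinear I v \<longleftrightarrow> (\<forall>i\<in>I. v i \<noteq> 0) \<and> (\<forall>i\<in>I. \<forall>j\<in>I. i \<noteq> j \<longrightarrow> cross3 (v i) (v j) \<noteq> 0)"

lemma noncollinear_subset:
  assumes "noncollinear I v" "J \<subseteq> I"
  shows "noncollinear J v"
proof -
  have "v i \<noteq> 0" if "i \<in> J" for i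
    using that assms by (auto simp: noncollinear_def)
  moreover have "cross3 (v i) (v j) \<noteq> 0" if "i \<in> J" "j \<in> J" "i \<noteq> j" for i j
    using that assms subsetD[OF assms(2)] unfolding noncollinear_def by metis
  ultimately show ?thesis by (simp add: noncollinear_def)
qed

text \<open>The witness is the component of \<open>u\<close> orthogonal to \<open>w\<close>,
  multiplied by the squared length of \<open>w\<close>.\<close>

lemma ex_linear_form_separating:
  fixes u w :: "real ^ 3"
  assumes "cross3 u w \<noteq> 0"
  shows "\<exists>a. a \<bullet> w = 0 \<and> a \<bullet> u \<noteq> 0"
proof (intro exI conjI)
  show "cross3 w (cross3 u w) \<bullet> w = 0" by (simp add: dot_cross_self)
  have "cross3 w (cross3 u w) \<bullet> u = (cross3 u w) \<bullet> (cross3 u w)"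
    using cross_triple[of w "cross3 u w" u] cross_triple[of "cross3 u w" u w] by simp
  then show "cross3 w (cross3 u w) \<bullet> u \<noteq> 0" using assms by simp
qed

text \<open>A product of squared linear forms, one square for each point of \<open>K\<close>; the
  remaining degree is filled with powers of a linear form that does not vanish at
  \<open>v i\<close>.\<close>

lemma ex_jet_interpolant:
  assumes "finite K" "noncollinear (insert i K) v" "i \<notin> K" "2 * card K \<le> n"
  shows "\<exists>g\<in>polys_le n. hev n g (v i) \<noteq> 0 \<and> (\<forall>j\<in>K. hev n g (v j) = 0 \<and> grd n g (v j) = 0)"
  using assms
proof (induction K arbitrary: n rule: finite_induct)
  case empty
  show ?case
  proof (intro bexI conjI ballI)
    have *: "lin (v i) ^ n \<in> polys_le n \<and> hev n (lin (v i) ^ n) (v i) = (v i \<bullet> v i) ^ n"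
    proof (induction n)
      case 0
      then show ?case by (simp add: one_in_polys_le hev_one)
    next
      case (Suc n)
      then show ?case
        using polys_le_mult[OF lin_in_polys_le, of "lin (v i) ^ n" n "v i"]
          hev_mult[OF lin_in_polys_le, of "lin (v i) ^ n" n "v i" "v i"]
        by (simp add: hev_lin[unfolded One_nat_def])
    qed
    then show "lin (v i) ^ n \<in> polys_le n" by blast
    show "hev n (lin (v i) ^ n) (v i) \<noteq> 0"
      using * empty.prems by (simp add: noncollinear_def)
  qed auto
next
  case (insert k K)
  have nc: "noncollinear (insert i K) v"
    using insert.prems(1) by (rule noncollinear_subset) auto
  obtain m where n: "n = 1 + (1 + m)" "2 * card K \<le> m"
    using insert.prems insert.hyps by (intro that[of "n - 2"]) auto
  obtain g where g: "g \<in> polys_le m" "hev m g (v i) \<noteq> 0" "\<forall>j\<in>K. hev m g (v j) = 0 \<and> grd m g (v j) = 0"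
    using insert.IH[OF nc _ n(2)] insert.prems by auto
  have "cross3 (v i) (v k) \<noteq> 0"
    using insert.prems unfolding noncollinear_def by blast
  then obtain a where a: "a \<bullet> v k = 0" "a \<bullet> v i \<noteq> 0" using ex_linear_form_separating by blast
  have ag: "lin a * g \<in> polys_le (1 + m)" using polys_le_mult[OF lin_in_polys_le g(1)] .
  show ?case
  proof (intro bexI conjI ballI)
    show "lin a * (lin a * g) \<in> polys_le n" unfolding n using polys_le_mult[OF lin_in_polys_le ag] .
    show "hev n (lin a * (lin a * g)) (v i) \<noteq> 0"
      unfolding n hev_mult[OF lin_in_polys_le ag] hev_mult[OF lin_in_polys_le g(1)] hev_lin
      using a g by simp
    fix j assume "j \<in> insert k K"
    then have "a \<bullet> v j = 0 \<or> hev m g (v j) = 0 \<and> grd m g (v j) = 0" using a g by auto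
    then show "hev n (lin a * (lin a * g)) (v j) = 0" "grd n (lin a * (lin a * g)) (v j) = 0"
      unfolding n hev_mult[OF lin_in_polys_le ag] hev_mult[OF lin_in_polys_le g(1)] hev_lin
        grd_mult[OF lin_in_polys_le ag] grd_mult[OF lin_in_polys_le g(1)] grd_lin
      by auto
  qed
qed

section \<open>The cone over a smooth cubic\<close>

locale smooth_cubic =
  fixes f :: "real poly poly"
  assumes cubic: "plane_cubic f" and smooth: "smooth_projectivization f"
begin

lemma f_in_polys_le: "f \<in> polys_le 3"
  using cubic by (simp add: plane_cubic_def)

lemma top_form_f: "top_form 3 f \<noteq> 0"
  using cubic top_form_eq_0_iff[of f 2] by (auto simp: plane_cubic_def numeral_3_eq_3 numeral_2_eq_2)

lemma prime_f: "prime_elem f"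
  using smooth_cubic_prime[OF cubic smooth] .

lemma f_nonzero: "f \<noteq> 0"
  using prime_f by auto

definition C :: "(real ^ 3) set" where
  "C = {v. hev 3 f v = 0}"

text \<open>A tangent vector of the cone at \<open>v\<close>, orthogonal to the ray through
  \<open>v\<close>. Euler's identity determines the derivative along the ray, so at a zero on the
  curve a vanishing derivative along \<open>\<tau> v\<close> means a double zero.\<close>

definition \<tau> :: "real ^ 3 \<Rightarrow> real ^ 3" where
  "\<tau> v = cross3 (grd 3 f v) v"

lemma grd_f: "v \<in> C \<Longrightarrow> v \<noteq> 0 \<Longrightarrow> grd 3 f v \<noteq> 0"
  using smooth_projectivization_grd[OF smooth] by (simp add: C_def)

lemma grd_f_inner: "v \<in> C \<Longrightarrow> grd 3 f v \<bullet> v = 0"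
  by (simp add: grd_euler C_def)

lemma scale_in_C: "v \<in> C \<Longrightarrow> t *\<^sub>R v \<in> C"
  by (simp add: C_def hev_scale)

lemma \<tau>_nonzero: assumes "v \<in> C" "v \<noteq> 0" shows "\<tau> v \<noteq> 0"
proof
  assume "\<tau> v = 0"
  then have "(norm (grd 3 f v) * norm v)\<^sup>2 = 0"
    using norm_cross_dot[of "grd 3 f v" v] grd_f_inner[OF assms(1)] by (simp add: \<tau>_def)
  then show False using assms grd_f by simp
qed

lemma grd_f_\<tau>: "grd 3 f v \<bullet> \<tau> v = 0"
  by (simp add: \<tau>_def dot_cross_self)

text \<open>
  The leading monomial of \<open>f\<close> for the degree order in which a higher power of \<open>y\<close> wins is
  \<open>x ^ (3 - lead_y) * y ^ lead_y\<close>; \<open>Std k\<close> indexes the monomials of degree at most \<open>k\<close> that it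
  does not divide.
\<close>

definition lead_y :: nat where
  "lead_y = degree (top_form 3 f)"

definition Std :: "nat \<Rightarrow> (nat \<times> nat) set" where
  "Std k = {s \<in> mons k. \<not> (3 - lead_y \<le> fst s \<and> lead_y \<le> snd s)}"

lemma lead_y_le: "lead_y \<le> 3"
  unfolding lead_y_def by (rule degree_le) (simp add: coeff_top_form)

lemma finite_Std [simp]: "finite (Std k)"
  by (rule finite_subset[OF _ finite_mons]) (auto simp: Std_def)

lemma Std_subset: "Std k \<subseteq> mons k"
  by (auto simp: Std_def)

lemma mon_Std_in_polys_le: "s \<in> Std k \<Longrightarrow> mon s \<in> polys_le k"
  using Std_subset by (blast intro: mon_in_polys_le)

lemma comb_Std_in_polys_le: "comb (Std k) c \<in> polys_le k"
  using Std_subset by (rule comb_in_polys_le)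

text \<open>The leading monomial of a nonzero multiple of \<open>f\<close> is divisible by that of
  \<open>f\<close>, and hence it is not standard.\<close>

lemma comb_Std_multiple:
  assumes "comb (Std k) c = f * q"
  shows "q = 0"
proof (rule ccontr)
  assume "q \<noteq> 0"
  then obtain n where n: "q \<in> polys_le n" "top_form n q \<noteq> 0" using ex_total_degree by blast
  define e where "e = degree (top_form n q)"
  have e: "e \<le> n" unfolding e_def by (rule degree_le) (simp add: coeff_top_form)
  have "coeff (top_form (3 + n) (f * q)) (lead_y + e) = lead_coeff (top_form 3 f) * lead_coeff (top_form n q)"
    unfolding top_form_mult[OF f_in_polys_le n(1)] lead_y_def e_def by (rule coeff_mult_degree_sum)
  then have "coeff (top_form (3 + n) (f * q)) (lead_y + e) \<noteq> 0"
    using top_form_f n(2) by simp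
  then have "cf (comb (Std k) c) (3 + n - (lead_y + e), lead_y + e) \<noteq> 0"
    unfolding assms using lead_y_le e by (simp add: coeff_top_form)
  then have "(3 + n - (lead_y + e), lead_y + e) \<in> Std k"
    by (simp add: cf_comb split: if_splits)
  then show False using lead_y_le e by (auto simp: Std_def)
qed

lemma comb_Std_dvd: "f dvd comb (Std k) c \<Longrightarrow> s \<in> Std k \<Longrightarrow> c s = 0"
  using comb_Std_multiple comb_eq_0[OF finite_Std] by (metis dvdE mult_zero_right)

lemma mons_eq_Std_Un: "k \<ge> 3 \<Longrightarrow>
    mons k = Std k \<union> (\<lambda>s. (fst s + (3 - lead_y), snd s + lead_y)) ` mons (k - 3)"
  (is "_ \<Longrightarrow> _ = _ \<union> ?g ` _")
proof (intro equalityI subsetI)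
  fix s assume k: "k \<ge> 3" and s: "s \<in> mons k"
  show "s \<in> Std k \<union> ?g ` mons (k - 3)"
  proof (cases "s \<in> Std k")
    case False
    then have *: "3 - lead_y \<le> fst s" "lead_y \<le> snd s" using s by (auto simp: Std_def)
    then have "s = ?g (fst s - (3 - lead_y), snd s - lead_y)" by (simp add: prod_eq_iff)
    moreover have "(fst s - (3 - lead_y), snd s - lead_y) \<in> mons (k - 3)"
      using s k * lead_y_le by (auto simp: mons_def)
    ultimately show ?thesis by blast
  qed auto
next
  fix s assume "k \<ge> 3" "s \<in> Std k \<union> ?g ` mons (k - 3)"
  then show "s \<in> mons k" using lead_y_le by (auto simp: Std_def mons_def)
qed

lemma card_mons_Std: "k \<ge> 3 \<Longrightarrow> card (mons k) = card (Std k) + card (mons (k - 3))"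
  by (subst mons_eq_Std_Un, assumption, subst card_Un_disjoint)
    (auto simp: Std_def intro!: card_image inj_onI prod_eqI)

text \<open>The Hilbert function of a plane cubic. In degree 0 the value is 1, so \<open>k\<close>
  has to be positive.\<close>

lemma card_Std: "k \<ge> 1 \<Longrightarrow> card (Std k) = 3 * k"
proof -
  assume k: "k \<ge> 1"
  show ?thesis
  proof (cases "k \<ge> 3")
    case True
    then obtain n where "k = n + 3" by (metis le_add_diff_inverse2)
    then show ?thesis
      using card_mons_Std[OF True] card_mons[of k] card_mons[of "k - 3"] by (simp add: algebra_simps)
  next
    case False
    then have "Std k = mons k" using lead_y_le by (auto simp: Std_def mons_def)
    moreover have "k = 1 \<or> k = 2" using False k by auto
    ultimately show ?thesis using card_mons[of k] by auto
  qed
qed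

text \<open>A dimension count replaces the division algorithm: standard monomials, multiples of
  \<open>f\<close> and \<open>p\<close> are one polynomial too many, and without \<open>p\<close>
  they are independent. The quotient is 0 for \<open>k < 3\<close>, where the truncated
  \<open>k - 3\<close> would still admit constants.\<close>

lemma reduce_to_Std:
  assumes "p \<in> polys_le k"
  shows "\<exists>c q. p = comb (Std k) c + f * q \<and> (q = 0 \<or> k \<ge> 3 \<and> q \<in> polys_le (k - 3))"
proof (cases "k \<ge> 3")
  case False
  then have "Std k = mons k" using lead_y_le by (auto simp: Std_def mons_def)
  then show ?thesis using comb_cf[OF assms] by (intro exI[of _ "cf p"] exI[of _ 0]) simp
next
  case True
  \<comment> \<open>The tags 0, 1 and 2 mark the standard monomials, the multiples of
    \<open>f\<close>, and \<open>p\<close>.\<close>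
  define I where "I = (Pair (0::nat) ` Std k \<union> Pair 1 ` mons (k - 3)) \<union> {(2, (0::nat, 0::nat))}"
  define g where "g i = (if fst i = (0::nat) then mon (snd i) else if fst i = 1 then f * mon (snd i) else p)" for i
  have fin: "finite I" by (simp add: I_def)
  have "card I = card (Std k) + card (mons (k - 3)) + 1"
    unfolding I_def
    by (subst card_Un_disjoint, simp, simp, force, subst card_Un_disjoint) (auto simp: card_image inj_on_def)
  then have "card (mons k) < card I" using card_mons_Std[OF True] by simp
  moreover have "g i \<in> polys_le k" if i: "i \<in> I" for i
  proof -
    have "f * mon s \<in> polys_le k" if "s \<in> mons (k - 3)" for s
      using polys_le_mult[OF f_in_polys_le mon_in_polys_le[OF that]] True by simp
    with i assms show ?thesis
      by (cases i) (auto simp: I_def g_def intro: mon_Std_in_polys_le)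
  qed
  ultimately obtain c where c: "\<exists>i\<in>I. c i \<noteq> 0" "(\<Sum>i\<in>I. smult [:c i:] (g i)) = 0"
    using polys_dependent[OF fin, of k g] by blast
  define A B where "A = comb (Std k) (\<lambda>s. c (0, s))" and "B = comb (mons (k - 3)) (\<lambda>s. c (1, s))"
  have "(\<Sum>i\<in>I. smult [:c i:] (g i)) = A + f * B + smult [:c (2, (0, 0)):] p"
    unfolding I_def A_def B_def mult_comb unfolding comb_def
    by (subst sum.union_disjoint, simp, simp, force, subst sum.union_disjoint)
      (auto simp: g_def sum.reindex inj_on_def)
  with c(2) have eq: "A + f * B + smult [:c (2, (0, 0)):] p = 0" by simp
  have c2: "c (2, (0, 0)) \<noteq> 0"
  proof
    assume 0: "c (2, (0, 0)) = 0"
    with eq have "A = f * (- B)" by (simp add: eq_neg_iff_add_eq_0)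
    then have "- B = 0" unfolding A_def by (rule comb_Std_multiple)
    then have "B = 0" "A = 0" using \<open>A = f * (- B)\<close> by auto
    then have "\<forall>i\<in>I. c i = 0"
      using 0 comb_eq_0[OF finite_Std] comb_eq_0[OF finite_mons] by (auto simp: I_def A_def B_def)
    with c(1) show False by blast
  qed
  define t where "t = - inverse (c (2, (0, 0)))"
  have "smult [:t:] (smult [:c (2, (0, 0)):] p) = - p"
    by (rule poly_eq_cfI) (simp only: cf_smult cf_minus, simp add: c2 t_def)
  moreover have "smult [:t:] (A + f * B + smult [:c (2, (0, 0)):] p) = 0" using eq by simp
  ultimately have "p = smult [:t:] A + f * smult [:t:] B"
    by (simp add: smult_add_right)
  moreover have "smult [:t:] A = comb (Std k) (\<lambda>s. t * c (0, s))"
    by (rule poly_eq_cfI) (simp add: A_def cf_comb)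
  moreover have "smult [:t:] B \<in> polys_le (k - 3)"
    unfolding B_def by (intro polys_le_smult comb_in_polys_le) simp
  ultimately show ?thesis using True by metis
qed

text \<open>A form with double zeros at all other points isolates one point. Multiplied by the
  linear form \<open>lin (\<tau> (v i))\<close> it vanishes at \<open>v i\<close> too, but not to
  first order, and this isolates \<open>b i\<close>; once the \<open>b i\<close> are gone, the form
  itself isolates \<open>a i\<close>.\<close>

lemma jets_independent:
  fixes a b :: "'i \<Rightarrow> real"
  assumes "finite I" "v ` I \<subseteq> C" "noncollinear I v" "D \<subseteq> I" "2 * card I \<le> n"
    and rel: "\<And>g. g \<in> polys_le n \<Longrightarrow>
      (\<Sum>i\<in>I. a i * hev n g (v i)) + (\<Sum>i\<in>D. b i * (grd n g (v i) \<bullet> \<tau> (v i))) = 0"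
  shows "(\<forall>i\<in>I. a i = 0) \<and> (\<forall>i\<in>D. b i = 0)"
proof -
  have finD: "finite D" using assms finite_subset by blast
  have ins: "insert i (I - {i}) = I" "2 * card (I - {i}) + 2 \<le> n" if "i \<in> I" for i
    using that assms(1,5) card_Suc_Diff1[OF assms(1) that] by auto
  have b0: "b i = 0" if i: "i \<in> D" for i
  proof -
    have iI: "i \<in> I" using i assms by auto
    have "2 * card (I - {i}) \<le> n - 1" and n: "n = 1 + (n - 1)" using ins[OF iI] by linarith+
    then obtain g where g: "g \<in> polys_le (n - 1)" "hev (n - 1) g (v i) \<noteq> 0"
      "\<forall>j\<in>I - {i}. hev (n - 1) g (v j) = 0 \<and> grd (n - 1) g (v j) = 0"
      using ex_jet_interpolant[of "I - {i}" i v "n - 1"] assms ins iI by auto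
    let ?l = "lin (\<tau> (v i))"
    have l0: "\<tau> (v i) \<bullet> v i = 0" by (simp add: \<tau>_def dot_cross_self)
    have mem: "?l * g \<in> polys_le n" using polys_le_mult[OF lin_in_polys_le g(1)] n by simp
    have h: "hev n (?l * g) w = (\<tau> (v i) \<bullet> w) * hev (n - 1) g w" for w
      using hev_mult[OF lin_in_polys_le g(1)] n by (metis hev_lin)
    have d: "grd n (?l * g) w = (\<tau> (v i) \<bullet> w) *\<^sub>R grd (n - 1) g w + hev (n - 1) g w *\<^sub>R \<tau> (v i)" for w
      using grd_mult[OF lin_in_polys_le g(1)] n by (metis hev_lin grd_lin)
    have "(\<Sum>j\<in>I. a j * hev n (?l * g) (v j)) = 0"
      using g l0 by (intro sum.neutral) (auto simp: h)
    moreover have "(\<Sum>j\<in>D. b j * (grd n (?l * g) (v j) \<bullet> \<tau> (v j)))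
        = b i * (grd n (?l * g) (v i) \<bullet> \<tau> (v i))"
    proof -
      have "b j * (grd n (?l * g) (v j) \<bullet> \<tau> (v j)) = 0" if "j \<in> D - {i}" for j
      proof -
        have "j \<in> I - {i}" using that assms(4) by blast
        then show ?thesis using g(3) unfolding d by simp
      qed
      then show ?thesis by (subst sum.remove[OF finD i]) (simp add: sum.neutral)
    qed
    moreover have "grd n (?l * g) (v i) \<bullet> \<tau> (v i) \<noteq> 0"
      using g(2) l0 \<tau>_nonzero[of "v i"] assms iI by (auto simp: d noncollinear_def)
    ultimately show ?thesis using rel[OF mem] by simp
  qed
  have "a i = 0" if i: "i \<in> I" for i
  proof -
    obtain g where g: "g \<in> polys_le n" "hev n g (v i) \<noteq> 0"
      "\<forall>j\<in>I - {i}. hev n g (v j) = 0 \<and> grd n g (v j) = 0"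
      using ex_jet_interpolant[of "I - {i}" i v n] assms ins[OF i] by auto
    have "(\<Sum>j\<in>I. a j * hev n g (v j)) = a i * hev n g (v i)"
      using g by (subst sum.remove[OF assms(1) i]) (auto intro!: sum.neutral)
    then show ?thesis using rel[OF g(1)] g(2) b0 by simp
  qed
  with b0 show ?thesis by blast
qed

text \<open>In a large degree \<open>n\<close>, the multiples of \<open>f\<close> together with
  \<open>p\<close> times the standard monomials of degree \<open>n - k\<close> satisfy all jet
  conditions. Since \<open>f\<close> is prime and does not divide \<open>p\<close>, they span a
  space of codimension \<open>3 * n - 3 * (n - k)\<close>, which is \<open>3 * k\<close>;
  independent conditions on which this space vanishes cannot be more numerous.\<close>

lemma bezout:
  assumes "p \<in> polys_le k" "\<not> f dvd p" "finite I" "v ` I \<subseteq> C" "noncollinear I v"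
    and zero: "\<And>i. i \<in> I \<Longrightarrow> hev k p (v i) = 0"
    and D: "D \<subseteq> I" and double: "\<And>i. i \<in> D \<Longrightarrow> grd k p (v i) \<bullet> \<tau> (v i) = 0"
  shows "card I + card D \<le> 3 * k"
proof (rule ccontr)
  assume many: "\<not> ?thesis"
  \<comment> \<open>The summand \<open>2 * card I\<close> makes the jets independent, and
    \<open>k + 3\<close> provides the multipliers of \<open>f\<close> and \<open>p\<close> and puts
    \<open>n - k\<close> in the range of \<open>card_Std\<close>.\<close>
  define n where "n = k + 3 + 2 * card I"
  have n: "n = 3 + (n - 3)" "n = k + (n - k)" "n \<ge> 3" "n - k \<ge> 1" "n \<ge> 1" by (auto simp: n_def)
  define J where "J = I <+> D"
  define l where "l j g = (case j of Inl i \<Rightarrow> hev n g (v i) | Inr i \<Rightarrow> grd n g (v i) \<bullet> \<tau> (v i))" for j g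
  have finD: "finite D" using assms finite_subset by blast
  have finJ: "finite J" using assms(3) finD by (simp add: J_def)
  have l_sum: "l j (\<Sum>i\<in>K. smult [:c i:] (g i)) = (\<Sum>i\<in>K. c i * l j (g i))" for j c g and K :: "'k set"
    by (cases j) (simp_all add: l_def hev_sum hev_smult grd_sum grd_smult inner_sum_left)
  have l_add: "l j (g + h) = l j g + l j h" for j g h
    by (cases j) (simp_all add: l_def hev_add grd_add inner_add_left)
  have "\<forall>j\<in>J. c j = 0" if c: "\<And>s. s \<in> mons n \<Longrightarrow> (\<Sum>j\<in>J. c j * l j (mon s)) = 0" for c
  proof -
    have split: "(\<Sum>j\<in>J. c j * l j g) = (\<Sum>i\<in>I. c (Inl i) * hev n g (v i))
        + (\<Sum>i\<in>D. c (Inr i) * (grd n g (v i) \<bullet> \<tau> (v i)))" for g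
      unfolding J_def using assms(3) finD by (simp add: sum.Plus l_def)
    have "(\<Sum>j\<in>J. c j * l j g) = 0" if g: "g \<in> polys_le n" for g
    proof -
      have "(\<Sum>j\<in>J. c j * l j (comb (mons n) (cf g))) = (\<Sum>s\<in>mons n. cf g s * (\<Sum>j\<in>J. c j * l j (mon s)))"
        unfolding comb_def l_sum sum_distrib_left by (subst sum.swap) (simp add: mult_ac)
      then show ?thesis using c comb_cf[OF g] by simp
    qed
    then have "(\<forall>i\<in>I. c (Inl i) = 0) \<and> (\<forall>i\<in>D. c (Inr i) = 0)"
      by (intro jets_independent[OF assms(3-5) D, of n]) (auto simp: split n_def)
    then show ?thesis by (auto simp: J_def)
  qed
  then obtain e where e: "\<And>j j'. j \<in> J \<Longrightarrow> j' \<in> J \<Longrightarrow>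
      (\<Sum>s\<in>mons n. l j (mon s) * e j' s) = (if j = j' then 1 else 0)"
    using dual_vectors_of_independent_rows[OF finJ finite_mons, of n "\<lambda>j s. l j (mon s)"] by blast
  \<comment> \<open>Forms dual to the jet conditions. They complement the space above, so that too
    many conditions turn into a linear dependence.\<close>
  define G where "G j = comb (mons n) (e j)" for j
  have lG: "l j (G j') = (if j = j' then 1 else 0)" if "j \<in> J" "j' \<in> J" for j j'
    unfolding G_def comb_def l_sum using e[OF that] by (simp add: mult.commute)
  define K where "K = (Inl ` Inl ` mons (n - 3) \<union> Inl ` Inr ` Std (n - k)) \<union> Inr ` J"
  define g where "g i = (case i of Inl (Inl s) \<Rightarrow> f * mon s | Inl (Inr s) \<Rightarrow> p * mon s | Inr j \<Rightarrow> G j)" for i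
  have finK: "finite K" using finJ by (simp add: K_def)
  have cardK: "card K = card (mons (n - 3)) + card (Std (n - k)) + card J"
    unfolding K_def using finJ
    by (subst card_Un_disjoint, simp, simp, force, subst card_Un_disjoint)
      (auto simp: card_image inj_on_def)
  have "card J = card I + card D" unfolding J_def using assms(3) finD by (rule card_Plus)
  moreover have "card (Std n) = 3 * n" "card (Std (n - k)) = 3 * (n - k)"
    using n card_Std by blast+
  ultimately have "card (mons n) < card K"
    using many cardK card_mons_Std[OF n(3)] n(2) by linarith
  moreover have "f * mon s \<in> polys_le n" if "s \<in> mons (n - 3)" for s
    using polys_le_mult[OF f_in_polys_le mon_in_polys_le[OF that]] unfolding n(1)[symmetric] .
  moreover have "p * mon s \<in> polys_le n" if "s \<in> Std (n - k)" for s
    using polys_le_mult[OF assms(1) mon_Std_in_polys_le[OF that]] unfolding n(2)[symmetric] .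
  moreover have "G j \<in> polys_le n" for j
    unfolding G_def by (rule comb_in_polys_le) simp
  ultimately have "card (mons n) < card K" "\<And>i. i \<in> K \<Longrightarrow> g i \<in> polys_le n"
    by (auto simp: K_def g_def simp del: split_paired_All)
  then obtain c where c: "\<exists>i\<in>K. c i \<noteq> 0" "(\<Sum>i\<in>K. smult [:c i:] (g i)) = 0"
    using polys_dependent[OF finK] by blast
  define A B where "A = comb (mons (n - 3)) (\<lambda>s. c (Inl (Inl s)))"
    and "B = comb (Std (n - k)) (\<lambda>s. c (Inl (Inr s)))"
  define E where "E = (\<Sum>j\<in>J. smult [:c (Inr j):] (G j))"
  have "(\<Sum>i\<in>K. smult [:c i:] (g i)) = f * A + p * B + E"
    unfolding K_def A_def B_def E_def mult_comb using finJ
    by (subst sum.union_disjoint, simp, simp, force, subst sum.union_disjoint)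
      (auto simp: g_def sum.reindex inj_on_def)
  with c(2) have eq: "f * A + p * B + E = 0" by simp
  have A: "A \<in> polys_le (n - 3)" and B: "B \<in> polys_le (n - k)"
    unfolding A_def B_def by (auto intro: comb_in_polys_le comb_Std_in_polys_le)
  have vC: "hev 3 f (v i) = 0" if "i \<in> I" for i using that assms(4) by (auto simp: C_def)
  \<comment> \<open>On the curve the product rule leaves the gradient of \<open>f\<close> times a
    scalar, and \<open>\<tau>\<close> is orthogonal to it.\<close>
  have lA: "l j (f * A) = 0" if "j \<in> J" for j
  proof -
    have "hev n (f * A) (v i) = 0" "grd n (f * A) (v i) \<bullet> \<tau> (v i) = 0" if "i \<in> I" for i
      using hev_mult[OF f_in_polys_le A, of "v i"] grd_mult[OF f_in_polys_le A, of "v i"] vC[OF that]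
      unfolding n(1)[symmetric] by (simp_all add: grd_f_\<tau>)
    then show ?thesis using that D by (auto simp: J_def l_def)
  qed
  have lB: "l j (p * B) = 0" if "j \<in> J" for j
  proof -
    have "hev n (p * B) (v i) = 0" if "i \<in> I" for i
      using hev_mult[OF assms(1) B, of "v i"] zero[OF that] unfolding n(2)[symmetric] by simp
    moreover have "grd n (p * B) (v i) \<bullet> \<tau> (v i) = 0" if "i \<in> D" for i
      using grd_mult[OF assms(1) B, of "v i"] zero[of i] double[OF that] D that
      unfolding n(2)[symmetric] by auto
    ultimately show ?thesis using that by (auto simp: J_def l_def)
  qed
  \<comment> \<open>Condition \<open>j\<close> reads off the coefficient of \<open>G j\<close>,
    since it annihilates the two other groups.\<close>
  have cJ: "c (Inr j) = 0" if j: "j \<in> J" for j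
  proof -
    have "l j E = (\<Sum>j'\<in>J. if j = j' then c (Inr j') else 0)"
      unfolding E_def l_sum by (intro sum.cong) (auto simp: lG j)
    also have "\<dots> = c (Inr j)" using j finJ by simp
    finally have "l j (f * A + p * B + E) = c (Inr j)" by (simp add: l_add lA lB j)
    moreover have "l j 0 = 0" by (cases j) (simp_all add: l_def hev_0 grd_0)
    ultimately show ?thesis by (simp add: eq)
  qed
  then have "E = 0" by (simp add: E_def)
  with eq have fApB: "f * A + p * B = 0" by simp
  then have "p * B = f * (- A)" by (simp add: eq_neg_iff_add_eq_0 add.commute)
  then have "f dvd p * B" by (metis dvd_triv_left)
  then have "f dvd B" using prime_f assms(2) by (simp add: prime_elem_dvd_mult_iff)
  then have c1: "\<forall>s\<in>Std (n - k). c (Inl (Inr s)) = 0" unfolding B_def using comb_Std_dvd by blast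
  then have "B = 0" by (simp add: B_def comb_def)
  then have "A = 0" using fApB f_nonzero by simp
  then have "\<forall>s\<in>mons (n - 3). c (Inl (Inl s)) = 0"
    unfolding A_def using comb_eq_0[OF finite_mons] by blast
  with c1 cJ have "\<forall>i\<in>K. c i = 0" by (auto simp: K_def)
  with c(1) show False by blast
qed

text \<open>A zero on the cone brings its whole ray along, so finiteness is expressed by
  representatives. A largest family of distinct zeros exists by \<open>bezout\<close> and must meet
  every ray of zeros.\<close>

lemma finite_zeros:
  assumes "p \<in> polys_le k" "\<not> f dvd p"
  shows "\<exists>U. finite U \<and> U \<subseteq> C - {0} \<and> (\<forall>w\<in>C - {0}. hev k p w = 0 \<longrightarrow> (\<exists>u\<in>U. cross3 w u = 0))"
proof -
  define good where "good U \<longleftrightarrow> finite U \<and> U \<subseteq> C \<and> noncollinear U (\<lambda>u. u) \<and> (\<forall>u\<in>U. hev k p u = 0)" for U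
  have "card U \<le> 3 * k" if "good U" for U
  proof -
    have "card U + card ({} :: (real ^ 3) set) \<le> 3 * k"
      by (rule bezout[OF assms, where v = "\<lambda>u. u"]) (use that in \<open>simp_all add: good_def\<close>)
    then show ?thesis by simp
  qed
  then have "\<forall>U. good U \<longrightarrow> card U < Suc (3 * k)" by (simp add: le_imp_less_Suc)
  moreover have "good {}" by (simp add: good_def noncollinear_def)
  ultimately obtain U where U: "good U" "\<forall>V. good V \<longrightarrow> card V \<le> card U"
    using ex_has_greatest_nat[of good "{}" card "Suc (3 * k)"] by blast
  have "\<exists>u\<in>U. cross3 w u = 0" if w: "w \<in> C - {0}" "hev k p w = 0" for w
  proof (rule ccontr)
    assume no: "\<not> ?thesis"
    then have "w \<notin> U" using cross_refl[of w] by blast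
    have "cross3 u w \<noteq> 0" if "u \<in> U" for u
      using no that cross_skew[of u w] neg_equal_0_iff_equal[of "cross3 w u"] by presburger
    then have "noncollinear (insert w U) (\<lambda>u. u)"
      using U(1) w(1) no unfolding good_def noncollinear_def by blast
    then have "good (insert w U)" using U(1) w by (simp add: good_def)
    then have "card (insert w U) \<le> card U" using U(2) by blast
    moreover have "finite U" using U(1) by (simp add: good_def)
    ultimately show False using \<open>w \<notin> U\<close> by simp
  qed
  moreover have "finite U" "U \<subseteq> C - {0}" using U(1) unfolding good_def noncollinear_def by blast+
  ultimately show ?thesis by blast
qed

end

section \<open>Perturbation of finitely many points\<close>

text \<open>Tychonoff's theorem. It permits minimization over families indexed by any type, provided
  that irrelevant coordinates are confined as well.\<close>

lemma compact_functions_box: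
  fixes K :: "'a \<Rightarrow> 'b::topological_space set"
  assumes "\<And>i. compact (K i)"
  shows "compact {g. \<forall>i. g i \<in> K i}"
proof -
  have "compactin (product_topology (\<lambda>i. euclidean) UNIV) (PiE UNIV K)"
    using assms by (subst compactin_PiE) auto
  moreover have "PiE UNIV K = {g. \<forall>i. g i \<in> K i}" by (auto simp: PiE_iff)
  ultimately show ?thesis by (simp add: euclidean_product_topology)
qed

text \<open>
  At a point where the total error is minimal, one Newton step would halve that error, so the
  error is zero.
\<close>

lemma near_identity_system_solvable:
  fixes G :: "('j \<Rightarrow> real) \<Rightarrow> 'j \<Rightarrow> real"
  assumes "finite J" "r \<ge> 0"
    and strict: "\<And>y y'. \<forall>j\<in>J. \<bar>y j\<bar> \<le> r \<and> \<bar>y' j\<bar> \<le> r \<Longrightarrow>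
      2 * (\<Sum>j\<in>J. \<bar>G y j - G y' j - (y j - y' j)\<bar>) \<le> (\<Sum>j\<in>J. \<bar>y j - y' j\<bar>)"
    and cont: "\<And>j. j \<in> J \<Longrightarrow> continuous_on UNIV (\<lambda>y. G y j)"
    and close: "5 * (\<Sum>j\<in>J. \<bar>G (\<lambda>_. 0) j - c j\<bar>) \<le> r"
  shows "\<exists>y. (\<forall>j\<in>J. \<bar>y j\<bar> \<le> r) \<and> (\<forall>j\<in>J. G y j = c j)"
proof -
  define Q where "Q = {y :: 'j \<Rightarrow> real. \<forall>j. y j \<in> {-r..r}}"
  define h where "h y = (\<Sum>j\<in>J. \<bar>G y j - c j\<bar>)" for y
  have "compact Q" unfolding Q_def by (rule compact_functions_box) simp
  moreover have zero: "(\<lambda>_. 0) \<in> Q" using assms(2) by (simp add: Q_def)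
  moreover have "continuous_on Q h"
    unfolding h_def
    by (intro continuous_on_sum continuous_on_rabs continuous_on_diff continuous_on_const
        continuous_on_subset[OF cont subset_UNIV])
  ultimately obtain y where y: "y \<in> Q" "\<And>y'. y' \<in> Q \<Longrightarrow> h y \<le> h y'"
    using continuous_attains_inf[of Q h] by blast
  define e0 where "e0 = h (\<lambda>_. 0)"
  have e0: "h y \<le> e0" "5 * e0 \<le> r" using y(2)[OF zero] close by (simp_all add: e0_def h_def)
  have yb: "\<bar>y j\<bar> \<le> r" for j using y(1) by (auto simp: Q_def abs_le_iff minus_le_iff)
  define Y where "Y = (\<Sum>j\<in>J. \<bar>y j\<bar>)"
  have "Y \<le> (\<Sum>j\<in>J. \<bar>G y j - G (\<lambda>_. 0) j - y j\<bar> + (\<bar>G y j - c j\<bar> + \<bar>G (\<lambda>_. 0) j - c j\<bar>))"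
    unfolding Y_def by (rule sum_mono) linarith
  also have "\<dots> = (\<Sum>j\<in>J. \<bar>G y j - G (\<lambda>_. 0) j - y j\<bar>) + (h y + e0)"
    by (simp add: sum.distrib h_def e0_def)
  also have "2 * (\<Sum>j\<in>J. \<bar>G y j - G (\<lambda>_. 0) j - y j\<bar>) \<le> Y"
    using strict[of y "\<lambda>_. 0"] yb assms(2) by (simp add: Y_def)
  then have "(\<Sum>j\<in>J. \<bar>G y j - G (\<lambda>_. 0) j - y j\<bar>) + (h y + e0) \<le> Y / 2 + 2 * e0"
    using e0 by linarith
  finally have Y: "Y \<le> 4 * e0" by linarith
  \<comment> \<open>The Newton step with the identity as approximate derivative. It starts within
    \<open>4 * e0\<close> of the origin and moves by at most \<open>e0\<close>; this is the origin
    of the factor 5 in the hypothesis.\<close>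
  define y' where "y' j = (if j \<in> J then y j - (G y j - c j) else 0)" for j
  have y'b: "\<bar>y' j\<bar> \<le> r" for j
  proof (cases "j \<in> J")
    case True
    have "\<bar>y j\<bar> \<le> Y" "\<bar>G y j - c j\<bar> \<le> h y"
      unfolding Y_def h_def using True assms(1) by (auto intro!: member_le_sum)
    then have "\<bar>y j - (G y j - c j)\<bar> \<le> r" using Y e0 by linarith
    then show ?thesis using True by (simp add: y'_def)
  qed (use assms(2) in \<open>simp add: y'_def\<close>)
  then have "y' \<in> Q" by (auto simp: Q_def abs_le_iff minus_le_iff)
  have "h y' = (\<Sum>j\<in>J. \<bar>G y' j - G y j - (y' j - y j)\<bar>)"
    unfolding h_def by (rule sum.cong) (auto simp: y'_def)
  moreover have "(\<Sum>j\<in>J. \<bar>y' j - y j\<bar>) = h y"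
    unfolding h_def by (rule sum.cong) (auto simp: y'_def)
  ultimately have "2 * h y' \<le> h y" using strict[of y' y] yb y'b by simp
  with y(2)[OF \<open>y' \<in> Q\<close>] have "h y \<le> 0" by linarith
  moreover have "\<bar>G y j - c j\<bar> \<le> h y" if "j \<in> J" for j
    unfolding h_def using that assms(1) by (auto intro!: member_le_sum)
  ultimately have "\<forall>j\<in>J. G y j = c j" by fastforce
  with yb show ?thesis by blast
qed

lemma uniform_radius:
  assumes "finite S" "\<And>x. x \<in> S \<Longrightarrow> \<exists>r>0. P x r"
    and mono: "\<And>x r s. P x r \<Longrightarrow> 0 < s \<Longrightarrow> s \<le> r \<Longrightarrow> P x s"
  shows "\<exists>r>0::real. \<forall>x\<in>S. P x r"
  using assms(1,2)
proof (induction S rule: finite_induct)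
  case empty
  then show ?case by (intro exI[of _ 1]) auto
next
  case (insert x S)
  obtain r where r: "r > 0" "\<forall>x\<in>S. P x r" using insert by auto
  obtain s where s: "s > 0" "P x s" using insert by auto
  have "\<forall>z\<in>insert x S. P z (min r s)"
    using r s mono[of _ r "min r s"] mono[of _ s "min r s"] by auto
  then show ?case using r s by (intro exI[of _ "min r s"]) auto
qed

text \<open>The open mapping theorem for a submersion: along directions dual to the gradients, the
  conditions become a system close to the identity. A form \<open>p j i\<close> for each point
  allows a condition to involve all points or, with zeros elsewhere, a single one.\<close>

lemma perturb_points:
  fixes p :: "'j \<Rightarrow> 'i \<Rightarrow> real poly poly" and v :: "'i \<Rightarrow> real ^ 3"
  assumes "finite I" "finite J" "e > 0"
    and indep: "\<And>c. (\<And>i. i \<in> I \<Longrightarrow> (\<Sum>j\<in>J. c j *\<^sub>R grd (k j) (p j i) (v i)) = 0) \<Longrightarrow> \<forall>j\<in>J. c j = 0"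
  shows "\<exists>\<delta>>0. \<forall>b. (\<forall>j\<in>J. \<bar>b j\<bar> \<le> \<delta>) \<longrightarrow> (\<exists>w. (\<forall>i\<in>I. norm (w i - v i) < e) \<and>
    (\<forall>j\<in>J. (\<Sum>i\<in>I. hev (k j) (p j i) (w i)) = (\<Sum>i\<in>I. hev (k j) (p j i) (v i)) + b j))"
proof -
  define B where "B = I \<times> (UNIV :: 3 set)"
  have "\<forall>j\<in>J. c j = 0"
    if c: "\<And>b. b \<in> B \<Longrightarrow> (\<Sum>j\<in>J. c j * grd (k j) (p j (fst b)) (v (fst b)) $ snd b) = 0" for c
  proof (rule indep)
    fix i assume "i \<in> I"
    then have "(\<Sum>j\<in>J. c j * grd (k j) (p j i) (v i) $ a) = 0" for a
      using c[of "(i, a)"] by (simp add: B_def)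
    then show "(\<Sum>j\<in>J. c j *\<^sub>R grd (k j) (p j i) (v i)) = 0" by (simp add: vec_eq_iff)
  qed
  moreover have "finite B" using assms(1) by (simp add: B_def)
  ultimately obtain E where E: "\<forall>j\<in>J. \<forall>l\<in>J.
      (\<Sum>b\<in>B. grd (k j) (p j (fst b)) (v (fst b)) $ snd b * E l b) = (if j = l then 1 else 0)"
    using dual_vectors_of_independent_rows[OF assms(2),
        of B "\<lambda>j b. grd (k j) (p j (fst b)) (v (fst b)) $ snd b"] by blast
  \<comment> \<open>Moving all points along \<open>u l\<close> changes condition \<open>l\<close> at
    unit rate and the others only to second order.\<close>
  define u :: "'j \<Rightarrow> 'i \<Rightarrow> real ^ 3" where "u l i = (\<chi> a. E l (i, a))" for l i
  have dual: "(\<Sum>i\<in>I. grd (k j) (p j i) (v i) \<bullet> u l i) = (if j = l then 1 else 0)"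
    if "j \<in> J" "l \<in> J" for j l
  proof -
    have "(\<Sum>i\<in>I. grd (k j) (p j i) (v i) \<bullet> u l i)
        = (\<Sum>i\<in>I. \<Sum>a\<in>UNIV. grd (k j) (p j i) (v i) $ a * E l (i, a))"
      by (simp add: u_def inner_vec_def)
    also have "\<dots> = (\<Sum>b\<in>B. grd (k j) (p j (fst b)) (v (fst b)) $ snd b * E l b)"
      by (simp add: B_def sum.cartesian_product split_beta)
    finally show ?thesis using E that by simp
  qed
  define w where "w y i = v i + (\<Sum>l\<in>J. y l *\<^sub>R u l i)" for y i
  define G where "G y j = (\<Sum>i\<in>I. hev (k j) (p j i) (w y i))" for y j
  define U where "U = 1 + (\<Sum>l\<in>J. \<Sum>i\<in>I. norm (u l i))"
  have U: "U \<ge> 1" unfolding U_def by (simp add: sum_nonneg)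
  have u_le: "norm (u l i) \<le> U" if "l \<in> J" "i \<in> I" for l i
  proof -
    have "norm (u l i) \<le> (\<Sum>i\<in>I. norm (u l i))" using that assms(1) by (intro member_le_sum) auto
    also have "\<dots> \<le> (\<Sum>l\<in>J. \<Sum>i\<in>I. norm (u l i))"
      using that assms(2) by (intro member_le_sum[of l J "\<lambda>l. \<Sum>i\<in>I. norm (u l i)"]) (auto intro: sum_nonneg)
    finally show ?thesis by (simp add: U_def)
  qed
  have w_diff: "w y i - w y' i = (\<Sum>l\<in>J. (y l - y' l) *\<^sub>R u l i)" for y y' i
    by (simp add: w_def scaleR_left_diff_distrib sum_subtractf)
  have w_le: "norm (w y i - w y' i) \<le> U * (\<Sum>l\<in>J. \<bar>y l - y' l\<bar>)" if "i \<in> I" for y y' i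
  proof -
    have "norm (w y i - w y' i) \<le> (\<Sum>l\<in>J. norm ((y l - y' l) *\<^sub>R u l i))"
      unfolding w_diff by (rule norm_sum)
    also have "\<dots> \<le> (\<Sum>l\<in>J. U * \<bar>y l - y' l\<bar>)"
      using u_le that by (intro sum_mono) (simp add: mult.commute mult_right_mono)
    finally show ?thesis by (simp add: sum_distrib_left)
  qed
  have w0: "w (\<lambda>_. 0) i = v i" for i by (simp add: w_def)
  define N where "N = real (card J) * real (card I) + 1"
  have N: "N \<ge> 1" by (simp add: N_def)
  \<comment> \<open>Summed over at most \<open>N\<close> pairs and with displacements stretched by
    at most \<open>U\<close>, this error leaves a contraction factor of one half.\<close>
  define \<eta> where "\<eta> = 1 / (2 * N * U)"
  have \<eta>: "\<eta> > 0" using N U by (simp add: \<eta>_def)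
  have "\<exists>r>0. \<forall>x\<in>J \<times> I. \<forall>a\<in>ball (v (snd x)) r. \<forall>b\<in>ball (v (snd x)) r.
      \<bar>hev (k (fst x)) (p (fst x) (snd x)) a - hev (k (fst x)) (p (fst x) (snd x)) b
        - grd (k (fst x)) (p (fst x) (snd x)) (v (snd x)) \<bullet> (a - b)\<bar> \<le> \<eta> * norm (a - b)"
    by (rule uniform_radius) (use assms(1,2) hev_strict_derivative[OF \<eta>] in auto)
  then obtain r0 where r0: "r0 > 0" "\<And>j i a b. j \<in> J \<Longrightarrow> i \<in> I \<Longrightarrow> a \<in> ball (v i) r0 \<Longrightarrow> b \<in> ball (v i) r0 \<Longrightarrow>
      \<bar>hev (k j) (p j i) a - hev (k j) (p j i) b - grd (k j) (p j i) (v i) \<bullet> (a - b)\<bar> \<le> \<eta> * norm (a - b)"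
    by fastforce
  define \<rho> where "\<rho> = min r0 e"
  have \<rho>: "\<rho> > 0" "\<rho> \<le> r0" "\<rho> \<le> e" using r0(1) assms(3) by (auto simp: \<rho>_def)
  \<comment> \<open>Parameters bounded by \<open>r\<close> move every point by at most
    \<open>\<rho> / 2\<close>. The summand 1 avoids a division by zero for empty
    \<open>J\<close>.\<close>
  define r where "r = \<rho> / (2 * U * (real (card J) + 1))"
  have r: "r > 0" using \<rho> U by (simp add: r_def)
  have close: "norm (w y i - v i) < \<rho>" if "\<forall>j\<in>J. \<bar>y j\<bar> \<le> r" "i \<in> I" for y i
  proof -
    have "(\<Sum>l\<in>J. \<bar>y l\<bar>) \<le> real (card J) * r"
      using that(1) by (intro sum_bounded_above[of J, simplified]) auto
    then have "U * (\<Sum>l\<in>J. \<bar>y l\<bar>) \<le> U * (real (card J) * r)" using U by (intro mult_left_mono) auto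
    also have "\<dots> \<le> U * ((real (card J) + 1) * r)" using U r by (intro mult_left_mono mult_right_mono) auto
    also have "\<dots> = \<rho> / 2"
    proof -
      have "U \<noteq> 0" "real (card J) + 1 \<noteq> 0" using U by auto
      then show ?thesis by (simp add: r_def)
    qed
    also have "\<dots> < \<rho>" using \<rho> by simp
    finally show ?thesis using w_le[OF that(2), of y "\<lambda>_. 0"] by (simp add: w0)
  qed
  have strict: "2 * (\<Sum>j\<in>J. \<bar>G y j - G y' j - (y j - y' j)\<bar>) \<le> (\<Sum>j\<in>J. \<bar>y j - y' j\<bar>)"
    if yy: "\<forall>j\<in>J. \<bar>y j\<bar> \<le> r \<and> \<bar>y' j\<bar> \<le> r" for y y'
  proof -
    define Y where "Y = (\<Sum>j\<in>J. \<bar>y j - y' j\<bar>)"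
    have Y: "Y \<ge> 0" by (simp add: Y_def sum_nonneg)
    have "\<bar>G y j - G y' j - (y j - y' j)\<bar> \<le> real (card I) * (\<eta> * (U * Y))" if j: "j \<in> J" for j
    proof -
      have "(\<Sum>i\<in>I. grd (k j) (p j i) (v i) \<bullet> (w y i - w y' i))
          = (\<Sum>l\<in>J. (y l - y' l) * (\<Sum>i\<in>I. grd (k j) (p j i) (v i) \<bullet> u l i))"
        unfolding w_diff inner_sum_right inner_scaleR_right sum_distrib_left by (rule sum.swap)
      also have "\<dots> = (\<Sum>l\<in>J. if j = l then y l - y' l else 0)"
        by (intro sum.cong) (auto simp: dual j)
      also have "\<dots> = y j - y' j" using j assms(2) by simp
      finally have "G y j - G y' j - (y j - y' j) = (\<Sum>i\<in>I. hev (k j) (p j i) (w y i) - hev (k j) (p j i) (w y' i)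
          - grd (k j) (p j i) (v i) \<bullet> (w y i - w y' i))"
        by (simp add: G_def sum_subtractf)
      also have "\<bar>\<dots>\<bar> \<le> (\<Sum>i\<in>I. \<eta> * (U * Y))"
      proof (rule order_trans[OF sum_abs], rule sum_mono)
        fix i assume i: "i \<in> I"
        have "norm (w y i - v i) < \<rho>" "norm (w y' i - v i) < \<rho>" using close yy i by blast+
        then have "w y i \<in> ball (v i) r0" "w y' i \<in> ball (v i) r0"
          using \<rho> by (auto simp: dist_norm norm_minus_commute)
        from r0(2)[OF j i this] have "\<bar>hev (k j) (p j i) (w y i) - hev (k j) (p j i) (w y' i)
            - grd (k j) (p j i) (v i) \<bullet> (w y i - w y' i)\<bar> \<le> \<eta> * norm (w y i - w y' i)" .
        also have "\<dots> \<le> \<eta> * (U * Y)" using w_le[OF i, of y y'] \<eta> by (simp add: Y_def)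
        finally show "\<bar>hev (k j) (p j i) (w y i) - hev (k j) (p j i) (w y' i)
            - grd (k j) (p j i) (v i) \<bullet> (w y i - w y' i)\<bar> \<le> \<eta> * (U * Y)" .
      qed
      finally show ?thesis by simp
    qed
    then have "(\<Sum>j\<in>J. \<bar>G y j - G y' j - (y j - y' j)\<bar>) \<le> real (card J) * (real (card I) * (\<eta> * (U * Y)))"
      by (intro sum_bounded_above[of J, simplified]) auto
    also have "\<dots> = (N - 1) * (\<eta> * (U * Y))" by (simp add: N_def)
    also have "\<dots> \<le> N * (\<eta> * (U * Y))" using \<eta> U Y by (intro mult_right_mono) auto
    also have "\<dots> = Y / 2" using N U by (simp add: \<eta>_def)
    finally show ?thesis by (simp add: Y_def)
  qed
  have cont: "continuous_on UNIV (\<lambda>y. G y j)" if "j \<in> J" for j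
  proof -
    have "continuous_on UNIV (\<lambda>y :: 'j \<Rightarrow> real. y l)" for l
      by (rule continuous_on_product_coordinates)
    then have "continuous_on UNIV (\<lambda>y. w y i)" for i
      unfolding w_def by (intro continuous_on_add continuous_on_const continuous_on_sum continuous_on_scaleR)
    then show ?thesis unfolding G_def by (intro continuous_on_sum continuous_on_hev)
  qed
  show ?thesis
  \<comment> \<open>Perturbations of this size have total at most \<open>r / 5\<close>, as
    \<open>near_identity_system_solvable\<close> demands.\<close>
  proof (intro exI[of _ "r / (5 * (real (card J) + 1))"] conjI allI impI)
    show "r / (5 * (real (card J) + 1)) > 0" using r by simp
    fix b assume b: "\<forall>j\<in>J. \<bar>b j\<bar> \<le> r / (5 * (real (card J) + 1))"
    have "(\<Sum>j\<in>J. \<bar>G (\<lambda>_. 0) j - (G (\<lambda>_. 0) j + b j)\<bar>) \<le> real (card J) * (r / (5 * (real (card J) + 1)))"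
      using b by (intro sum_bounded_above[of J, simplified]) auto
    also have "\<dots> \<le> (real (card J) + 1) * (r / (5 * (real (card J) + 1)))"
      using r by (intro mult_right_mono) auto
    also have "\<dots> = r / 5"
    proof -
      have *: "a * (r / (5 * a)) = r / 5" if "a > 0" for a using that by simp
      show ?thesis by (rule *) simp
    qed
    finally have "5 * (\<Sum>j\<in>J. \<bar>G (\<lambda>_. 0) j - (G (\<lambda>_. 0) j + b j)\<bar>) \<le> r" by simp
    then obtain y where y: "\<forall>j\<in>J. \<bar>y j\<bar> \<le> r" "\<forall>j\<in>J. G y j = G (\<lambda>_. 0) j + b j"
      using near_identity_system_solvable[OF assms(2), of r G "\<lambda>j. G (\<lambda>_. 0) j + b j"] strict cont r by force
    have "norm (w y i - v i) < e" if "i \<in> I" for i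
      using close[OF y(1) that] \<rho>(3) by linarith
    then show "\<exists>w. (\<forall>i\<in>I. norm (w i - v i) < e) \<and>
        (\<forall>j\<in>J. (\<Sum>i\<in>I. hev (k j) (p j i) (w i)) = (\<Sum>i\<in>I. hev (k j) (p j i) (v i)) + b j)"
      using y(2) by (intro exI[of _ "w y"]) (simp add: G_def w0)
  qed
qed

section \<open>Zeros of nonnegative forms on the cone\<close>

context smooth_cubic
begin

text \<open>With a nonzero derivative along \<open>\<tau> v\<close> the gradients of
  \<open>f\<close> and \<open>F\<close> would be independent, and \<open>v\<close> could be moved on
  the curve to a point where \<open>F\<close> is negative.\<close>

lemma nonneg_double_zero:
  assumes nonneg: "\<And>v. v \<in> C \<Longrightarrow> hev n F v \<ge> 0" and v: "v \<in> C" "v \<noteq> 0" "hev n F v = 0"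
  shows "grd n F v \<bullet> \<tau> v = 0"
proof (rule ccontr)
  assume nz: "grd n F v \<bullet> \<tau> v \<noteq> 0"
  \<comment> \<open>One point, hence the index type \<open>unit\<close>, and two conditions:
    \<open>False\<close> stands for \<open>f\<close> and \<open>True\<close> for
    \<open>F\<close>.\<close>
  define k where "k b = (if b then n else 3)" for b
  define p where "p b (i::unit) = (if b then F else f)" for b i
  have "\<forall>j\<in>UNIV. c j = 0"
    if "\<And>i. i \<in> UNIV \<Longrightarrow> (\<Sum>j\<in>UNIV. c j *\<^sub>R grd (k j) (p j i) v) = 0" for c :: "bool \<Rightarrow> real"
  proof -
    have "c False *\<^sub>R grd 3 f v + c True *\<^sub>R grd n F v = 0"
      using that[of "()"] by (simp add: UNIV_bool k_def p_def)
    moreover from this have "(c False *\<^sub>R grd 3 f v + c True *\<^sub>R grd n F v) \<bullet> \<tau> v = 0" by simp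
    then have "c True = 0" using nz by (simp add: inner_add_left grd_f_\<tau>)
    ultimately have "c False = 0" using grd_f[OF v(1,2)] by simp
    with \<open>c True = 0\<close> show ?thesis by (auto simp: UNIV_bool)
  qed
  then have "\<exists>\<delta>>0. \<forall>b. (\<forall>j\<in>UNIV. \<bar>b j\<bar> \<le> \<delta>) \<longrightarrow> (\<exists>w. (\<forall>i\<in>UNIV. norm (w i - v) < 1) \<and>
      (\<forall>j\<in>UNIV. (\<Sum>i\<in>UNIV. hev (k j) (p j i) (w i)) = (\<Sum>i\<in>UNIV. hev (k j) (p j i) v) + b j))"
    by (intro perturb_points) simp_all
  then obtain \<delta> where \<delta>: "\<delta> > 0" and sol: "\<forall>b. (\<forall>j\<in>UNIV. \<bar>b j\<bar> \<le> \<delta>) \<longrightarrow>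
      (\<exists>w. (\<forall>i\<in>UNIV. norm (w i - v) < 1) \<and>
      (\<forall>j\<in>UNIV. (\<Sum>i\<in>UNIV. hev (k j) (p j i) (w i)) = (\<Sum>i\<in>UNIV. hev (k j) (p j i) v) + b j))" by blast
  have "\<forall>j\<in>UNIV. \<bar>if j then - \<delta> else 0\<bar> \<le> \<delta>" using \<delta> by simp
  then obtain w where w: "\<forall>j\<in>UNIV. (\<Sum>i\<in>UNIV. hev (k j) (p j i) (w i))
      = (\<Sum>i\<in>UNIV. hev (k j) (p j i) v) + (if j then - \<delta> else 0)"
    using spec[OF sol, of "\<lambda>j. if j then - \<delta> else 0"] by blast
  have "hev 3 f (w ()) = 0" "hev n F (w ()) = - \<delta>"
    using bspec[OF w, of False] bspec[OF w, of True] v by (simp_all add: k_def p_def UNIV_unit C_def)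
  then show False using nonneg[of "w ()"] \<delta> by (simp add: C_def)
qed

end

section \<open>Functionals that are nonnegative on nonnegative forms\<close>

definition linear_on :: "nat \<Rightarrow> (real poly poly \<Rightarrow> real) \<Rightarrow> bool" where
  "linear_on n \<phi> \<longleftrightarrow> (\<forall>p\<in>polys_le n. \<forall>q\<in>polys_le n. \<phi> (p + q) = \<phi> p + \<phi> q) \<and>
     (\<forall>c. \<forall>p\<in>polys_le n. \<phi> (smult [:c:] p) = c * \<phi> p)"

lemma linear_on_add: "linear_on n \<phi> \<Longrightarrow> p \<in> polys_le n \<Longrightarrow> q \<in> polys_le n \<Longrightarrow> \<phi> (p + q) = \<phi> p + \<phi> q"
  and linear_on_smult: "linear_on n \<phi> \<Longrightarrow> p \<in> polys_le n \<Longrightarrow> \<phi> (smult [:c:] p) = c * \<phi> p"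
  by (simp_all add: linear_on_def)

lemma linear_on_0: "linear_on n \<phi> \<Longrightarrow> \<phi> 0 = 0"
  using linear_on_smult[of n \<phi> 0 0] polys_le_0 by auto

lemma smult_minus_1: "smult [:-1:] p = - p" for p :: "real poly poly"
proof (rule poly_eq_cfI)
  fix s
  show "cf (smult [:-1:] p) s = cf (- p) s" using cf_smult[of "-1" p s] by simp
qed

lemma linear_on_minus: "linear_on n \<phi> \<Longrightarrow> p \<in> polys_le n \<Longrightarrow> \<phi> (- p) = - \<phi> p"
  using linear_on_smult[of n \<phi> p "-1"] unfolding smult_minus_1 by simp

lemma linear_on_diff: "linear_on n \<phi> \<Longrightarrow> p \<in> polys_le n \<Longrightarrow> q \<in> polys_le n \<Longrightarrow> \<phi> (p - q) = \<phi> p - \<phi> q"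
  using linear_on_add[of n \<phi> p "- q"] linear_on_minus[of n \<phi> q] polys_le_minus[of q n] by simp

lemma linear_on_sum:
  assumes "linear_on n \<phi>" "\<And>i. i \<in> I \<Longrightarrow> g i \<in> polys_le n"
  shows "\<phi> (\<Sum>i\<in>I. smult [:c i:] (g i)) = (\<Sum>i\<in>I. c i * \<phi> (g i))"
  using assms(2)
proof (induction I rule: infinite_finite_induct)
  case (insert x F)
  then have "(\<Sum>i\<in>F. smult [:c i:] (g i)) \<in> polys_le n" "smult [:c x:] (g x) \<in> polys_le n"
    by (auto intro: polys_le_sum polys_le_smult)
  then show ?case
    using insert linear_on_add[OF assms(1)] linear_on_smult[OF assms(1), of "g x"] by simp
qed (use linear_on_0[OF assms(1)] in auto)

lemma linear_on_comb:
  "linear_on n \<phi> \<Longrightarrow> S \<subseteq> mons n \<Longrightarrow> \<phi> (comb S c) = (\<Sum>s\<in>S. c s * \<phi> (mon s))"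
  unfolding comb_def by (rule linear_on_sum) (auto intro: mon_in_polys_le)

lemma linear_on_mono: "linear_on n \<phi> \<Longrightarrow> m \<le> n \<Longrightarrow> linear_on m \<phi>"
  using polys_le_mono unfolding linear_on_def by blast

lemma linear_on_eqI:
  assumes "linear_on n \<phi>" "linear_on n \<psi>" "\<And>s. s \<in> mons n \<Longrightarrow> \<phi> (mon s) = \<psi> (mon s)" "p \<in> polys_le n"
  shows "\<phi> p = \<psi> p"
  using linear_on_comb[OF assms(1) subset_refl, of "cf p"] linear_on_comb[OF assms(2) subset_refl, of "cf p"]
    assms(3) comb_cf[OF assms(4)] by simp

lemma linear_on_hev_sum: "linear_on n (\<lambda>p. \<Sum>i\<in>I. hev n p (w i))"
  by (simp add: linear_on_def hev_add hev_smult sum.distrib sum_distrib_left)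

text \<open>The first-order condition at a minimum. The bound \<open>e < 1\<close> is there for
  variations that scale by \<open>1 - e\<close>.\<close>

lemma quadratic_nonneg_near_0:
  fixes A E :: real
  assumes "\<And>e. 0 < e \<Longrightarrow> e < 1 \<Longrightarrow> 0 \<le> 2 * A * e + E * e\<^sup>2"
  shows "A \<ge> 0"
proof (rule ccontr)
  assume A: "\<not> A \<ge> 0"
  define e where "e = min (1 / 2) (- A / (\<bar>E\<bar> + 1))"
  have e: "0 < e" "e < 1" using A by (auto simp: e_def intro: divide_neg_pos)
  have "E * e \<le> \<bar>E\<bar> * e" using e by (intro mult_right_mono) auto
  also have "\<dots> \<le> (\<bar>E\<bar> + 1) * e" using e by (intro mult_right_mono) auto
  also have "\<dots> \<le> (\<bar>E\<bar> + 1) * (- A / (\<bar>E\<bar> + 1))" by (intro mult_left_mono) (auto simp: e_def)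
  also have "\<dots> = - A" by simp
  finally have "2 * A + E * e < 0" using A by linarith
  then have "(2 * A + E * e) * e < 0" using e by (intro mult_neg_pos)
  moreover have "(2 * A + E * e) * e = 2 * A * e + E * e\<^sup>2" by (simp add: power2_eq_square algebra_simps)
  ultimately show False using assms[OF e] by linarith
qed

section \<open>The closed cone of sums of evaluations\<close>

context smooth_cubic
begin

lemma closed_C: "closed C"
  unfolding C_def by (intro closed_Collect_eq continuous_on_hev continuous_on_id continuous_on_const)

lemma zero_in_C: "0 \<in> C"
  by (simp add: C_def hev_def hg_def) (auto simp: mons_def power_0_left intro!: sum.neutral)

lemma hev_at_0: "n > 0 \<Longrightarrow> hev n p 0 = 0"
  using hev_scale[of n p 0 0] by (simp add: power_0_left)

lemma hev_weight: "n > 0 \<Longrightarrow> t \<ge> 0 \<Longrightarrow> hev n p (root n t *\<^sub>R v) = t * hev n p v"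
  by (simp add: hev_scale)

text \<open>The weights are shifted along a linear relation until the first one vanishes. The
  purpose is a vacant index at which \<open>cone_representation\<close> can insert a new
  point.\<close>

lemma caratheodory_step:
  fixes w :: "nat \<Rightarrow> real ^ 3"
  assumes "n > 0" "\<forall>i. w i \<in> C" "N > card (mons n)"
  shows "\<exists>w'. (\<forall>i. w' i \<in> C) \<and> (\<exists>i0<N. w' i0 = 0) \<and>
    (\<forall>s\<in>mons n. (\<Sum>i<N. hev n (mon s) (w' i)) = (\<Sum>i<N. hev n (mon s) (w i)))"
proof -
  obtain c0 where c0: "\<exists>i\<in>{..<N}. c0 i \<noteq> 0" "\<forall>s\<in>mons n. (\<Sum>i<N. c0 i * hev n (mon s) (w i)) = 0"
    using homogeneous_system_nontrivial_solution[OF finite_mons finite_lessThan, of n N "\<lambda>i s. hev n (mon s) (w i)"]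
      assms(3) by auto
  obtain c where c: "\<exists>i\<in>{..<N}. c i > 0" "\<forall>s\<in>mons n. (\<Sum>i<N. c i * hev n (mon s) (w i)) = 0"
  proof (cases "\<exists>i\<in>{..<N}. c0 i > 0")
    case True
    then show ?thesis using c0 that by blast
  next
    case False
    with c0(1) obtain i where "i < N" "c0 i < 0" by (meson lessThan_iff linorder_neqE_linordered_idom)
    then show ?thesis using c0(2) that[of "\<lambda>i. - c0 i"] by (auto simp: sum_negf)
  qed
  define m where "m = Max (c ` {..<N})"
  have "m \<in> c ` {..<N}" unfolding m_def using c(1) by (intro Max_in) auto
  then obtain i0 where i0: "i0 < N" "c i0 = m" by auto
  have le: "c i \<le> m" if "i < N" for i unfolding m_def using that by (intro Max_ge) auto
  have m: "m > 0" using c(1) le by fastforce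
  \<comment> \<open>The weight \<open>1 - c i / m\<close> is nonnegative, because \<open>m\<close>
    is the largest coefficient, and it is zero at \<open>i0\<close>.\<close>
  define w' where "w' i = root n (1 - c i / m) *\<^sub>R w i" for i
  have "hev n (mon s) (w' i) = hev n (mon s) (w i) - c i * hev n (mon s) (w i) / m" if "i < N" for i s
    using hev_weight[OF assms(1), of "1 - c i / m" "mon s" "w i"] le[OF that] m
    by (simp add: w'_def algebra_simps)
  then have "(\<Sum>i<N. hev n (mon s) (w' i)) = (\<Sum>i<N. hev n (mon s) (w i)) - (\<Sum>i<N. c i * hev n (mon s) (w i)) / m" for s
    by (simp add: sum_subtractf sum_divide_distrib)
  moreover have "w' i0 = 0" using i0 m by (simp add: w'_def)
  moreover have "w' i \<in> C" for i using assms(2) by (simp add: w'_def scale_in_C)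
  ultimately show ?thesis using c(2) i0(1) by (intro exI[of _ w']) auto
qed

text \<open>In even degree the pure powers of the coordinates are nonnegative, so the contribution
  of a long vector cannot cancel; beyond the radius \<open>R\<close> the distance is no smaller than
  at the origin. Closedness of the cone is used in this form.\<close>

lemma nearest_cone_point:
  fixes \<phi> :: "nat \<times> nat \<Rightarrow> real" and N :: nat
  assumes "even n" "n > 0"
  defines "h \<equiv> \<lambda>w :: nat \<Rightarrow> real ^ 3. \<Sum>s\<in>mons n. ((\<Sum>i<N. hev n (mon s) (w i)) - \<phi> s)\<^sup>2"
  shows "\<exists>w. (\<forall>i. w i \<in> C) \<and> (\<forall>w'. (\<forall>i. w' i \<in> C) \<longrightarrow> h w \<le> h w')"
proof -
  define T where "T = (\<Sum>s\<in>mons n. \<bar>\<phi> s\<bar>)"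
  have T: "T \<ge> 0" "\<And>s. s \<in> mons n \<Longrightarrow> \<bar>\<phi> s\<bar> \<le> T"
    unfolding T_def by (auto intro!: sum_nonneg member_le_sum)
  \<comment> \<open>Some coordinate of a vector longer than \<open>R\<close> is at least
    \<open>2 * T + 1\<close> in absolute value, and then its power misses \<open>\<phi>\<close> by
    at least \<open>T + 1\<close>.\<close>
  define R where "R = 3 * (2 * T + 1)"
  define Q where "Q = {w :: nat \<Rightarrow> real ^ 3. \<forall>i. w i \<in> C \<inter> cball 0 R}"
  have "compact Q" unfolding Q_def
    by (rule compact_functions_box) (intro closed_Int_compact closed_C compact_cball)
  moreover have "continuous_on Q h"
    unfolding h_def
    by (intro continuous_on_sum continuous_on_power continuous_on_diff continuous_on_const continuous_on_hev
        continuous_on_subset[OF continuous_on_product_coordinates subset_UNIV])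
  moreover have zero: "(\<lambda>_. 0) \<in> Q" using T by (simp add: Q_def zero_in_C R_def)
  ultimately obtain w where w: "w \<in> Q" "\<And>w'. w' \<in> Q \<Longrightarrow> h w \<le> h w'"
    using continuous_attains_inf[of Q h] by blast
  have h0: "h (\<lambda>_. 0) \<le> T\<^sup>2"
  proof -
    have "h (\<lambda>_. 0) = (\<Sum>s\<in>mons n. \<bar>\<phi> s\<bar> * \<bar>\<phi> s\<bar>)"
      unfolding h_def using assms(2) by (simp add: hev_at_0 power2_eq_square)
    also have "\<dots> \<le> (\<Sum>s\<in>mons n. \<bar>\<phi> s\<bar> * T)"
      by (intro sum_mono mult_left_mono T(2)) auto
    finally show ?thesis by (simp add: T_def sum_distrib_right power2_eq_square)
  qed
  have far: "h (\<lambda>_. 0) \<le> h w'" if w': "\<forall>i. w' i \<in> C" and i: "i < N" and big: "norm (w' i) > R" for w' i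
  proof -
    have "norm (w' i) \<le> \<bar>w' i $ 1\<bar> + \<bar>w' i $ 2\<bar> + \<bar>w' i $ 3\<bar>"
      using norm_le_l1_cart[of "w' i"] by (simp add: sum_3)
    moreover have "\<bar>w' i $ 1\<bar> \<ge> 2 * T + 1 \<or> \<bar>w' i $ 2\<bar> \<ge> 2 * T + 1 \<or> \<bar>w' i $ 3\<bar> \<ge> 2 * T + 1"
    proof -
      have "x \<ge> t \<or> y \<ge> t \<or> z \<ge> t" if "3 * t < x + y + z" for x y z t :: real using that by linarith
      then show ?thesis using big calculation unfolding R_def by force
    qed
    ultimately obtain a where a: "\<bar>w' i $ a\<bar> \<ge> 2 * T + 1" by blast
    have "\<exists>s\<in>mons n. \<forall>v. hev n (mon s) v = v $ a ^ n"
    proof -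
      have "a = 1 \<or> a = 2 \<or> a = 3" using exhaust_3 by blast
      then show ?thesis
      proof (elim disjE)
        assume "a = 1"
        then show ?thesis by (intro bexI[of _ "(n, 0)"]) (auto simp: hev_def hg_mon mons_def)
      next
        assume "a = 2"
        then show ?thesis by (intro bexI[of _ "(0, n)"]) (auto simp: hev_def hg_mon mons_def)
      next
        assume "a = 3"
        then show ?thesis by (intro bexI[of _ "(0, 0)"]) (auto simp: hev_def hg_mon mons_def)
      qed
    qed
    then obtain s where s: "s \<in> mons n" "\<And>v. hev n (mon s) v = v $ a ^ n" by blast
    have nonneg: "v $ a ^ n \<ge> 0" for v :: "real ^ 3" using assms(1) by (simp add: zero_le_even_power)
    have "2 * T + 1 \<le> (2 * T + 1) ^ n" using T assms(2) by (intro self_le_power) auto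
    also have "\<dots> \<le> \<bar>w' i $ a\<bar> ^ n" using a T by (intro power_mono) auto
    also have "\<dots> = w' i $ a ^ n" using assms(1) by (simp add: power_even_abs)
    also have "\<dots> \<le> (\<Sum>i<N. hev n (mon s) (w' i))"
      unfolding s(2) using i nonneg by (intro member_le_sum[of i _ "\<lambda>i. w' i $ a ^ n"]) auto
    finally have "T + 1 \<le> (\<Sum>i<N. hev n (mon s) (w' i)) - \<phi> s" using T(2)[OF s(1)] by linarith
    then have "T\<^sup>2 \<le> ((\<Sum>i<N. hev n (mon s) (w' i)) - \<phi> s)\<^sup>2" using T(1) by (intro power_mono) auto
    also have "\<dots> \<le> h w'"
      unfolding h_def using s(1)
      by (intro member_le_sum[of s _ "\<lambda>s. ((\<Sum>i<N. hev n (mon s) (w' i)) - \<phi> s)\<^sup>2"]) auto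
    finally show ?thesis using h0 by linarith
  qed
  have "h w \<le> h w'" if w': "\<forall>i. w' i \<in> C" for w'
  proof (cases "\<forall>i<N. norm (w' i) \<le> R")
    case True
    \<comment> \<open>Only the first \<open>N\<close> vectors enter \<open>h\<close>; the others are
      set to 0 to lie in the compact set.\<close>
    define w'' where "w'' i = (if i < N then w' i else 0)" for i
    have "w'' \<in> Q" using True w' T by (auto simp: Q_def w''_def zero_in_C R_def)
    moreover have "h w'' = h w'" by (simp add: h_def w''_def)
    ultimately show ?thesis using w(2) by metis
  next
    case False
    then show ?thesis using far[OF w'] w(2)[OF zero] by fastforce
  qed
  moreover have "\<forall>i. w i \<in> C" using w(1) by (simp add: Q_def)
  ultimately show ?thesis by blast
qed

text \<open>Projection to a closed convex cone. The difference \<open>D\<close> between the nearest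
  point and \<open>\<phi>\<close> gives a form that is nonnegative on \<open>C\<close>, by inserting
  a point, and has nonpositive value under the nearest point, by shrinking. Nonnegativity of
  \<open>\<phi>\<close> on this form then forces \<open>D\<close> to vanish.\<close>

lemma cone_representation:
  assumes lin: "linear_on n \<phi>" and n: "even n" "n > 0"
    and nonneg: "\<And>F. F \<in> polys_le n \<Longrightarrow> (\<And>v. v \<in> C \<Longrightarrow> hev n F v \<ge> 0) \<Longrightarrow> \<phi> F \<ge> 0"
  shows "\<exists>(N :: nat) w. (\<forall>i<N. w i \<in> C) \<and> (\<forall>p\<in>polys_le n. \<phi> p = (\<Sum>i<N. hev n p (w i)))"
proof -
  \<comment> \<open>One more than the number of coefficients, so that Caratheodory's argument
    vacates an index.\<close>
  define N where "N = card (mons n) + 1"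
  define \<kappa> where "\<kappa> w s = (\<Sum>i<N. hev n (mon s) (w i))" for w :: "nat \<Rightarrow> real ^ 3" and s
  define h where "h w = (\<Sum>s\<in>mons n. (\<kappa> w s - \<phi> (mon s))\<^sup>2)" for w
  obtain w0 where w0: "\<forall>i. w0 i \<in> C" "\<And>w'. \<forall>i. w' i \<in> C \<Longrightarrow> h w0 \<le> h w'"
    using nearest_cone_point[OF n, of N "\<lambda>s. \<phi> (mon s)"] unfolding h_def \<kappa>_def by blast
  obtain w i0 where w: "\<forall>i. w i \<in> C" and i0: "i0 < N" "w i0 = 0" and \<kappa>w: "\<forall>s\<in>mons n. \<kappa> w s = \<kappa> w0 s"
    using caratheodory_step[OF n(2) w0(1), of N] unfolding \<kappa>_def N_def by auto
  have "h w = h w0" using \<kappa>w by (simp add: h_def)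
  with w0(2) have min: "\<And>w'. \<forall>i. w' i \<in> C \<Longrightarrow> h w \<le> h w'" by simp
  define D where "D s = \<kappa> w s - \<phi> (mon s)" for s
  have expand: "h w' - h w = 2 * (\<Sum>s\<in>mons n. D s * x s) * e + (\<Sum>s\<in>mons n. (x s)\<^sup>2) * e\<^sup>2"
    if "\<And>s. s \<in> mons n \<Longrightarrow> \<kappa> w' s = \<kappa> w s + e * x s" for w' x e
  proof -
    have "h w' - h w = (\<Sum>s\<in>mons n. 2 * (D s * x s) * e + (x s)\<^sup>2 * e\<^sup>2)"
      unfolding h_def sum_subtractf[symmetric] using that
      by (intro sum.cong refl) (simp add: D_def power2_eq_square algebra_simps)
    then show ?thesis by (simp add: sum.distrib sum_distrib_left sum_distrib_right)
  qed
  define F where "F = comb (mons n) D"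
  have "hev n F v \<ge> 0" if v: "v \<in> C" for v
  proof -
    have q: "0 \<le> 2 * (\<Sum>s\<in>mons n. D s * hev n (mon s) v) * e + (\<Sum>s\<in>mons n. (hev n (mon s) v)\<^sup>2) * e\<^sup>2"
      if e: "0 < e" for e
    proof -
      define w' where "w' = w(i0 := root n e *\<^sub>R v)"
      have "\<kappa> w' s = \<kappa> w s + e * hev n (mon s) v" for s
      proof -
        have "\<kappa> w' s = hev n (mon s) (w' i0) + (\<Sum>i\<in>{..<N} - {i0}. hev n (mon s) (w' i))"
          unfolding \<kappa>_def using i0 by (intro sum.remove) auto
        moreover have "\<kappa> w s = hev n (mon s) (w i0) + (\<Sum>i\<in>{..<N} - {i0}. hev n (mon s) (w i))"
          unfolding \<kappa>_def using i0 by (intro sum.remove) auto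
        moreover have "(\<Sum>i\<in>{..<N} - {i0}. hev n (mon s) (w' i)) = (\<Sum>i\<in>{..<N} - {i0}. hev n (mon s) (w i))"
          by (intro sum.cong) (auto simp: w'_def)
        ultimately show ?thesis using i0 e n by (simp add: w'_def hev_weight hev_at_0)
      qed
      moreover have "\<forall>i. w' i \<in> C" using w v by (simp add: w'_def scale_in_C)
      ultimately show ?thesis using min[of w'] expand[of w' e "\<lambda>s. hev n (mon s) v"] by simp
    qed
    have "(\<Sum>s\<in>mons n. D s * hev n (mon s) v) \<ge> 0" by (rule quadratic_nonneg_near_0[OF q])
    then show ?thesis by (simp add: F_def hev_comb)
  qed
  moreover have "F \<in> polys_le n" by (simp add: F_def comb_in_polys_le)
  ultimately have "\<phi> F \<ge> 0" by (intro nonneg)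
  \<comment> \<open>The second variation shrinks all weights by the factor
    \<open>1 - e\<close>.\<close>
  have q: "0 \<le> 2 * (\<Sum>s\<in>mons n. D s * (- \<kappa> w s)) * e + (\<Sum>s\<in>mons n. (- \<kappa> w s)\<^sup>2) * e\<^sup>2"
    if e: "0 < e" "e < 1" for e
  proof -
    define w' where "w' i = root n (1 - e) *\<^sub>R w i" for i
    have "\<kappa> w' s = \<kappa> w s + e * (- \<kappa> w s)" for s
    proof -
      have "\<kappa> w' s = (1 - e) * \<kappa> w s"
        using e n by (simp add: \<kappa>_def w'_def hev_weight sum_distrib_left)
      then show ?thesis by (simp add: algebra_simps)
    qed
    moreover have "\<forall>i. w' i \<in> C" using w by (simp add: w'_def scale_in_C)
    ultimately show ?thesis using min[of w'] expand[of w' e "\<lambda>s. - \<kappa> w s"] by simp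
  qed
  have "(\<Sum>s\<in>mons n. D s * (- \<kappa> w s)) \<ge> 0" by (rule quadratic_nonneg_near_0[OF q])
  moreover have "\<phi> F = (\<Sum>s\<in>mons n. D s * \<phi> (mon s))"
    unfolding F_def by (rule linear_on_comb[OF lin subset_refl])
  moreover have "(\<Sum>s\<in>mons n. D s * D s) = - (\<Sum>s\<in>mons n. D s * (- \<kappa> w s)) - (\<Sum>s\<in>mons n. D s * \<phi> (mon s))"
    unfolding sum_negf[symmetric] sum_subtractf[symmetric]
    by (intro sum.cong refl) (simp add: D_def algebra_simps)
  ultimately have "(\<Sum>s\<in>mons n. D s * D s) \<le> 0" using \<open>\<phi> F \<ge> 0\<close> by linarith
  then have "(\<Sum>s\<in>mons n. D s * D s) = 0" by (intro antisym sum_nonneg) auto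
  then have "\<forall>s\<in>mons n. D s * D s = 0"
    using sum_nonneg_eq_0_iff[OF finite_mons, of n "\<lambda>s. D s * D s"] by simp
  then have mon: "\<phi> (mon s) = (\<Sum>i<N. hev n (mon s) (w i))" if "s \<in> mons n" for s
    using that by (simp add: D_def \<kappa>_def)
  have "\<phi> p = (\<Sum>i<N. hev n p (w i))" if "p \<in> polys_le n" for p
    by (rule linear_on_eqI[OF lin linear_on_hev_sum mon that])
  with w show ?thesis by blast
qed

end

section \<open>Decomposition of strictly positive functionals\<close>

lemma cross_eq_0_imp:
  fixes x u :: "real ^ 3"
  assumes "cross3 x u = 0" "u \<noteq> 0"
  shows "\<exists>c. x = c *\<^sub>R u"
proof -
  have "cross3 u x = 0" using assms(1) cross_skew[of u x] by simp
  then show ?thesis using assms(2) by (auto simp: cross_eq_0 collinear_lemma)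
qed

lemma cross_nonzero_nearby:
  fixes u v :: "real ^ 3"
  assumes "cross3 u v \<noteq> 0"
  shows "\<exists>r>0. \<forall>x y. norm (x - u) < r \<longrightarrow> norm (y - v) < r \<longrightarrow> cross3 x y \<noteq> 0"
proof -
  have "isCont (\<lambda>z. cross3 (fst z) (snd z)) (u, v)"
    by (intro continuous_cross continuous_fst continuous_snd continuous_ident)
  then obtain r where r: "r > 0" "\<And>z. dist z (u, v) < r \<Longrightarrow> dist (cross3 (fst z) (snd z)) (cross3 u v) < norm (cross3 u v)"
    using assms unfolding continuous_at_eps_delta by (metis fst_conv snd_conv zero_less_norm_iff)
  show ?thesis
  proof (intro exI[of _ "r / 2"] conjI allI impI)
    show "r / 2 > 0" using r(1) by simp
    fix x y assume "norm (x - u) < r / 2" "norm (y - v) < r / 2"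
    moreover have "dist (x, y) (u, v) \<le> norm (x - u) + norm (y - v)"
      using norm_Pair_le[of "x - u" "y - v"] by (simp add: dist_norm)
    ultimately have "dist (cross3 x y) (cross3 u v) < norm (cross3 u v)" using r(2)[of "(x, y)"] by simp
    then show "cross3 x y \<noteq> 0" by (auto simp: dist_norm)
  qed
qed

lemma component_nonzero_nearby:
  fixes u :: "real ^ 3"
  assumes "u $ a \<noteq> 0"
  shows "\<exists>r>0. \<forall>x. norm (x - u) < r \<longrightarrow> x $ a \<noteq> 0"
proof (intro exI[of _ "\<bar>u $ a\<bar>"] conjI allI impI)
  show "\<bar>u $ a\<bar> > 0" using assms by simp
  fix x assume "norm (x - u) < \<bar>u $ a\<bar>"
  then have "\<bar>x $ a - u $ a\<bar> < \<bar>u $ a\<bar>" using component_le_norm_cart[of "x - u" a] by simp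
  then show "x $ a \<noteq> 0" by auto
qed

text \<open>In even degree proportional vectors merge into one: the multiple \<open>c\<close>
  contributes the nonnegative weight \<open>c ^ n\<close>, whatever its sign.\<close>

lemma merge_collinear:
  fixes w :: "nat \<Rightarrow> real ^ 3"
  assumes "even n" "n > 0" "finite I" "cone P"
    and "\<forall>i\<in>I. w i \<in> P"
  shows "\<exists>I' w'. finite I' \<and> (\<forall>i\<in>I'. w' i \<in> P) \<and> noncollinear (I' :: nat set) w' \<and>
    (\<forall>p. (\<Sum>i\<in>I'. hev n p (w' i)) = (\<Sum>i\<in>I. hev n p (w i)))"
  using assms(3,5)
proof (induction "card I" arbitrary: I w rule: less_induct)
  case less
  have hev0: "hev n p 0 = 0" for p using hev_scale[of n p 0 0] assms(2) by (simp add: power_0_left)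
  have step: ?case if i: "i \<in> I" and w'': "\<forall>j\<in>I - {i}. w'' j \<in> P"
    and eq: "\<And>p. (\<Sum>j\<in>I - {i}. hev n p (w'' j)) = (\<Sum>j\<in>I. hev n p (w j))" for i w''
  proof -
    have "card (I - {i}) < card I" using less.prems(1) i by (rule card_Diff1_less)
    from less.hyps[OF this _ w''] less.prems(1) eq show ?thesis by auto
  qed
  show ?case
  proof (cases "noncollinear I w")
    case True
    then show ?thesis using less.prems by blast
  next
    case False
    then consider i where "i \<in> I" "w i = 0"
      | i j where "i \<in> I" "j \<in> I" "i \<noteq> j" "cross3 (w i) (w j) = 0" "w j \<noteq> 0"
      unfolding noncollinear_def by blast
    then show ?thesis
    proof cases
      case 1
      then have "(\<Sum>j\<in>I - {i}. hev n p (w j)) = (\<Sum>j\<in>I. hev n p (w j))" for p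
        using less.prems(1) by (simp add: sum.remove[of I i] hev0)
      then show ?thesis using step[OF 1(1), of w] less.prems(2) by blast
    next
      case 2
      obtain c where c: "w i = c *\<^sub>R w j" using cross_eq_0_imp[OF 2(4,5)] by blast
      have cn: "c ^ n \<ge> 0" using assms(1) by (simp add: zero_le_even_power)
      define w'' where "w'' = w(j := root n (1 + c ^ n) *\<^sub>R w j)"
      have "root n (1 + c ^ n) \<ge> 0" using cn by (intro real_root_ge_zero) simp
      then have "\<forall>l\<in>I - {i}. w'' l \<in> P"
        using less.prems(2) assms(4) by (auto simp: w''_def cone_def)
      moreover have "(\<Sum>l\<in>I - {i}. hev n p (w'' l)) = (\<Sum>l\<in>I. hev n p (w l))" for p
      proof -
        have j: "j \<in> I - {i}" "finite (I - {i})" using 2 less.prems(1) by auto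
        have "(\<Sum>l\<in>I - {i} - {j}. hev n p (w'' l)) = (\<Sum>l\<in>I - {i} - {j}. hev n p (w l))"
          by (intro sum.cong) (auto simp: w''_def)
        moreover have "hev n p (w'' j) = hev n p (w i) + hev n p (w j)"
          using cn assms(2) by (simp add: w''_def c hev_scale distrib_right)
        moreover have "(\<Sum>l\<in>I - {i}. hev n p (w'' l)) = hev n p (w'' j) + (\<Sum>l\<in>I - {i} - {j}. hev n p (w'' l))"
          using j by (intro sum.remove) auto
        moreover have "(\<Sum>l\<in>I. hev n p (w l)) = hev n p (w i) + (hev n p (w j) + (\<Sum>l\<in>I - {i} - {j}. hev n p (w l)))"
          using j 2(1) less.prems(1) by (simp add: sum.remove[of I i] sum.remove[of "I - {i}" j])
        ultimately show ?thesis by simp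
      qed
      ultimately show ?thesis using step[OF 2(1), of w''] by blast
    qed
  qed
qed

section \<open>Splitting off an affine point\<close>

context smooth_cubic
begin

lemma not_dvd_1: "\<not> f dvd 1"
  using prime_f by (simp add: prime_elem_def)

lemma multiple_quotient:
  assumes "F \<in> polys_le n" "f dvd F"
  shows "F = 0 \<or> (\<exists>q. n \<ge> 3 \<and> q \<in> polys_le (n - 3) \<and> F = f * q)"
proof -
  obtain c q where F: "F = comb (Std n) c + f * q" "q = 0 \<or> n \<ge> 3 \<and> q \<in> polys_le (n - 3)"
    using reduce_to_Std[OF assms(1)] by blast
  then have "f dvd comb (Std n) c" using assms(2) by (simp add: dvd_add_left_iff)
  then have "\<forall>s\<in>Std n. c s = 0" using comb_Std_dvd by blast
  then have "comb (Std n) c = 0" by (simp add: comb_def)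
  then show ?thesis using F by auto
qed

text \<open>The degree bound on the quotient matters for points at infinity: it makes the
  homogenization of \<open>F\<close> a multiple of that of \<open>f\<close>.\<close>

lemma hev_multiple:
  assumes "F \<in> polys_le n" "f dvd F" "v \<in> C"
  shows "hev n F v = 0"
  using multiple_quotient[OF assms(1,2)]
proof (elim disjE exE conjE)
  fix q assume "n \<ge> 3" "q \<in> polys_le (n - 3)" "F = f * q"
  then show ?thesis using hev_mult[OF f_in_polys_le, of q "n - 3" v] assms(3) by (simp add: C_def)
qed (simp add: hev_0)

lemma cone_C: "cone C"
  by (simp add: cone_def scale_in_C)

lemma origin_in_Std: "(0, 0) \<in> Std n"
  using lead_y_le by (auto simp: Std_def mons_def)

text \<open>A compact base of the cone of nonnegative forms modulo \<open>f\<close>. Coefficients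
  outside \<open>Std n\<close> are pinned to 0, because the set lives in a space of functions on all
  exponents.\<close>

lemma compact_normalized_nonneg:
  "compact {c :: nat \<times> nat \<Rightarrow> real. (\<forall>s. c s \<in> (if s \<in> Std n then {-1..1} else {0})) \<and>
    (\<Sum>s\<in>Std n. (c s)\<^sup>2) = 1 \<and> (\<forall>v\<in>C. hev n (comb (Std n) c) v \<ge> 0)}"
proof -
  define K where "K s = (if s \<in> Std n then {-1..1::real} else {0})" for s
  have coord: "continuous_on UNIV (\<lambda>c :: nat \<times> nat \<Rightarrow> real. c s)" for s
    by (rule continuous_on_product_coordinates)
  have "compact {c. \<forall>s. c s \<in> K s}" by (rule compact_functions_box) (simp add: K_def)
  moreover have "closed {c :: nat \<times> nat \<Rightarrow> real. (\<Sum>s\<in>Std n. (c s)\<^sup>2) = 1}"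
    by (intro closed_Collect_eq continuous_on_sum continuous_on_power continuous_on_const coord)
  moreover have "closed {c :: nat \<times> nat \<Rightarrow> real. \<forall>v\<in>C. hev n (comb (Std n) c) v \<ge> 0}"
  proof -
    have "{c :: nat \<times> nat \<Rightarrow> real. \<forall>v\<in>C. hev n (comb (Std n) c) v \<ge> 0}
        = (\<Inter>v\<in>C. {c. 0 \<le> (\<Sum>s\<in>Std n. c s * hev n (mon s) v)})" by (auto simp: hev_comb)
    moreover have "closed \<dots>"
      by (intro closed_INT ballI closed_Collect_le continuous_on_sum continuous_on_mult continuous_on_const coord)
    ultimately show ?thesis by simp
  qed
  ultimately have "compact ({c. \<forall>s. c s \<in> K s} \<inter> {c. (\<Sum>s\<in>Std n. (c s)\<^sup>2) = 1}
      \<inter> {c. \<forall>v\<in>C. hev n (comb (Std n) c) v \<ge> 0})"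
    by (intro compact_Int_closed)
  then show ?thesis by (simp add: K_def Int_def conj_assoc)
qed

text \<open>The largest \<open>t\<close> is the reciprocal of the maximum of
  \<open>F(A) / \<phi>(F)\<close> over the nonnegative forms. Strict positivity of
  \<open>\<phi>\<close> and compactness provide a maximizer \<open>F\<close>, and
  \<open>\<phi>\<close> minus \<open>t\<close> times the evaluation at \<open>A\<close> vanishes on
  it.\<close>

lemma split_off_point:
  assumes lin: "linear_on n \<phi>" and n: "even n" "n > 0"
    and van: "\<And>F. F \<in> polys_le n \<Longrightarrow> f dvd F \<Longrightarrow> \<phi> F = 0"
    and pos: "\<And>F. F \<in> polys_le n \<Longrightarrow> (\<And>v. v \<in> C \<Longrightarrow> hev n F v \<ge> 0) \<Longrightarrow> \<not> f dvd F \<Longrightarrow> \<phi> F > 0"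
    and A: "A \<in> C" "A $ 3 \<noteq> 0"
  shows "\<exists>t F (N :: nat) w. t > 0 \<and> F \<in> polys_le n \<and> \<not> f dvd F \<and> (\<forall>v\<in>C. hev n F v \<ge> 0) \<and> hev n F A > 0 \<and>
    (\<forall>i<N. w i \<in> C) \<and> (\<Sum>i<N. hev n F (w i)) = 0 \<and>
    (\<forall>p\<in>polys_le n. \<phi> p = t * hev n p A + (\<Sum>i<N. hev n p (w i)))"
proof -
  let ?c = "comb (Std n)"
  define Q where "Q = {c :: nat \<times> nat \<Rightarrow> real. (\<forall>s. c s \<in> (if s \<in> Std n then {-1..1} else {0})) \<and>
    (\<Sum>s\<in>Std n. (c s)\<^sup>2) = 1 \<and> (\<forall>v\<in>C. hev n (?c c) v \<ge> 0)}"
  have coord: "continuous_on Q (\<lambda>c. c s)" for s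
    by (rule continuous_on_subset[OF continuous_on_product_coordinates subset_UNIV])
  have \<phi>c: "\<phi> (?c c) = (\<Sum>s\<in>Std n. c s * \<phi> (mon s))" for c
    by (rule linear_on_comb[OF lin Std_subset])
  have ndvd: "\<not> f dvd ?c c" if "(\<Sum>s\<in>Std n. (c s)\<^sup>2) \<noteq> 0" for c
  proof
    assume "f dvd ?c c"
    then have "\<forall>s\<in>Std n. c s = 0" using comb_Std_dvd by blast
    then have "(\<Sum>s\<in>Std n. (c s)\<^sup>2) = 0" by simp
    with that show False by simp
  qed
  have posQ: "\<phi> (?c c) > 0" if "c \<in> Q" for c
    using that ndvd[of c] by (intro pos comb_Std_in_polys_le) (auto simp: Q_def)
  define g where "g c = hev n (?c c) A / \<phi> (?c c)" for c
  have contg: "continuous_on Q g"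
    unfolding g_def hev_comb \<phi>c
    using posQ by (intro continuous_on_divide continuous_on_sum continuous_on_mult continuous_on_const coord)
      (force simp: \<phi>c)
  have compQ: "compact Q" unfolding Q_def by (rule compact_normalized_nonneg)
  \<comment> \<open>The constant 1, as a form the \<open>n\<close>-th power of the third coordinate.
    It is positive at the affine point \<open>A\<close>, so the maximum is positive.\<close>
  define c1 where "c1 s = (if s = (0, 0) then 1 else 0 :: real)" for s :: "nat \<times> nat"
  have c1: "?c c1 = 1"
  proof -
    have "?c c1 = mon (0, 0)"
      by (rule poly_eq_cfI) (use origin_in_Std in \<open>auto simp: cf_comb cf_mon c1_def\<close>)
    then show ?thesis by (simp add: mon_0)
  qed
  have "(\<Sum>s\<in>Std n. (c1 s)\<^sup>2) = (\<Sum>s\<in>Std n. if s = (0, 0) then 1 else 0)"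
    by (intro sum.cong) (auto simp: c1_def)
  then have "(\<Sum>s\<in>Std n. (c1 s)\<^sup>2) = 1" using origin_in_Std[of n] by simp
  moreover have "c1 s \<in> (if s \<in> Std n then {-1..1} else {0})" for s
    using origin_in_Std[of n] by (cases "s = (0, 0)") (auto simp: c1_def)
  moreover have "hev n (?c c1) v \<ge> 0" for v
    using n(1) unfolding c1 hev_one by (simp add: zero_le_even_power)
  ultimately have c1Q: "c1 \<in> Q" unfolding Q_def by blast
  then obtain c0 where c0: "c0 \<in> Q" "\<And>c. c \<in> Q \<Longrightarrow> g c \<le> g c0"
    using continuous_attains_sup[OF compQ _ contg] by blast
  have "g c1 > 0"
    using posQ[OF c1Q] A(2) n(1) unfolding g_def c1 hev_one by (simp add: zero_less_power_eq)
  then have g0: "g c0 > 0" using c0(2)[OF c1Q] by linarith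
  define t where "t = 1 / g c0"
  have t: "t > 0" using g0 by (simp add: t_def)
  define F where "F = ?c c0"
  have F: "F \<in> polys_le n" "\<not> f dvd F" "\<forall>v\<in>C. hev n F v \<ge> 0"
    unfolding F_def using c0(1) ndvd[of c0] comb_Std_in_polys_le by (auto simp: Q_def)
  have gF: "g c0 * \<phi> F = hev n F A" using posQ[OF c0(1)] by (simp add: g_def F_def)
  have \<phi>F: "\<phi> F = t * hev n F A" unfolding gF[symmetric] t_def using g0 by simp
  have FA: "hev n F A > 0"
    unfolding gF[symmetric] using g0 posQ[OF c0(1)] by (simp add: F_def)
  define \<psi> where "\<psi> p = \<phi> p - t * hev n p A" for p
  have "linear_on n \<psi>"
    using lin unfolding linear_on_def \<psi>_def by (simp add: hev_add hev_smult algebra_simps)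
  moreover have "\<psi> G \<ge> 0" if G: "G \<in> polys_le n" "\<And>v. v \<in> C \<Longrightarrow> hev n G v \<ge> 0" for G
  proof (cases "f dvd G")
    case True
    then show ?thesis using van[OF G(1)] hev_multiple[OF G(1) _ A(1)] by (simp add: \<psi>_def)
  next
    case False
    obtain c q where cq: "G = ?c c + f * q" using reduce_to_Std[OF G(1)] by blast
    have fq: "f * q \<in> polys_le n" "f dvd f * q"
      using polys_le_diff[OF G(1) comb_Std_in_polys_le[of n c]] cq by simp_all
    have hG: "hev n G v = hev n (?c c) v" if "v \<in> C" for v
      using hev_multiple[OF fq that] by (simp add: cq hev_add)
    have \<phi>G: "\<phi> G = \<phi> (?c c)"
      using linear_on_add[OF lin comb_Std_in_polys_le fq(1)] van[OF fq] by (simp add: cq)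
    \<comment> \<open>Nonnegativity is invariant under scaling, so the standard part of
      \<open>G\<close> may be normalized and compared with the maximizer.\<close>
    define m where "m = sqrt (\<Sum>s\<in>Std n. (c s)\<^sup>2)"
    have "(\<Sum>s\<in>Std n. (c s)\<^sup>2) \<noteq> 0"
    proof
      assume "(\<Sum>s\<in>Std n. (c s)\<^sup>2) = 0"
      then have "\<forall>s\<in>Std n. c s = 0" by (subst (asm) sum_nonneg_eq_0_iff) auto
      then have "?c c = 0" by (simp add: comb_def)
      with False cq show False by simp
    qed
    then have sq: "(\<Sum>s\<in>Std n. (c s)\<^sup>2) > 0" by (simp add: less_le sum_nonneg)
    then have m: "m > 0" "m\<^sup>2 = (\<Sum>s\<in>Std n. (c s)\<^sup>2)" by (simp_all add: m_def)
    define c' where "c' s = (if s \<in> Std n then c s / m else 0)" for s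
    have scale: "(\<Sum>s\<in>Std n. c' s * x s) = (\<Sum>s\<in>Std n. c s * x s) / m" for x
      unfolding sum_divide_distrib by (intro sum.cong) (auto simp: c'_def)
    have "(\<Sum>s\<in>Std n. (c' s)\<^sup>2) = (\<Sum>s\<in>Std n. (c s)\<^sup>2) / m\<^sup>2"
      unfolding sum_divide_distrib by (intro sum.cong) (auto simp: c'_def power_divide)
    then have one: "(\<Sum>s\<in>Std n. (c' s)\<^sup>2) = 1" using m sq by simp
    have "\<bar>c' s\<bar> \<le> 1" if "s \<in> Std n" for s
    proof -
      have "(c' s)\<^sup>2 \<le> (\<Sum>s\<in>Std n. (c' s)\<^sup>2)" using that by (intro member_le_sum) auto
      then show ?thesis using one by (simp add: abs_square_le_1)
    qed
    then have "c' \<in> Q"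
      using one G(2) hG m unfolding Q_def
      by (auto simp: hev_comb scale abs_le_iff minus_le_iff) (simp add: c'_def)
    from c0(2)[OF this] posQ[OF this] have "hev n (?c c') A \<le> g c0 * \<phi> (?c c')"
      by (simp add: g_def[of c'] divide_le_eq)
    then have "hev n (?c c) A \<le> g c0 * \<phi> (?c c)"
      using m by (simp add: hev_comb \<phi>c scale divide_le_cancel)
    then have "t * hev n (?c c) A \<le> \<phi> (?c c)" using g0 by (simp add: t_def field_simps)
    then show ?thesis using hG[OF A(1)] \<phi>G by (simp add: \<psi>_def)
  qed
  ultimately obtain N :: nat and w where w: "\<forall>i<N. w i \<in> C" "\<forall>p\<in>polys_le n. \<psi> p = (\<Sum>i<N. hev n p (w i))"
    using cone_representation[of n \<psi>] n by blast
  have "(\<Sum>i<N. hev n F (w i)) = 0" using w(2) F(1) \<phi>F by (auto simp: \<psi>_def)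
  moreover have "\<forall>p\<in>polys_le n. \<phi> p = t * hev n p A + (\<Sum>i<N. hev n p (w i))"
    using w(2) by (auto simp: \<psi>_def)
  ultimately show ?thesis using t F FA w(1) by blast
qed

text \<open>The remaining atoms are zeros of \<open>F\<close>, whereas \<open>F\<close> is positive
  at \<open>A\<close>; therefore \<open>A\<close> stays distinct from them.\<close>

lemma short_decomposition:
  assumes lin: "linear_on (2 * d) \<phi>" and d: "d \<ge> 1"
    and van: "\<And>F. F \<in> polys_le (2 * d) \<Longrightarrow> f dvd F \<Longrightarrow> \<phi> F = 0"
    and pos: "\<And>F. F \<in> polys_le (2 * d) \<Longrightarrow> (\<And>v. v \<in> C \<Longrightarrow> hev (2 * d) F v \<ge> 0) \<Longrightarrow> \<not> f dvd F \<Longrightarrow> \<phi> F > 0"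
    and A: "A \<in> C" "A $ 3 \<noteq> 0"
  shows "\<exists>(I :: nat set) i0 v s. finite I \<and> i0 \<in> I \<and> card I \<le> 3 * d + 1 \<and> v ` I \<subseteq> C \<and> noncollinear I v \<and>
    s \<noteq> 0 \<and> v i0 = s *\<^sub>R A \<and> (\<forall>p\<in>polys_le (2 * d). \<phi> p = (\<Sum>i\<in>I. hev (2 * d) p (v i)))"
proof -
  let ?n = "2 * d"
  have n: "even ?n" "?n > 0" using d by auto
  obtain t F N w where t: "t > 0" and F: "F \<in> polys_le ?n" "\<not> f dvd F" "\<forall>v\<in>C. hev ?n F v \<ge> 0" "hev ?n F A > 0"
    and w: "\<forall>i<N::nat. w i \<in> C" "(\<Sum>i<N. hev ?n F (w i)) = 0"
    and rep: "\<forall>p\<in>polys_le ?n. \<phi> p = t * hev ?n p A + (\<Sum>i<N. hev ?n p (w i))"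
    using split_off_point[OF lin n van pos A] by blast
  obtain I' w' where I': "finite I'" "\<forall>i\<in>I'. w' i \<in> C" "noncollinear (I' :: nat set) w'"
    "\<forall>p. (\<Sum>i\<in>I'. hev ?n p (w' i)) = (\<Sum>i<N. hev ?n p (w i))"
    using merge_collinear[OF n finite_lessThan cone_C, of N w] w(1) by auto
  have "(\<Sum>i\<in>I'. hev ?n F (w' i)) = 0" using I'(4) w(2) by simp
  then have zero: "hev ?n F (w' i) = 0" if "i \<in> I'" for i
    using that I'(1,2) F(3) by (subst (asm) sum_nonneg_eq_0_iff) auto
  have "grd ?n F (w' i) \<bullet> \<tau> (w' i) = 0" if "i \<in> I'" for i
    using that I' F(3) zero by (intro nonneg_double_zero) (auto simp: noncollinear_def)
  \<comment> \<open>Nonnegativity makes every zero double, which halves the Bezout number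
    \<open>6 * d\<close>.\<close>
  then have "card I' + card I' \<le> 3 * ?n"
    using zero I' by (intro bezout[OF F(1,2) I'(1) _ I'(3)]) auto
  then have card: "card I' \<le> 3 * d" by simp
  obtain i0 where i0: "i0 \<notin> I'" using I'(1) ex_new_if_finite infinite_UNIV_nat by blast
  define v where "v = w'(i0 := root ?n t *\<^sub>R A)"
  have A0: "A \<noteq> 0" using A(2) by auto
  have s0: "root ?n t \<noteq> 0" using t n by simp
  have vI': "v i = w' i" if "i \<in> I'" for i using that i0 by (auto simp: v_def)
  have cr: "cross3 (w' i) (root ?n t *\<^sub>R A) \<noteq> 0" if i: "i \<in> I'" for i
  proof
    assume "cross3 (w' i) (root ?n t *\<^sub>R A) = 0"
    then have "cross3 (w' i) A = 0" using s0 by (simp add: cross_mult_right)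
    then obtain c where c: "w' i = c *\<^sub>R A" using cross_eq_0_imp A0 by blast
    then have "c ^ ?n * hev ?n F A = 0" using zero[OF i] by (simp add: hev_scale)
    then have "w' i = 0" using F(4) c by simp
    then show False using I'(3) i by (simp add: noncollinear_def)
  qed
  have "noncollinear (insert i0 I') v"
  proof -
    have "v i \<noteq> 0" if "i \<in> insert i0 I'" for i
      using that s0 A0 I'(3) vI' by (auto simp: v_def noncollinear_def)
    moreover have "cross3 (v i) (v j) \<noteq> 0" if ij: "i \<in> insert i0 I'" "j \<in> insert i0 I'" "i \<noteq> j" for i j
    proof -
      have v0: "v i0 = root ?n t *\<^sub>R A" by (simp add: v_def)
      consider "i \<in> I'" "j \<in> I'" | "i \<in> I'" "j = i0" | "i = i0" "j \<in> I'" using ij by auto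
      then show ?thesis
      proof cases
        case 1
        then show ?thesis using I'(3) ij(3) vI' by (simp add: noncollinear_def)
      next
        case 2
        then show ?thesis using cr vI' v0 by simp
      next
        case 3
        then show ?thesis using cr[of j] vI' v0 cross_skew[of "w' j" "v i0"] by auto
      qed
    qed
    ultimately show ?thesis by (simp add: noncollinear_def)
  qed
  moreover have "\<forall>p\<in>polys_le ?n. \<phi> p = (\<Sum>i\<in>insert i0 I'. hev ?n p (v i))"
  proof
    fix p :: "real poly poly"
    assume p: "p \<in> polys_le ?n"
    have "hev ?n p (v i0) = t * hev ?n p A" using t n by (simp add: v_def hev_weight)
    moreover have "(\<Sum>i\<in>I'. hev ?n p (v i)) = (\<Sum>i\<in>I'. hev ?n p (w' i))"
      by (intro sum.cong) (auto simp: vI')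
    ultimately show "\<phi> p = (\<Sum>i\<in>insert i0 I'. hev ?n p (v i))"
      using rep p I'(1,4) i0 by simp
  qed
  moreover have "v ` insert i0 I' \<subseteq> C" using I'(2) A(1) vI' by (auto simp: v_def scale_in_C)
  moreover have "card (insert i0 I') \<le> 3 * d + 1" using card I'(1) i0 by simp
  moreover have "finite (insert i0 I')" using I'(1) by simp
  moreover have "v i0 = root ?n t *\<^sub>R A" by (simp add: v_def)
  ultimately show ?thesis using s0 by blast
qed

end

section \<open>Moving points off the line at infinity\<close>

definition aff :: "real \<times> real \<Rightarrow> real ^ 3" where
  "aff A = vector [fst A, snd A, 1]"

lemma aff_components [simp]: "aff A $ 1 = fst A" "aff A $ 2 = snd A" "aff A $ 3 = 1"
  by (simp_all add: aff_def)

lemma hev_aff: "p \<in> polys_le n \<Longrightarrow> hev n p (aff A) = eval2 p A"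
  using hg_affine[of p n "fst A" "snd A"] by (simp add: hev_def)

lemma aff_nonzero [simp]: "aff A \<noteq> 0"
  using aff_components(3)[of A] by (metis zero_index zero_neq_one)

lemma scale_aff: "v $ 3 \<noteq> 0 \<Longrightarrow> v = v $ 3 *\<^sub>R aff (v $ 1 / v $ 3, v $ 2 / v $ 3)"
  by (simp add: vec_eq_iff forall_3)

lemma aff_collinear: "cross3 (aff A) (aff B) = 0 \<Longrightarrow> A = B"
proof -
  assume "cross3 (aff A) (aff B) = 0"
  then obtain c where c: "aff A = c *\<^sub>R aff B" using cross_eq_0_imp aff_nonzero by blast
  then have "aff A $ 3 = (c *\<^sub>R aff B) $ 3" by simp
  then have "c = 1" by simp
  with c have "aff A $ 1 = aff B $ 1" "aff A $ 2 = aff B $ 2" by simp_all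
  then show "A = B" by (simp add: prod_eq_iff)
qed

section \<open>Affine points, representers and motion along the curve\<close>

context smooth_cubic
begin

lemma aff_in_C: "aff A \<in> C \<longleftrightarrow> A \<in> real_points f"
  using hev_aff[OF f_in_polys_le] by (simp add: C_def real_points_def)

lemma finite_affine_zeros:
  assumes "p \<in> polys_le k" "\<not> f dvd p"
  shows "finite {A \<in> real_points f. eval2 p A = 0}"
proof -
  obtain U where U: "finite U" "U \<subseteq> C - {0}" "\<forall>w\<in>C - {0}. hev k p w = 0 \<longrightarrow> (\<exists>u\<in>U. cross3 w u = 0)"
    using finite_zeros[OF assms] by blast
  \<comment> \<open>Representatives at infinity yield spurious points through division by zero; they
    only enlarge a finite set.\<close>
  have "A \<in> (\<lambda>u. (u $ 1 / u $ 3, u $ 2 / u $ 3)) ` U" if A: "A \<in> real_points f" "eval2 p A = 0" for A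
  proof -
    have "aff A \<in> C - {0}" "hev k p (aff A) = 0" using A aff_in_C hev_aff[OF assms(1)] by auto
    then obtain u where u: "u \<in> U" "cross3 (aff A) u = 0" using U(3) by blast
    then have "u \<noteq> 0" using U(2) by auto
    then obtain c where c: "aff A = c *\<^sub>R u" using u(2) cross_eq_0_imp by blast
    have c3: "1 = c * u $ 3" "fst A = c * u $ 1" "snd A = c * u $ 2"
      using arg_cong[OF c, of "\<lambda>v. v $ 3"] arg_cong[OF c, of "\<lambda>v. v $ 1"] arg_cong[OF c, of "\<lambda>v. v $ 2"]
      by simp_all
    then have "u $ 3 \<noteq> 0" by auto
    moreover from this have "c = 1 / u $ 3" using c3(1) by (simp add: field_simps)
    ultimately have "A = (u $ 1 / u $ 3, u $ 2 / u $ 3)" using c3 by (simp add: prod_eq_iff)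
    with u(1) show ?thesis by blast
  qed
  then have "{A \<in> real_points f. eval2 p A = 0} \<subseteq> (\<lambda>u. (u $ 1 / u $ 3, u $ 2 / u $ 3)) ` U" by blast
  then show ?thesis using U(1) finite_subset by blast
qed

lemma ex_form_through:
  assumes "finite K" "card K < 3 * k" "k \<ge> 1"
  shows "\<exists>q\<in>polys_le k. \<not> f dvd q \<and> (\<forall>i\<in>K. hev k q (v i) = 0)"
proof -
  obtain c where c: "\<exists>s\<in>Std k. c s \<noteq> 0" "\<forall>i\<in>K. (\<Sum>s\<in>Std k. c s * hev k (mon s) (v i)) = 0"
    using homogeneous_system_nontrivial_solution[OF assms(1) finite_Std, of k "\<lambda>s i. hev k (mon s) (v i)"]
      assms(2) card_Std[OF assms(3)] by auto
  then have "\<not> f dvd comb (Std k) c" "\<forall>i\<in>K. hev k (comb (Std k) c) (v i) = 0"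
    using comb_Std_dvd[of k c] unfolding hev_comb by blast+
  then show ?thesis using comb_Std_in_polys_le by blast
qed

lemma hev_square: "q \<in> polys_le d \<Longrightarrow> hev (2 * d) (q * q) v = (hev d q v)\<^sup>2"
  using hev_mult[of q d q d v] by (simp add: mult_2 power2_eq_square)

lemma dvd_square: "f dvd q * q \<Longrightarrow> f dvd q"
  using prime_f by (simp add: prime_elem_dvd_mult_iff)

text \<open>Riesz representation: strict positivity on squares makes the Gram matrix on
  \<open>Std d\<close> nonsingular. The lemma is applied to points \<open>P\<close> at infinity,
  where it converts an evaluation into a value of \<open>\<phi>\<close>.\<close>

lemma ex_representer:
  assumes lin: "linear_on (2 * d) \<phi>"
    and van: "\<And>F. F \<in> polys_le (2 * d) \<Longrightarrow> f dvd F \<Longrightarrow> \<phi> F = 0"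
    and pos: "\<And>F. F \<in> polys_le (2 * d) \<Longrightarrow> (\<And>v. v \<in> C \<Longrightarrow> hev (2 * d) F v \<ge> 0) \<Longrightarrow> \<not> f dvd F \<Longrightarrow> \<phi> F > 0"
    and P: "P \<in> C" "P \<noteq> 0"
  shows "\<exists>r\<in>polys_le d. \<not> f dvd r \<and> (\<forall>g\<in>polys_le d. \<phi> (g * r) = hev d g P)"
proof -
  have prod: "p * q \<in> polys_le (2 * d)" if "p \<in> polys_le d" "q \<in> polys_le d" for p q :: "real poly poly"
    using polys_le_mult[OF that] by (simp add: mult_2)
  have lin_right: "\<phi> (g * comb (Std d) c) = (\<Sum>h\<in>Std d. c h * \<phi> (g * mon h))" if "g \<in> polys_le d" for g c
    unfolding mult_comb by (rule linear_on_sum[OF lin]) (intro prod that mon_Std_in_polys_le)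
  have lin_left: "\<phi> (comb (Std d) c * h) = (\<Sum>g\<in>Std d. c g * \<phi> (mon g * h))" if "h \<in> polys_le d" for h c
    using linear_on_sum[OF lin, of "Std d" "\<lambda>s. mon s * h" c] prod[OF mon_Std_in_polys_le that]
    by (simp add: comb_def sum_distrib_right)
  have "\<forall>g\<in>Std d. c g = 0"
    if c: "\<And>h. h \<in> Std d \<Longrightarrow> (\<Sum>g\<in>Std d. c g * \<phi> (mon g * mon h)) = 0" for c
  proof -
    let ?q = "comb (Std d) c"
    have q: "?q \<in> polys_le d" by (rule comb_Std_in_polys_le)
    have "\<phi> (?q * ?q) = (\<Sum>h\<in>Std d. c h * (\<Sum>g\<in>Std d. c g * \<phi> (mon g * mon h)))"
      unfolding lin_right[OF q] by (intro sum.cong refl) (simp add: lin_left mon_Std_in_polys_le)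
    also have "\<dots> = 0" using c by simp
    \<comment> \<open>A square that \<open>f\<close> does not divide would have positive
      value.\<close>
    finally have "f dvd ?q * ?q" using pos[OF prod[OF q q]] hev_square[OF q] by force
    then show ?thesis using dvd_square comb_Std_dvd by blast
  qed
  then obtain e where e: "\<forall>g\<in>Std d. \<forall>l\<in>Std d. (\<Sum>h\<in>Std d. \<phi> (mon g * mon h) * e l h) = (if g = l then 1 else 0)"
    using dual_vectors_of_independent_rows[OF finite_Std finite_Std, where a = "\<lambda>g h. \<phi> (mon g * mon h)"]
    by blast
  define r where "r = comb (Std d) (\<lambda>h. \<Sum>l\<in>Std d. hev d (mon l) P * e l h)"
  have r: "r \<in> polys_le d" unfolding r_def by (rule comb_Std_in_polys_le)
  have mon: "\<phi> (mon g * r) = hev d (mon g) P" if g: "g \<in> Std d" for g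
  proof -
    have "\<phi> (mon g * r) = (\<Sum>h\<in>Std d. \<Sum>l\<in>Std d. hev d (mon l) P * (\<phi> (mon g * mon h) * e l h))"
      unfolding r_def lin_right[OF mon_Std_in_polys_le[OF g]]
      by (simp add: sum_distrib_left mult_ac)
    also have "\<dots> = (\<Sum>l\<in>Std d. hev d (mon l) P * (\<Sum>h\<in>Std d. \<phi> (mon g * mon h) * e l h))"
      unfolding sum_distrib_left by (rule sum.swap)
    also have "\<dots> = (\<Sum>l\<in>Std d. if g = l then hev d (mon l) P else 0)"
      using e g by (intro sum.cong) auto
    also have "\<dots> = hev d (mon g) P" using g by simp
    finally show ?thesis .
  qed
  have rep: "\<phi> (g * r) = hev d g P" if g: "g \<in> polys_le d" for g
  proof -
    obtain c q where cq: "g = comb (Std d) c + f * q" using reduce_to_Std[OF g] by blast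
    have fq: "f * q \<in> polys_le d" "f dvd f * q"
      using polys_le_diff[OF g comb_Std_in_polys_le[of d c]] cq by simp_all
    have "\<phi> (g * r) = \<phi> (comb (Std d) c * r) + \<phi> (f * q * r)"
      unfolding cq distrib_right by (intro linear_on_add[OF lin] prod comb_Std_in_polys_le fq r)
    also have "\<phi> (f * q * r) = 0" by (intro van prod fq r) simp
    also have "\<phi> (comb (Std d) c * r) = hev d (comb (Std d) c) P"
      unfolding lin_left[OF r] hev_comb by (intro sum.cong) (auto simp: mon)
    finally show ?thesis using hev_multiple[OF fq P(1)] by (simp add: cq hev_add)
  qed
  have "\<not> f dvd r"
  proof
    assume "f dvd r"
    obtain g where g: "g \<in> polys_le d" "hev d g P \<noteq> 0"
      using ex_jet_interpolant[of "{}" "()" "\<lambda>_. P" d] P(2) by (auto simp: noncollinear_def)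
    have "\<phi> (g * r) = 0" using \<open>f dvd r\<close> by (intro van prod g r) simp
    with rep g show False by simp
  qed
  with r rep show ?thesis by blast
qed

text \<open>The polynomial 1 taken in degree 1 is the form \<open>z\<close>, whose zeros are the
  points at infinity.\<close>

lemma points_at_infinity:
  "\<exists>U. finite U \<and> U \<subseteq> C - {0} \<and> (\<forall>w\<in>C - {0}. w $ 3 = 0 \<longrightarrow> (\<exists>u\<in>U. cross3 w u = 0))"
  using finite_zeros[OF one_in_polys_le[of 1] not_dvd_1] by (simp add: hev_one)

text \<open>
  The jets of the forms of degree \<open>2 * d\<close> at the \<open>3 * d + 1\<close> points, two at each but one at the
  point to be moved, are \<open>6 * d + 1\<close> conditions and so determine a form modulo \<open>f\<close>. Therefore
  that point can be moved along the curve while the other points compensate.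
\<close>

lemma move_point:
  fixes v :: "nat \<Rightarrow> real ^ 3"
  assumes d: "d \<ge> 1" and I: "finite I" "card I = 3 * d + 1" "v ` I \<subseteq> C" "noncollinear I v" and i1: "i1 \<in> I"
    and e: "e > 0"
  shows "\<exists>w. (\<forall>i\<in>I. norm (w i - v i) < e) \<and> w ` I \<subseteq> C \<and> \<tau> (v i1) \<bullet> w i1 \<noteq> 0 \<and>
    (\<forall>p\<in>polys_le (2 * d). (\<Sum>i\<in>I. hev (2 * d) p (w i)) = (\<Sum>i\<in>I. hev (2 * d) p (v i)))"
proof -
  let ?n = "2 * d"
  define a where "a = \<tau> (v i1)"
  have vC: "v i \<in> C" "v i \<noteq> 0" if "i \<in> I" for i using that I by (auto simp: noncollinear_def)
  have a0: "a \<bullet> a \<noteq> 0" using \<tau>_nonzero vC i1 by (simp add: a_def)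
  have av: "a \<bullet> v i1 = 0" by (simp add: a_def \<tau>_def dot_cross_self)
  \<comment> \<open>Three groups of conditions: the sums for the standard monomials, the equation of
    the curve at each point, and a linear form measuring the displacement of \<open>v i1\<close>
    along its tangent.\<close>
  define J where "J = (Std ?n <+> I) <+> {()}"
  define k where "k j = (case j of Inl (Inl s) \<Rightarrow> ?n | Inl (Inr i) \<Rightarrow> 3 | Inr u \<Rightarrow> 1)"
    for j :: "((nat \<times> nat) + nat) + unit"
  define p where "p j i = (case j of Inl (Inl s) \<Rightarrow> mon s | Inl (Inr i') \<Rightarrow> if i' = i then f else 0
      | Inr u \<Rightarrow> if i = i1 then lin a else 0)" for j :: "((nat \<times> nat) + nat) + unit" and i
  have inJ: "Inr () \<in> J" "\<And>s. s \<in> Std ?n \<Longrightarrow> Inl (Inl s) \<in> J" "\<And>i. i \<in> I \<Longrightarrow> Inl (Inr i) \<in> J"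
    unfolding J_def by (auto simp del: split_paired_All)
  have "finite J" using I(1) by (simp add: J_def)
  have "\<forall>j\<in>J. c j = 0" if c: "\<And>i. i \<in> I \<Longrightarrow> (\<Sum>j\<in>J. c j *\<^sub>R grd (k j) (p j i) (v i)) = 0" for c
  proof -
    define g where "g = comb (Std ?n) (\<lambda>s. c (Inl (Inl s)))"
    have eq: "grd ?n g (v i) + c (Inl (Inr i)) *\<^sub>R grd 3 f (v i) + (if i = i1 then c (Inr ()) *\<^sub>R a else 0) = 0"
      if i: "i \<in> I" for i
    proof -
      have "(\<Sum>i'\<in>I. c (Inl (Inr i')) *\<^sub>R grd 3 (if i' = i then f else 0) (v i))
          = (\<Sum>i'\<in>I. if i' = i then c (Inl (Inr i')) *\<^sub>R grd 3 f (v i) else 0)"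
        by (intro sum.cong) (auto simp: grd_0)
      also have "\<dots> = c (Inl (Inr i)) *\<^sub>R grd 3 f (v i)" using i I(1) by simp
      finally have "(\<Sum>j\<in>J. c j *\<^sub>R grd (k j) (p j i) (v i)) = grd ?n g (v i)
          + c (Inl (Inr i)) *\<^sub>R grd 3 f (v i) + c (Inr ()) *\<^sub>R grd 1 (if i = i1 then lin a else 0) (v i)"
        unfolding J_def using I(1) by (simp add: sum.Plus k_def p_def g_def grd_comb)
      then show ?thesis using c[OF i] by (simp add: grd_lin[unfolded One_nat_def] grd_0 split: if_splits)
    qed
    \<comment> \<open>Pairing with \<open>v i\<close> kills the gradient of \<open>f\<close> and the
      vector \<open>a\<close>; Euler's identity turns what is left into the value of
      \<open>g\<close>.\<close>
    have zero: "hev ?n g (v i) = 0" if i: "i \<in> I" for i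
    proof -
      have "(grd ?n g (v i) + c (Inl (Inr i)) *\<^sub>R grd 3 f (v i) + (if i = i1 then c (Inr ()) *\<^sub>R a else 0)) \<bullet> v i = 0"
        unfolding eq[OF i] by simp
      then have "grd ?n g (v i) \<bullet> v i = 0"
        using av grd_f_inner[OF vC(1)[OF i]] by (simp add: inner_add_left split: if_splits)
      then show ?thesis using d by (simp add: grd_euler)
    qed
    have "grd ?n g (v i) \<bullet> \<tau> (v i) = 0" if i: "i \<in> I - {i1}" for i
    proof -
      have "(grd ?n g (v i) + c (Inl (Inr i)) *\<^sub>R grd 3 f (v i)) \<bullet> \<tau> (v i) = 0"
        using eq[of i] i by simp
      then show ?thesis by (simp add: inner_add_left grd_f_\<tau>)
    qed
    then have "\<not> f dvd g \<Longrightarrow> card I + card (I - {i1}) \<le> 3 * ?n"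
      using I zero comb_Std_in_polys_le unfolding g_def by (intro bezout) auto
    \<comment> \<open>There are \<open>6 * d + 1\<close> conditions, one more than Bezout
      allows.\<close>
    then have "f dvd g" using I(1,2) i1 by (auto simp: card_Diff_singleton)
    then have c1: "\<forall>s\<in>Std ?n. c (Inl (Inl s)) = 0" unfolding g_def using comb_Std_dvd by blast
    then have "g = 0" by (simp add: g_def comb_def)
    then have eq': "c (Inl (Inr i)) *\<^sub>R grd 3 f (v i) + (if i = i1 then c (Inr ()) *\<^sub>R a else 0) = 0"
      if "i \<in> I" for i using eq[OF that] by (simp add: grd_0)
    have "(c (Inl (Inr i1)) *\<^sub>R grd 3 f (v i1) + c (Inr ()) *\<^sub>R a) \<bullet> a = 0" using eq'[OF i1] by simp
    then have c2: "c (Inr ()) = 0" using a0 by (simp add: inner_add_left a_def grd_f_\<tau>)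
    then have "c (Inl (Inr i)) = 0" if "i \<in> I" for i
      using eq'[OF that] grd_f[OF vC[OF that]] by (simp split: if_splits)
    with c1 c2 show ?thesis by (auto simp: J_def)
  qed
  then have "\<exists>\<delta>>0. \<forall>b. (\<forall>j\<in>J. \<bar>b j\<bar> \<le> \<delta>) \<longrightarrow> (\<exists>w. (\<forall>i\<in>I. norm (w i - v i) < e) \<and>
      (\<forall>j\<in>J. (\<Sum>i\<in>I. hev (k j) (p j i) (w i)) = (\<Sum>i\<in>I. hev (k j) (p j i) (v i)) + b j))"
    by (rule perturb_points[OF I(1) \<open>finite J\<close> e])
  then obtain \<delta> where \<delta>: "\<delta> > 0" and sol: "\<forall>b. (\<forall>j\<in>J. \<bar>b j\<bar> \<le> \<delta>) \<longrightarrow> (\<exists>w. (\<forall>i\<in>I. norm (w i - v i) < e) \<and>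
      (\<forall>j\<in>J. (\<Sum>i\<in>I. hev (k j) (p j i) (w i)) = (\<Sum>i\<in>I. hev (k j) (p j i) (v i)) + b j))" by blast
  \<comment> \<open>Only the tangential displacement is prescribed to change.\<close>
  define b where "b j = (case j of Inl x \<Rightarrow> 0 | Inr u \<Rightarrow> \<delta>)" for j :: "((nat \<times> nat) + nat) + unit"
  have "\<forall>j\<in>J. \<bar>b j\<bar> \<le> \<delta>" using \<delta> by (auto simp: b_def split: sum.split)
  then obtain w where near: "\<forall>i\<in>I. norm (w i - v i) < e"
    and w: "\<forall>j\<in>J. (\<Sum>i\<in>I. hev (k j) (p j i) (w i)) = (\<Sum>i\<in>I. hev (k j) (p j i) (v i)) + b j"
    using sol by blast
  have delta: "(\<Sum>i\<in>I. hev n (if i' = i then q else 0) (u i)) = hev n q (u i')" if "i' \<in> I" for i' n q u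
  proof -
    have "(\<Sum>i\<in>I. hev n (if i' = i then q else 0) (u i)) = (\<Sum>i\<in>I. if i' = i then hev n q (u i) else 0)"
      by (intro sum.cong) (auto simp: hev_0)
    then show ?thesis using that I(1) by simp
  qed
  have wC: "w i \<in> C" if i: "i \<in> I" for i
    using bspec[OF w inJ(3)[OF i]] delta[OF i, of 3 f w] delta[OF i, of 3 f v] vC(1)[OF i]
    by (simp add: k_def p_def b_def C_def)
  have "\<tau> (v i1) \<bullet> w i1 = \<delta>"
  proof -
    have "(\<Sum>i\<in>I. hev 1 (if i1 = i then lin a else 0) (w i)) = (\<Sum>i\<in>I. hev 1 (if i1 = i then lin a else 0) (v i)) + \<delta>"
      using bspec[OF w inJ(1)] by (simp add: k_def p_def b_def eq_commute[of i1])
    then show ?thesis unfolding delta[OF i1] hev_lin using av by (simp add: a_def)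
  qed
  moreover have "(\<Sum>i\<in>I. hev ?n q (w i)) = (\<Sum>i\<in>I. hev ?n q (v i))" if q: "q \<in> polys_le ?n" for q
  proof -
    obtain c r where cr: "q = comb (Std ?n) c + f * r" using reduce_to_Std[OF q] by blast
    have fr: "f * r \<in> polys_le ?n" "f dvd f * r"
      using polys_le_diff[OF q comb_Std_in_polys_le[of ?n c]] cr by simp_all
    have mon: "(\<Sum>i\<in>I. hev ?n (mon s) (w i)) = (\<Sum>i\<in>I. hev ?n (mon s) (v i))" if "s \<in> Std ?n" for s
      using bspec[OF w inJ(2)[OF that]] by (simp add: k_def p_def b_def)
    have red: "(\<Sum>i\<in>I. hev ?n q (u i)) = (\<Sum>s\<in>Std ?n. c s * (\<Sum>i\<in>I. hev ?n (mon s) (u i)))"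
      if "\<And>i. i \<in> I \<Longrightarrow> u i \<in> C" for u
    proof -
      have "hev ?n q (u i) = (\<Sum>s\<in>Std ?n. c s * hev ?n (mon s) (u i))" if "i \<in> I" for i
        using hev_multiple[OF fr] \<open>\<And>i. i \<in> I \<Longrightarrow> u i \<in> C\<close>[OF that] by (simp add: cr hev_add hev_comb)
      then have "(\<Sum>i\<in>I. hev ?n q (u i)) = (\<Sum>i\<in>I. \<Sum>s\<in>Std ?n. c s * hev ?n (mon s) (u i))"
        by (intro sum.cong) auto
      also have "\<dots> = (\<Sum>s\<in>Std ?n. \<Sum>i\<in>I. c s * hev ?n (mon s) (u i))" by (rule sum.swap)
      finally show ?thesis by (simp add: sum_distrib_left)
    qed
    have "(\<Sum>i\<in>I. hev ?n q (w i)) = (\<Sum>s\<in>Std ?n. c s * (\<Sum>i\<in>I. hev ?n (mon s) (w i)))"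
      by (rule red[OF wC])
    also have "\<dots> = (\<Sum>s\<in>Std ?n. c s * (\<Sum>i\<in>I. hev ?n (mon s) (v i)))" using mon by simp
    also have "\<dots> = (\<Sum>i\<in>I. hev ?n q (v i))" by (rule red[symmetric, OF vC(1)])
    finally show ?thesis .
  qed
  ultimately show ?thesis using near wC \<delta> by (intro exI[of _ w]) auto
qed

text \<open>For a small perturbation the points stay distinct, affine points stay affine, and the
  moved point stays away from all other points at infinity. Its old position is excluded by the
  displacement along the tangent.\<close>

lemma move_off_infinity:
  fixes v :: "nat \<Rightarrow> real ^ 3"
  assumes d: "d \<ge> 1" and I: "finite I" "card I = 3 * d + 1" "v ` I \<subseteq> C" "noncollinear I v" and i1: "i1 \<in> I"
  shows "\<exists>w. w ` I \<subseteq> C \<and> noncollinear I w \<and> w i1 $ 3 \<noteq> 0 \<and> (\<forall>i\<in>I. v i $ 3 \<noteq> 0 \<longrightarrow> w i $ 3 \<noteq> 0) \<and>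
    (\<forall>p\<in>polys_le (2 * d). (\<Sum>i\<in>I. hev (2 * d) p (w i)) = (\<Sum>i\<in>I. hev (2 * d) p (v i)))"
proof -
  obtain U where U: "finite U" "U \<subseteq> C - {0}" "\<forall>w\<in>C - {0}. w $ 3 = 0 \<longrightarrow> (\<exists>u\<in>U. cross3 w u = 0)"
    using points_at_infinity by blast
  have "\<exists>r>0. \<forall>x\<in>{x \<in> I \<times> I. fst x \<noteq> snd x}. \<forall>y z. norm (y - v (fst x)) < r \<longrightarrow> norm (z - v (snd x)) < r \<longrightarrow> cross3 y z \<noteq> 0"
  proof (rule uniform_radius)
    show "finite {x \<in> I \<times> I. fst x \<noteq> snd x}" using I(1) by simp
    fix x assume "x \<in> {x \<in> I \<times> I. fst x \<noteq> snd x}"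
    then show "\<exists>r>0. \<forall>y z. norm (y - v (fst x)) < r \<longrightarrow> norm (z - v (snd x)) < r \<longrightarrow> cross3 y z \<noteq> 0"
      using I(4) by (intro cross_nonzero_nearby) (auto simp: noncollinear_def)
  qed force
  then obtain r1 where r1: "r1 > 0" "\<And>i j y z. i \<in> I \<Longrightarrow> j \<in> I \<Longrightarrow> i \<noteq> j \<Longrightarrow>
      norm (y - v i) < r1 \<Longrightarrow> norm (z - v j) < r1 \<Longrightarrow> cross3 y z \<noteq> 0" by force
  have "\<exists>r>0. \<forall>i\<in>{i \<in> I. v i $ 3 \<noteq> 0}. \<forall>y. norm (y - v i) < r \<longrightarrow> y $ 3 \<noteq> 0"
  proof (rule uniform_radius)
    show "finite {i \<in> I. v i $ 3 \<noteq> 0}" using I(1) by simp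
    fix i assume "i \<in> {i \<in> I. v i $ 3 \<noteq> 0}"
    then show "\<exists>r>0. \<forall>y. norm (y - v i) < r \<longrightarrow> y $ 3 \<noteq> 0"
      by (intro component_nonzero_nearby) simp
  qed force
  then obtain r2 where r2: "r2 > 0" "\<forall>i\<in>{i \<in> I. v i $ 3 \<noteq> 0}. \<forall>y. norm (y - v i) < r2 \<longrightarrow> y $ 3 \<noteq> 0"
    by blast
  have "\<exists>r>0. \<forall>u\<in>{u \<in> U. cross3 (v i1) u \<noteq> 0}. \<forall>y. norm (y - v i1) < r \<longrightarrow> cross3 y u \<noteq> 0"
  proof (rule uniform_radius)
    show "finite {u \<in> U. cross3 (v i1) u \<noteq> 0}" using U(1) by simp
    fix u assume "u \<in> {u \<in> U. cross3 (v i1) u \<noteq> 0}"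
    then obtain r where "r > 0" "\<forall>x y. norm (x - v i1) < r \<longrightarrow> norm (y - u) < r \<longrightarrow> cross3 x y \<noteq> 0"
      using cross_nonzero_nearby[of "v i1" u] by blast
    then show "\<exists>r>0. \<forall>y. norm (y - v i1) < r \<longrightarrow> cross3 y u \<noteq> 0" by (intro exI[of _ r]) auto
  qed force
  then obtain r3 where r3: "r3 > 0"
    "\<forall>u\<in>{u \<in> U. cross3 (v i1) u \<noteq> 0}. \<forall>y. norm (y - v i1) < r3 \<longrightarrow> cross3 y u \<noteq> 0"
    by blast
  define e where "e = min r1 (min r2 r3)"
  have "e > 0" using r1(1) r2(1) r3(1) by (simp add: e_def)
  then obtain w where near: "\<forall>i\<in>I. norm (w i - v i) < e" and wC: "w ` I \<subseteq> C" and \<tau>w: "\<tau> (v i1) \<bullet> w i1 \<noteq> 0"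
    and rep: "\<forall>p\<in>polys_le (2 * d). (\<Sum>i\<in>I. hev (2 * d) p (w i)) = (\<Sum>i\<in>I. hev (2 * d) p (v i))"
    using move_point[OF d I i1] by blast
  have near: "norm (w i - v i) < r1" "norm (w i - v i) < r2" "norm (w i - v i) < r3" if "i \<in> I" for i
    using near that by (auto simp: e_def)
  have cr: "cross3 (w i) (w j) \<noteq> 0" if "i \<in> I" "j \<in> I" "i \<noteq> j" for i j
    using r1(2)[OF that near(1) near(1)] that by blast
  have "w i \<noteq> 0" if i: "i \<in> I" for i
  proof -
    \<comment> \<open>Since \<open>d \<ge> 1\<close> there is a second point, and a nonzero cross
      product with it shows that \<open>w i\<close> is nonzero.\<close>
    have "card (I - {i}) \<noteq> 0" using I(1,2) i d by (simp add: card_Diff_singleton)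
    then obtain j where "j \<in> I - {i}" by (metis all_not_in_conv card.empty)
    then show ?thesis using cr[OF i, of j] by auto
  qed
  with cr have nc: "noncollinear I w" by (simp add: noncollinear_def)
  have "w i1 $ 3 \<noteq> 0"
  proof
    assume "w i1 $ 3 = 0"
    moreover have "w i1 \<in> C - {0}" using wC nc i1 by (auto simp: noncollinear_def)
    ultimately obtain u where u: "u \<in> U" "cross3 (w i1) u = 0" using U(3) by blast
    then have "cross3 (v i1) u = 0" using r3(2) near(3)[OF i1] by blast
    moreover have "u \<noteq> 0" using u(1) U(2) by blast
    ultimately obtain c c' where c: "v i1 = c *\<^sub>R u" "w i1 = c' *\<^sub>R u"
      using cross_eq_0_imp u(2) by metis
    have "v i1 \<noteq> 0" using I(4) i1 by (simp add: noncollinear_def)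
    then have "c \<noteq> 0" using c(1) by auto
    moreover have "\<tau> (v i1) \<bullet> v i1 = 0" by (simp add: \<tau>_def dot_cross_self)
    ultimately have "\<tau> (v i1) \<bullet> u = 0" by (simp add: c(1))
    then show False using \<tau>w c(2) by simp
  qed
  moreover have "\<forall>i\<in>I. v i $ 3 \<noteq> 0 \<longrightarrow> w i $ 3 \<noteq> 0" using r2(2) near(2) by blast
  ultimately show ?thesis using wC nc rep by blast
qed

lemma move_all_off_infinity:
  fixes v :: "nat \<Rightarrow> real ^ 3"
  assumes d: "d \<ge> 1" and I: "finite I" "card I = 3 * d + 1" "v ` I \<subseteq> C" "noncollinear I v"
  shows "\<exists>w. w ` I \<subseteq> C \<and> noncollinear I w \<and> (\<forall>i\<in>I. w i $ 3 \<noteq> 0) \<and>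
    (\<forall>p\<in>polys_le (2 * d). (\<Sum>i\<in>I. hev (2 * d) p (w i)) = (\<Sum>i\<in>I. hev (2 * d) p (v i)))"
  using I(3,4)
proof (induction "card {i \<in> I. v i $ 3 = 0}" arbitrary: v rule: less_induct)
  case less
  show ?case
  proof (cases "\<exists>i\<in>I. v i $ 3 = 0")
    case True
    then obtain i1 where i1: "i1 \<in> I" "v i1 $ 3 = 0" by blast
    obtain w where w: "w ` I \<subseteq> C" "noncollinear I w" "w i1 $ 3 \<noteq> 0" "\<forall>i\<in>I. v i $ 3 \<noteq> 0 \<longrightarrow> w i $ 3 \<noteq> 0"
      "\<forall>p\<in>polys_le (2 * d). (\<Sum>i\<in>I. hev (2 * d) p (w i)) = (\<Sum>i\<in>I. hev (2 * d) p (v i))"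
      using move_off_infinity[OF d I(1,2) less.prems i1(1)] by blast
    have "card {i \<in> I. w i $ 3 = 0} < card {i \<in> I. v i $ 3 = 0}"
      using w(3,4) i1 I(1) by (intro psubset_card_mono) auto
    from less.hyps[OF this w(1,2)] w(5) show ?thesis by auto
  next
    case False
    then show ?thesis using less.prems by blast
  qed
qed

theorem few_atoms_of_positive:
  assumes lin: "linear_on (2 * d) \<phi>" and d: "d \<ge> 1" and inf: "infinite (real_points f)"
    and van: "\<And>F. F \<in> polys_le (2 * d) \<Longrightarrow> f dvd F \<Longrightarrow> \<phi> F = 0"
    and pos: "\<And>F. F \<in> polys_le (2 * d) \<Longrightarrow> (\<And>v. v \<in> C \<Longrightarrow> hev (2 * d) F v \<ge> 0) \<Longrightarrow> \<not> f dvd F \<Longrightarrow> \<phi> F > 0"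
  shows "\<exists>S x. finite S \<and> S \<subseteq> real_points f \<and> card S \<le> 3 * d + 1 \<and> (\<forall>A\<in>S. x A > 0) \<and>
    (\<forall>p\<in>polys_le (2 * d). \<phi> p = (\<Sum>A\<in>S. x A * eval2 p A))"
proof -
  obtain U where U: "finite U" "U \<subseteq> C - {0}" "\<forall>w\<in>C - {0}. w $ 3 = 0 \<longrightarrow> (\<exists>u\<in>U. cross3 w u = 0)"
    using points_at_infinity by blast
  have "\<forall>u\<in>U. \<exists>r. r \<in> polys_le d \<and> \<not> f dvd r \<and> (\<forall>g\<in>polys_le d. \<phi> (g * r) = hev d g u)"
    using ex_representer[OF lin van pos] U(2) by blast
  then obtain r where r: "\<And>u. u \<in> U \<Longrightarrow> r u \<in> polys_le d" "\<And>u. u \<in> U \<Longrightarrow> \<not> f dvd r u"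
    "\<And>u g. u \<in> U \<Longrightarrow> g \<in> polys_le d \<Longrightarrow> \<phi> (g * r u) = hev d g u" by metis
  \<comment> \<open>The points to avoid are the affine zeros of the representers of the points at
    infinity.\<close>
  have "finite (\<Union>u\<in>U. {A \<in> real_points f. eval2 (r u) A = 0})"
    using U(1) finite_affine_zeros r by blast
  then have "\<not> real_points f \<subseteq> (\<Union>u\<in>U. {A \<in> real_points f. eval2 (r u) A = 0})"
    using inf finite_subset by blast
  then obtain A where A: "A \<in> real_points f" "\<And>u. u \<in> U \<Longrightarrow> eval2 (r u) A \<noteq> 0" by blast
  have "aff A \<in> C" "aff A $ 3 \<noteq> 0" using A(1) aff_in_C by simp_all
  from short_decomposition[OF lin d van pos this]
  obtain I :: "nat set" and i0 v s where I: "finite I" "i0 \<in> I" "card I \<le> 3 * d + 1" "v ` I \<subseteq> C" "noncollinear I v"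
    and s: "s \<noteq> 0" "v i0 = s *\<^sub>R aff A" and rep: "\<forall>p\<in>polys_le (2 * d). \<phi> p = (\<Sum>i\<in>I. hev (2 * d) p (v i))"
    by blast
  obtain w where w: "w ` I \<subseteq> C" "noncollinear I w" "\<forall>i\<in>I. w i $ 3 \<noteq> 0"
    "\<forall>p\<in>polys_le (2 * d). \<phi> p = (\<Sum>i\<in>I. hev (2 * d) p (w i))"
  proof (cases "card I = 3 * d + 1")
    case True
    then obtain w where "w ` I \<subseteq> C" "noncollinear I w" "\<forall>i\<in>I. w i $ 3 \<noteq> 0"
      "\<forall>p\<in>polys_le (2 * d). (\<Sum>i\<in>I. hev (2 * d) p (w i)) = (\<Sum>i\<in>I. hev (2 * d) p (v i))"
      using move_all_off_infinity[OF d I(1) _ I(4,5)] by blast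
    then show ?thesis using rep that[of w] by simp
  next
    case False
    then have "card (I - {i0}) < 3 * d" using I(1-3) d by (simp add: card_Diff_singleton)
    then obtain q where q: "q \<in> polys_le d" "\<not> f dvd q" "\<forall>i\<in>I - {i0}. hev d q (v i) = 0"
      using ex_form_through[of "I - {i0}" d v] I(1) d by auto
    have \<phi>q: "\<phi> (q * g) = hev d q (v i0) * hev d g (v i0)" if g: "g \<in> polys_le d" for g
    proof -
      have qg: "q * g \<in> polys_le (2 * d)" using polys_le_mult[OF q(1) g] by (simp add: mult_2)
      have "hev (2 * d) (q * g) (v i) = hev d q (v i) * hev d g (v i)" for i
        using hev_mult[OF q(1) g] by (simp add: mult_2)
      then have "\<phi> (q * g) = (\<Sum>i\<in>I. hev d q (v i) * hev d g (v i))" using rep qg by simp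
      also have "\<dots> = hev d q (v i0) * hev d g (v i0)"
        using q(3) by (simp add: sum.remove[OF I(1,2)])
      finally show ?thesis .
    qed
    have "\<not> f dvd q * q" using q(2) dvd_square by blast
    then have "\<phi> (q * q) > 0"
      using pos[of "q * q"] polys_le_mult[OF q(1) q(1)] hev_square[OF q(1)] by (simp add: mult_2)
    then have q0: "hev d q (v i0) \<noteq> 0" using \<phi>q[OF q(1)] by auto
    have "v i $ 3 \<noteq> 0" if i: "i \<in> I" for i
    proof
      assume 0: "v i $ 3 = 0"
      then have "i \<noteq> i0" using s by auto
      have "v i \<in> C - {0}" using i I(4,5) by (auto simp: noncollinear_def)
      then obtain u where u: "u \<in> U" "cross3 (v i) u = 0" using U(3) 0 by blast
      then obtain c where c: "v i = c *\<^sub>R u" using cross_eq_0_imp U(2) by blast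
      have "c \<noteq> 0" using c \<open>v i \<in> C - {0}\<close> by auto
      \<comment> \<open>The number \<open>\<phi> (q * r u)\<close> computed twice: by the defining
        property of the representer, and by the atoms, of which only \<open>v i0\<close>
        contributes.\<close>
      have "hev d q u = hev d q (v i0) * hev d (r u) (v i0)"
        using \<phi>q[OF r(1)[OF u(1)]] r(3)[OF u(1) q(1)] by simp
      moreover have "hev d (r u) (v i0) \<noteq> 0"
        using A(2)[OF u(1)] s hev_aff[OF r(1)[OF u(1)]] by (simp add: hev_scale)
      ultimately have "hev d q u \<noteq> 0" using q0 by simp
      then have "hev d q (v i) \<noteq> 0" using c \<open>c \<noteq> 0\<close> by (simp add: hev_scale)
      with q(3) i \<open>i \<noteq> i0\<close> show False by blast
    qed
    then show ?thesis using I rep that[of v] by blast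
  qed
  define B where "B i = (w i $ 1 / w i $ 3, w i $ 2 / w i $ 3)" for i
  have wB: "w i = w i $ 3 *\<^sub>R aff (B i)" if "i \<in> I" for i
    using scale_aff[of "w i"] w(3) that by (simp add: B_def)
  have inj: "inj_on B I"
  proof (rule inj_onI)
    fix i j assume ij: "i \<in> I" "j \<in> I" "B i = B j"
    have "cross3 (w i) (w j) = 0"
      by (subst wB[OF ij(1)], subst wB[OF ij(2)]) (simp add: ij(3) cross_mult_left cross_mult_right)
    then show "i = j" using w(2) ij by (auto simp: noncollinear_def)
  qed
  \<comment> \<open>Dehomogenizing shifts the length of the vector back into a weight, positive
    because the exponent is even.\<close>
  define x where "x A = w (the_inv_into I B A) $ 3 ^ (2 * d)" for A
  have x: "x (B i) = w i $ 3 ^ (2 * d)" if "i \<in> I" for i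
    by (simp add: x_def the_inv_into_f_f[OF inj that])
  have B: "B i \<in> real_points f" if "i \<in> I" for i
  proof -
    have "(1 / w i $ 3) *\<^sub>R w i \<in> C" using w(1) that scale_in_C by blast
    moreover have "(1 / w i $ 3) *\<^sub>R w i = aff (B i)"
      using w(3) that by (subst wB[OF that]) simp
    ultimately show ?thesis using aff_in_C by metis
  qed
  have "\<phi> p = (\<Sum>A\<in>B ` I. x A * eval2 p A)" if p: "p \<in> polys_le (2 * d)" for p
  proof -
    have "hev (2 * d) p (w i) = x (B i) * eval2 p (B i)" if "i \<in> I" for i
      by (subst wB[OF that]) (simp only: hev_scale hev_aff[OF p] x[OF that])
    then have "\<phi> p = (\<Sum>i\<in>I. x (B i) * eval2 p (B i))" using w(4) p by simp
    then show ?thesis by (simp add: sum.reindex[OF inj])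
  qed
  moreover have "\<forall>A\<in>B ` I. x A > 0"
    using x w(3) by (auto simp: zero_less_power_eq)
  moreover have "finite (B ` I)" "card (B ` I) \<le> 3 * d + 1" "B ` I \<subseteq> real_points f"
    using I(1,3) B inj by (auto simp: card_image)
  ultimately show ?thesis by blast
qed

end

section \<open>The real points and the vanishing ideal\<close>

lemma eval2_altdef: "eval2 p (a, b) = (\<Sum>j\<le>degree p. poly (coeff p j) a * b ^ j)"
  for a b :: "'a::comm_ring_1"
  by (simp add: eval2_def poly_altdef[of p] poly_sum)

lemma eval2_add: "eval2 (p + q) A = eval2 p A + eval2 q A"
  and eval2_mult: "eval2 (p * q) A = eval2 p A * eval2 q A"
  for A :: "'a::comm_ring_1 \<times> 'a"
  by (simp_all add: eval2_def)

lemma eval2_diff: "eval2 (p - q) A = eval2 p A - eval2 q A" for A :: "real \<times> real"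
  by (simp add: eval2_def)

lemma eval2_smult: "eval2 (smult [:c:] p) A = c * eval2 p A" for A :: "real \<times> real"
  by (simp add: eval2_def)

lemma eval2_sum: "eval2 (\<Sum>i\<in>I. smult [:c i:] (p i)) A = (\<Sum>i\<in>I. c i * eval2 (p i) A)" for A :: "real \<times> real"
  by (simp add: eval2_def poly_sum)

lemma eval2_1 [simp]: "eval2 1 A = 1" for A :: "real \<times> real"
  by (simp add: eval2_def)

lemma continuous_on_eval2: "continuous_on S (eval2 (p :: real poly poly))"
proof -
  have "eval2 p = (\<lambda>A. \<Sum>j\<le>degree p. poly (coeff p j) (fst A) * snd A ^ j)"
    by (rule ext) (metis eval2_altdef prod.collapse)
  then show ?thesis
    by (simp only:) (intro continuous_on_sum continuous_on_mult continuous_on_power continuous_on_poly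
        continuous_on_fst continuous_on_snd continuous_on_id)
qed

lemma measurable_eval2 [measurable]: "eval2 p \<in> borel_measurable borel" for p :: "real poly poly"
  by (rule borel_measurable_continuous_onI) (rule continuous_on_eval2)

lemma closed_real_points: "closed (real_points f)"
  unfolding real_points_def by (intro closed_Collect_eq continuous_on_eval2 continuous_on_const)

lemma degree_complexify: "degree (complexify p) = degree p"
  unfolding complexify_def by (rule degree_map_poly) (simp add: poly_eq_iff coeff_map_poly)

lemma poly_map_of_real: "poly (map_poly of_real u) (of_real a) = complex_of_real (poly u a)"
  by (simp add: poly_altdef degree_map_poly coeff_map_poly)

lemma eval2_complexify: "eval2 (complexify p) (of_real a, of_real b) = of_real (eval2 p (a, b))"
proof -
  have "coeff (complexify p) j = map_poly of_real (coeff p j)" for j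
    by (simp add: complexify_def coeff_map_poly)
  then show ?thesis by (simp add: eval2_altdef degree_complexify poly_map_of_real)
qed

lemma dvd_imp_vanishing_ideal: "f dvd p \<Longrightarrow> p \<in> vanishing_ideal f"
  by (auto simp: vanishing_ideal_def curve_def complexify_mult eval2_mult)

lemma vanishing_ideal_real_points: "p \<in> vanishing_ideal f \<Longrightarrow> A \<in> real_points f \<Longrightarrow> eval2 p A = 0"
proof -
  assume p: "p \<in> vanishing_ideal f" and A: "A \<in> real_points f"
  obtain a b where ab: "A = (a, b)" by force
  have "(of_real a, of_real b) \<in> curve f"
    using A by (simp add: curve_def eval2_complexify real_points_def ab)
  then show ?thesis using p by (auto simp: vanishing_ideal_def eval2_complexify ab)
qed

lemma totally_real_vanish:
  assumes "totally_real f" "\<And>A. A \<in> real_points f \<Longrightarrow> eval2 p A = 0" "P \<in> curve f"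
  shows "eval2 (complexify p) P = 0"
proof -
  have "map_prod of_real of_real ` real_points f \<subseteq> zero_locus {p}"
    using assms(2) by (auto simp: zero_locus_def eval2_complexify)
  then have "curve f \<subseteq> zero_locus {p}" using assms(1) unfolding totally_real_def by blast
  then show ?thesis using assms(3) by (auto simp: zero_locus_def)
qed

section \<open>Infinitely many real points\<close>

lemma poly_vanishing_on_finite_set:
  fixes E :: "real set"
  assumes "finite E"
  shows "\<exists>u. u \<noteq> 0 \<and> (\<forall>a\<in>E. poly u a = 0)"
  using assms by (intro exI[of _ "\<Prod>a\<in>E. [:- a, 1:]"]) (auto simp: poly_prod)

lemma infinite_UNIV_complex: "infinite (UNIV :: complex set)"
  by (rule infinite_UNIV_char_0)

lemma ex_root_complex:
  fixes p :: "complex poly"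
  assumes "degree p \<ge> 1"
  shows "\<exists>z. poly p z = 0"
  using assms fundamental_theorem_of_algebra[of p] by (simp add: constant_degree)

text \<open>Finitely many real points would be killed by a nonzero polynomial in one coordinate.
  Total reality extends its vanishing to the complex curve, on which that coordinate takes almost
  every value.\<close>

lemma infinite_real_points:
  assumes "plane_cubic f" "totally_real f"
  shows "infinite (real_points f)"
proof
  assume fin: "finite (real_points f)"
  let ?f = "complexify f"
  show False
  proof (cases "degree f = 0")
    case False
    obtain u where u: "u \<noteq> 0" "\<forall>a\<in>fst ` real_points f. poly u a = 0"
      using poly_vanishing_on_finite_set fin by blast
    let ?u = "map_poly complex_of_real u" and ?l = "lead_coeff ?f"
    have "?u \<noteq> 0" using u(1) by (auto simp: poly_eq_iff coeff_map_poly)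
    moreover have "?l \<noteq> 0" using False degree_complexify[of f] by (metis degree_0 leading_coeff_0_iff)
    ultimately have "finite ({x. poly ?u x = 0} \<union> {x. poly ?l x = 0})" by (simp add: poly_roots_finite)
    \<comment> \<open>Off the zeros of the leading coefficient in \<open>y\<close>, the curve has a
      point above \<open>X\<close>.\<close>
    then obtain X where X: "poly ?u X \<noteq> 0" "poly ?l X \<noteq> 0"
      using infinite_UNIV_complex by (metis (mono_tags, lifting) UnI1 UnI2 UNIV_I finite_subset mem_Collect_eq subsetI)
    define g where "g = (\<Sum>j\<le>degree ?f. monom (poly (coeff ?f j) X) j)"
    have "coeff g (degree ?f) \<noteq> 0" using X(2) by (simp add: g_def coeff_sum)
    then have "degree g \<ge> 1"
      using False le_degree[of g "degree ?f"] by (simp add: degree_complexify)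
    then obtain Y where "poly g Y = 0" using ex_root_complex by blast
    then have "(X, Y) \<in> curve f"
      by (simp add: curve_def eval2_altdef g_def poly_sum poly_monom)
    then have "eval2 (complexify [:u:]) (X, Y) = 0"
      by (rule totally_real_vanish[OF assms(2), rotated]) (use u(2) in \<open>auto simp: eval2_def\<close>)
    moreover have "complexify [:u:] = [:?u:]" using u(1) by (simp add: complexify_def map_poly_pCons)
    ultimately show False using X(1) by (simp add: eval2_def)
  next
    \<comment> \<open>The curve consists of vertical lines, so the second coordinate is used
      instead.\<close>
    case True
    then obtain g where g: "f = [:g:]" using degree_eq_zeroE by blast
    have "degree g \<ge> 1"
    proof (rule ccontr)
      assume "\<not> degree g \<ge> 1"
      then obtain c where "g = [:c:]" by (metis degree_eq_zeroE not_less_eq_eq One_nat_def le_zero_eq)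
      then have "f = smult [:c:] 1" by (simp add: g)
      then have "f \<in> polys_le 2" using polys_le_smult[OF one_in_polys_le] by metis
      then show False using assms(1) by (simp add: plane_cubic_def)
    qed
    then have "degree (map_poly complex_of_real g) \<ge> 1" by (simp add: degree_map_poly)
    then obtain X where X: "poly (map_poly complex_of_real g) X = 0" using ex_root_complex by blast
    have "complexify f = [:map_poly complex_of_real g:]"
      using \<open>degree g \<ge> 1\<close> by (auto simp: complexify_def g map_poly_pCons)
    then have "(X, Y) \<in> curve f" for Y using X by (simp add: curve_def eval2_def)
    moreover obtain u where u: "u \<noteq> 0" "\<forall>b\<in>snd ` real_points f. poly u b = 0"
      using poly_vanishing_on_finite_set fin by blast
    define q where "q = map_poly (\<lambda>c. [:c:]) u"
    have deg: "degree q = degree u" unfolding q_def by (rule degree_map_poly) simp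
    have eq: "eval2 q (a, b) = poly u b" for a b
      unfolding eval2_altdef deg by (simp add: q_def coeff_map_poly poly_altdef)
    ultimately have "eval2 (complexify q) (X, Y) = 0" for Y
      using u(2) by (intro totally_real_vanish[OF assms(2)]) auto
    moreover have "eval2 (complexify q) (X, Y) = poly (map_poly of_real u) Y" for Y
      unfolding eval2_altdef degree_complexify deg
      by (simp add: complexify_def q_def coeff_map_poly map_poly_pCons poly_altdef degree_map_poly)
    ultimately have "poly (map_poly of_real u) Y = 0" for Y :: complex by simp
    then have "map_poly complex_of_real u = 0" using poly_all_0_iff_0 by blast
    then show False using u(1) by (auto simp: poly_eq_iff coeff_map_poly)
  qed
qed

section \<open>Consequences of total reality\<close>

locale real_cubic = smooth_cubic +
  assumes totally_real: "totally_real f"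
begin

lemma infinite_points: "infinite (real_points f)"
  using infinite_real_points[OF cubic totally_real] .

text \<open>A polynomial not divisible by \<open>f\<close> has only finitely many zeros among the
  infinitely many real points. Residue classes thereby become classes modulo multiples of
  \<open>f\<close>.\<close>

lemma vanishing_on_points_imp_dvd:
  assumes "\<And>A. A \<in> real_points f \<Longrightarrow> eval2 p A = 0"
  shows "f dvd p"
proof (rule ccontr)
  assume "\<not> f dvd p"
  obtain k where "p \<in> polys_le k" using ex_polys_le by blast
  then have "finite {A \<in> real_points f. eval2 p A = 0}"
    using \<open>\<not> f dvd p\<close> by (rule finite_affine_zeros)
  moreover have "{A \<in> real_points f. eval2 p A = 0} = real_points f" using assms by blast
  ultimately show False using infinite_points by simp
qed

lemma vanishing_ideal_iff: "p \<in> vanishing_ideal f \<longleftrightarrow> f dvd p"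
  using vanishing_on_points_imp_dvd vanishing_ideal_real_points dvd_imp_vanishing_ideal by blast

lemma residue_class_eqI:
  assumes "p \<in> polys_le k" "q \<in> polys_le k" "f dvd p - q"
  shows "residue_class f k p = residue_class f k q"
proof -
  have "p - q \<in> ideal_le f k"
    using assms by (simp add: ideal_le_def vanishing_ideal_iff polys_le_diff)
  moreover have "r + s \<in> ideal_le f k" "r - s \<in> ideal_le f k" if "r \<in> ideal_le f k" "s \<in> ideal_le f k" for r s
    using that by (auto simp: ideal_le_def vanishing_ideal_iff polys_le_diff polys_le_add)
  ultimately have "z - p \<in> ideal_le f k \<longleftrightarrow> z - q \<in> ideal_le f k" for z
    by (metis add_diff_cancel_right' diff_add_cancel diff_diff_eq2 diff_right_commute)
  moreover have "residue_class f k r = {z. z - r \<in> ideal_le f k}" for r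
    by (force simp: residue_class_def elt_set_plus_def)
  ultimately show ?thesis by simp
qed

lemma mem_residue_class_eval2:
  "q \<in> residue_class f k p \<Longrightarrow> A \<in> real_points f \<Longrightarrow> eval2 q A = eval2 p A"
  by (auto simp: residue_class_def elt_set_plus_def ideal_le_def eval2_add vanishing_ideal_real_points)

lemma self_mem_residue_class: "p \<in> residue_class f k p"
  by (auto simp: residue_class_def elt_set_plus_def ideal_le_def polys_le_0 vanishing_ideal_0 intro!: bexI[of _ 0])

lemma linear_functional_linear_on:
  "linear_functional f k L \<Longrightarrow> linear_on k (\<lambda>p. L (residue_class f k p))"
  by (simp add: linear_functional_def linear_on_def)

lemma linear_functional_multiple:
  assumes "linear_functional f k L" "F \<in> polys_le k" "f dvd F"
  shows "L (residue_class f k F) = 0"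
proof -
  have "residue_class f k F = residue_class f k 0"
    using assms(2,3) by (intro residue_class_eqI polys_le_0) auto
  then show ?thesis using linear_on_0[OF linear_functional_linear_on[OF assms(1)]] by simp
qed

section \<open>Moment functionals have few atoms\<close>

lemma eval2_nonneg_of_hev:
  assumes "F \<in> polys_le n" "\<And>v. v \<in> C \<Longrightarrow> hev n F v \<ge> 0" "A \<in> real_points f"
  shows "eval2 F A \<ge> 0"
  using assms(2)[of "aff A"] assms(1,3) by (simp add: aff_in_C hev_aff)

lemma noncollinear_aff: "noncollinear S aff"
  using aff_collinear by (auto simp: noncollinear_def)

lemma card_double_zeros:
  assumes "F \<in> polys_le (2 * d)" "\<not> f dvd F" "\<And>v. v \<in> C \<Longrightarrow> hev (2 * d) F v \<ge> 0"
  shows "card {A \<in> real_points f. eval2 F A = 0} \<le> 3 * d"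
proof -
  let ?Z = "{A \<in> real_points f. eval2 F A = 0}"
  have "card ?Z + card ?Z \<le> 3 * (2 * d)"
  proof (rule bezout[OF assms(1,2), where v = aff])
    show "finite ?Z" using finite_affine_zeros[OF assms(1,2)] .
    fix A assume "A \<in> ?Z"
    then show "grd (2 * d) F (aff A) \<bullet> \<tau> (aff A) = 0"
      using hev_aff[OF assms(1)] assms(3) by (intro nonneg_double_zero) (auto simp: aff_in_C)
  qed (use hev_aff[OF assms(1)] noncollinear_aff in \<open>auto simp: aff_in_C\<close>)
  then show ?thesis by simp
qed

lemma few_atoms_of_moment_functional:
  assumes d: "d \<ge> 1" and lin: "linear_functional f (2 * d) L" and mom: "moment_functional f (2 * d) L"
  shows "\<exists>S x. finite S \<and> S \<subseteq> real_points f \<and> card S \<le> 3 * d + 1 \<and> (\<forall>A\<in>S. x A > 0) \<and>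
    (\<forall>p\<in>polys_le (2 * d). L (residue_class f (2 * d) p) = (\<Sum>A\<in>S. x A * eval2 p A))"
proof -
  let ?n = "2 * d"
  define \<phi> where "\<phi> p = L (residue_class f ?n p)" for p
  obtain \<mu> :: "(real \<times> real) measure" where sets: "sets \<mu> = sets borel"
    and null: "emeasure \<mu> (- real_points f) = 0"
    and int: "\<And>p. p \<in> polys_le ?n \<Longrightarrow> integrable \<mu> (eval2 p)" "\<And>p. p \<in> polys_le ?n \<Longrightarrow> \<phi> p = (\<integral>A. eval2 p A \<partial>\<mu>)"
    using mom unfolding moment_functional_def \<phi>_def by blast
  have AE: "AE A in \<mu>. A \<in> real_points f"
    by (rule AE_I[OF _ null]) (use sets closed_real_points in \<open>auto intro: borel_closed\<close>)
  have lin\<phi>: "linear_on ?n \<phi>" unfolding \<phi>_def by (rule linear_functional_linear_on[OF lin])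
  have van: "\<phi> F = 0" if "F \<in> polys_le ?n" "f dvd F" for F
    unfolding \<phi>_def by (rule linear_functional_multiple[OF lin that])
  have AE_nonneg: "AE A in \<mu>. 0 \<le> eval2 F A"
    if "F \<in> polys_le ?n" "\<And>v. v \<in> C \<Longrightarrow> hev ?n F v \<ge> 0" for F
    using AE by eventually_elim (use eval2_nonneg_of_hev[OF that] in auto)
  show ?thesis
  proof (cases "\<exists>F\<in>polys_le ?n. (\<forall>v\<in>C. hev ?n F v \<ge> 0) \<and> \<not> f dvd F \<and> \<phi> F = 0")
    case True
    then obtain F where F: "F \<in> polys_le ?n" "\<And>v. v \<in> C \<Longrightarrow> hev ?n F v \<ge> 0" "\<not> f dvd F" "\<phi> F = 0" by blast
    define Z where "Z = {A \<in> real_points f. eval2 F A = 0}"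
    have Z: "finite Z" "card Z \<le> 3 * d"
      unfolding Z_def using finite_affine_zeros[OF F(1,3)] card_double_zeros[OF F(1,3,2)] by auto
    have "AE A in \<mu>. eval2 F A = 0"
      using integral_nonneg_eq_0_iff_AE[OF int(1)[OF F(1)] AE_nonneg[OF F(1,2)]] int(2)[OF F(1)] F(4) by simp
    then have AEZ: "AE A in \<mu>. A \<in> Z" using AE by eventually_elim (simp add: Z_def)
    \<comment> \<open>The constant 1 is among the integrable polynomials, so the measure is finite
      and singletons have real mass.\<close>
    have "integrable \<mu> (\<lambda>A. 1 :: real)"
    proof -
      have "eval2 (1 :: real poly poly) = (\<lambda>A. 1)" by (rule ext) simp
      then show ?thesis using int(1)[OF one_in_polys_le] by simp
    qed
    then interpret finite_measure \<mu>
      by (intro finite_measureI) (simp add: integrable_iff_bounded ennreal_mult_less_top)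
    have "\<phi> p = (\<Sum>A\<in>Z. measure \<mu> {A} * eval2 p A)" if p: "p \<in> polys_le ?n" for p
    proof -
      have single: "{A} \<in> sets \<mu>" for A using sets by simp
      have "\<phi> p = (\<integral>B. (\<Sum>A\<in>Z. eval2 p A * indicator {A} B) \<partial>\<mu>)"
        unfolding int(2)[OF p]
      proof (rule integral_cong_AE)
        show "AE B in \<mu>. eval2 p B = (\<Sum>A\<in>Z. eval2 p A * indicator {A} B)"
          using AEZ
        proof eventually_elim
          case (elim B)
          have "(\<Sum>A\<in>Z. eval2 p A * indicator {A} B) = (\<Sum>A\<in>Z. if A = B then eval2 p A else 0)"
            by (intro sum.cong) (auto simp: indicator_def)
          then show ?case using elim Z(1) by simp
        qed
      qed (use int(1)[OF p] single in auto)
      also have "\<dots> = (\<Sum>A\<in>Z. \<integral>B. eval2 p A * indicator {A} B \<partial>\<mu>)"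
        using single by (intro Bochner_Integration.integral_sum) (simp add: integrable_real_indicator less_top[symmetric])
      also have "\<dots> = (\<Sum>A\<in>Z. measure \<mu> {A} * eval2 p A)"
        using single sets_eq_imp_space_eq[OF sets] by (intro sum.cong) auto
      finally show ?thesis .
    qed
    \<comment> \<open>Zeros of mass 0 are dropped, since the weights are to be positive.\<close>
    moreover have "(\<Sum>A\<in>Z. measure \<mu> {A} * g A) = (\<Sum>A\<in>{A \<in> Z. measure \<mu> {A} > 0}. measure \<mu> {A} * g A)" for g
      using Z(1) by (intro sum.mono_neutral_right) (auto simp: zero_less_measure_iff)
    moreover have "card {A \<in> Z. measure \<mu> {A} > 0} \<le> 3 * d + 1"
      using Z card_mono[OF Z(1), of "{A \<in> Z. measure \<mu> {A} > 0}"] by auto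
    moreover have "finite {A \<in> Z. measure \<mu> {A} > 0}" "{A \<in> Z. measure \<mu> {A} > 0} \<subseteq> real_points f"
      using Z(1) unfolding Z_def by (auto elim: rev_finite_subset)
    ultimately show ?thesis
      by (intro exI[of _ "{A \<in> Z. measure \<mu> {A} > 0}"] exI[of _ "\<lambda>A. measure \<mu> {A}"])
        (simp add: \<phi>_def)
  next
    case False
    have pos: "\<phi> F > 0" if F: "F \<in> polys_le ?n" "\<And>v. v \<in> C \<Longrightarrow> hev ?n F v \<ge> 0" "\<not> f dvd F" for F
    proof -
      have "\<phi> F \<ge> 0" unfolding int(2)[OF F(1)] by (rule integral_nonneg_AE[OF AE_nonneg[OF F(1,2)]])
      moreover have "\<phi> F \<noteq> 0" using False F by blast
      ultimately show ?thesis by simp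
    qed
    show ?thesis
      using few_atoms_of_positive[OF lin\<phi> d infinite_points van pos] unfolding \<phi>_def .
  qed
qed

lemma atomic_moment_functional:
  assumes "finite S" "S \<subseteq> real_points f" "\<And>A. A \<in> S \<Longrightarrow> x A \<ge> 0"
    and "\<And>p. p \<in> polys_le k \<Longrightarrow> L (residue_class f k p) = (\<Sum>A\<in>S. x A * eval2 p A)"
  shows "moment_functional f k L"
proof -
  define \<nu> where "\<nu> = point_measure S (\<lambda>A. ennreal (x A))"
  \<comment> \<open>The push-forward replaces the power set of \<open>S\<close> by the Borel
    sets.\<close>
  define \<mu> :: "(real \<times> real) measure" where "\<mu> = distr \<nu> borel id"
  have id: "id \<in> measurable \<nu> borel" by (simp add: \<nu>_def)
  have "emeasure \<mu> (- real_points f) = emeasure \<nu> (- real_points f \<inter> S)"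
    unfolding \<mu>_def using closed_real_points
    by (subst emeasure_distr[OF id]) (auto simp: \<nu>_def space_point_measure)
  also have "- real_points f \<inter> S = {}" using assms(2) by blast
  finally have "emeasure \<mu> (- real_points f) = 0" by simp
  moreover have "integrable \<mu> (eval2 p)" for p
    unfolding \<mu>_def using assms(1)
    by (subst integrable_distr_eq[OF id]) (auto simp: \<nu>_def intro!: integrable_point_measure_finite)
  moreover have "(\<integral>A. eval2 p A \<partial>\<mu>) = (\<Sum>A\<in>S. x A * eval2 p A)" for p
    unfolding \<mu>_def using assms(1,3)
    by (subst integral_distr[OF id]) (auto simp: \<nu>_def lebesgue_integral_point_measure_finite)
  moreover have "sets \<mu> = sets borel" by (simp add: \<mu>_def)
  ultimately show ?thesis
    unfolding moment_functional_def using assms(4) by (intro exI[of _ \<mu>]) auto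
qed

end

section \<open>Ranks of moment forms\<close>

lemma sum_functions_apply: "(\<Sum>i\<in>I. g i) v = (\<Sum>i\<in>I. g i v)" for g :: "'i \<Rightarrow> 'v \<Rightarrow> real"
  by (induction I rule: infinite_finite_induct) auto

context real_cubic
begin

lemma moment_form_residue_class:
  assumes "p \<in> polys_le k" "q \<in> polys_le k"
  shows "moment_form f k L (residue_class f k p) (residue_class f k q) = L (residue_class f (2 * k) (p * q))"
  using assms by (simp add: moment_form_def R_le_def class_mult_residue_class)

lemma product_in_polys_le: "p \<in> polys_le k \<Longrightarrow> q \<in> polys_le k \<Longrightarrow> p * q \<in> polys_le (2 * k)"
  for p q :: "real poly poly"
  using polys_le_mult[of p k q k] by (simp add: mult_2)

lemma moment_form_sum:
  assumes L: "linear_functional f (2 * k) L" and g: "\<And>i. i \<in> I \<Longrightarrow> g i \<in> polys_le k" and "q \<in> polys_le k"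
  shows "(\<Sum>i\<in>I. c i * moment_form f k L (residue_class f k (g i)) (residue_class f k q))
    = L (residue_class f (2 * k) ((\<Sum>i\<in>I. smult [:c i:] (g i)) * q))"
proof -
  have "(\<Sum>i\<in>I. smult [:c i:] (g i)) * q = (\<Sum>i\<in>I. smult [:c i:] (g i * q))"
    by (simp add: sum_distrib_right)
  moreover have "L (residue_class f (2 * k) (\<Sum>i\<in>I. smult [:c i:] (g i * q)))
      = (\<Sum>i\<in>I. c i * L (residue_class f (2 * k) (g i * q)))"
    using linear_on_sum[OF linear_functional_linear_on[OF L], of I "\<lambda>i. g i * q"]
      g product_in_polys_le assms(3) by blast
  ultimately show ?thesis using g assms(3) by (simp add: moment_form_residue_class)
qed

lemma moment_form_combination:
  assumes L: "linear_functional f (2 * k) L" and g: "\<And>i. i \<in> I \<Longrightarrow> g i \<in> polys_le k"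
    and 0: "\<And>q. q \<in> polys_le k \<Longrightarrow> L (residue_class f (2 * k) ((\<Sum>i\<in>I. smult [:c i:] (g i)) * q)) = 0"
  shows "(\<Sum>i\<in>I. (\<lambda>v. c i * moment_form f k L (residue_class f k (g i)) v)) = 0"
proof
  fix v
  show "(\<Sum>i\<in>I. (\<lambda>v. c i * moment_form f k L (residue_class f k (g i)) v)) v = 0 v"
  proof (cases "v \<in> R_le f k")
    case True
    then obtain q where q: "q \<in> polys_le k" "v = residue_class f k q" by (auto simp: R_le_def)
    show ?thesis
      using moment_form_sum[OF L g q(1), where c = c] 0[OF q(1)] by (simp add: sum_functions_apply q(2))
  next
    case False
    then show ?thesis by (simp add: sum_functions_apply moment_form_def)
  qed
qed

lemma moment_form_span:
  assumes L: "linear_functional f (2 * k) L"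
  shows "moment_form f k L ` R_le f k \<subseteq> module.span (\<lambda>(c::real) \<phi> v. c * \<phi> v)
    ((\<lambda>s. moment_form f k L (residue_class f k (mon s))) ` mons k)"
proof -
  interpret fs: vector_space "\<lambda>(c::real) (\<phi> :: real poly poly set \<Rightarrow> real) v. c * \<phi> v"
    by (rule vector_space_functionals)
  show ?thesis
  proof
    fix t assume "t \<in> moment_form f k L ` R_le f k"
    then obtain p where p: "p \<in> polys_le k" and t: "t = moment_form f k L (residue_class f k p)"
      by (auto simp: R_le_def)
    have "t = (\<Sum>s\<in>mons k. (\<lambda>v. cf p s * moment_form f k L (residue_class f k (mon s)) v))"
    proof
      fix v
      show "t v = (\<Sum>s\<in>mons k. (\<lambda>v. cf p s * moment_form f k L (residue_class f k (mon s)) v)) v"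
      proof (cases "v \<in> R_le f k")
        case True
        then obtain q where q: "q \<in> polys_le k" "v = residue_class f k q" by (auto simp: R_le_def)
        show ?thesis
          using moment_form_sum[OF L mon_in_polys_le q(1), where c = "cf p"] comb_cf[OF p]
          by (simp add: sum_functions_apply q t moment_form_residue_class p comb_def)
      next
        case False
        then show ?thesis by (simp add: sum_functions_apply moment_form_def t)
      qed
    qed
    also have "\<dots> \<in> fs.span ((\<lambda>s. moment_form f k L (residue_class f k (mon s))) ` mons k)"
      by (intro fs.span_sum fs.span_scale fs.span_base) auto
    finally show "t \<in> fs.span ((\<lambda>s. moment_form f k L (residue_class f k (mon s))) ` mons k)" .
  qed
qed

text \<open>The monomials span, so the image is finite-dimensional and its dimension is the
  cardinality of a finite basis.\<close>

lemma form_rank_basis: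
  assumes L: "linear_functional f (2 * k) L"
  shows "\<exists>T. finite T \<and> card T = form_rank (R_le f k) (moment_form f k L) \<and>
    T \<subseteq> moment_form f k L ` R_le f k \<and>
    moment_form f k L ` R_le f k \<subseteq> module.span (\<lambda>(c::real) \<phi> v. c * \<phi> v) T \<and>
    \<not> module.dependent (\<lambda>(c::real) \<phi> v. c * \<phi> v) T"
proof -
  interpret fs: vector_space "\<lambda>(c::real) (\<phi> :: real poly poly set \<Rightarrow> real) v. c * \<phi> v"
    by (rule vector_space_functionals)
  obtain T where T: "T \<subseteq> moment_form f k L ` R_le f k" "fs.independent T"
    "moment_form f k L ` R_le f k \<subseteq> fs.span T" "card T = fs.dim (moment_form f k L ` R_le f k)"
    using fs.basis_exists by blast
  have "T \<subseteq> fs.span ((\<lambda>s. moment_form f k L (residue_class f k (mon s))) ` mons k)"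
    by (rule subset_trans[OF T(1) moment_form_span[OF L]])
  from fs.independent_span_bound[OF finite_imageI[OF finite_mons] T(2) this] have "finite T" by (rule conjunct1)
  with T show ?thesis unfolding form_rank_def by (intro exI[of _ T] conjI)
qed

text \<open>Together with \<open>card_le_form_rank\<close> this restates the rank in terms of
  polynomials that are independent modulo the radical of the form.\<close>

lemma form_rank_realized:
  assumes L: "linear_functional f (2 * k) L"
  shows "\<exists>(T :: (real poly poly set \<Rightarrow> real) set) b. finite T \<and> card T = form_rank (R_le f k) (moment_form f k L) \<and>
    (\<forall>t\<in>T. b t \<in> polys_le k) \<and>
    (\<forall>c. (\<forall>q\<in>polys_le k. L (residue_class f (2 * k) ((\<Sum>t\<in>T. smult [:c t:] (b t)) * q)) = 0) \<longrightarrow> (\<forall>t\<in>T. c t = 0))"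
proof -
  interpret fs: vector_space "\<lambda>(c::real) (\<phi> :: real poly poly set \<Rightarrow> real) v. c * \<phi> v"
    by (rule vector_space_functionals)
  obtain T where T: "finite T" "card T = form_rank (R_le f k) (moment_form f k L)"
    "T \<subseteq> moment_form f k L ` R_le f k" "fs.independent T"
    using form_rank_basis[OF L] by blast
  have "\<forall>t\<in>T. \<exists>p. p \<in> polys_le k \<and> t = moment_form f k L (residue_class f k p)"
    using T(3) by (auto simp: R_le_def)
  then obtain b where b: "\<And>t. t \<in> T \<Longrightarrow> b t \<in> polys_le k"
    "\<And>t. t \<in> T \<Longrightarrow> t = moment_form f k L (residue_class f k (b t))" by metis
  have "\<forall>t\<in>T. c t = 0"
    if c: "\<And>q. q \<in> polys_le k \<Longrightarrow> L (residue_class f (2 * k) ((\<Sum>t\<in>T. smult [:c t:] (b t)) * q)) = 0" for c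
  proof -
    have "(\<Sum>t\<in>T. (\<lambda>v. c t * moment_form f k L (residue_class f k (b t)) v)) = 0"
      by (rule moment_form_combination[OF L b(1) c])
    moreover have "(\<Sum>t\<in>T. (\<lambda>v. c t * moment_form f k L (residue_class f k (b t)) v)) = (\<Sum>t\<in>T. (\<lambda>v. c t * t v))"
      by (intro sum.cong) (simp_all add: b(2)[symmetric])
    ultimately have "(\<Sum>t\<in>T. (\<lambda>v. c t * t v)) = 0" by simp
    then show ?thesis using fs.independentD[OF T(4) T(1) subset_refl] by blast
  qed
  with T(1,2) b(1) show ?thesis by blast
qed

lemma card_le_form_rank:
  fixes p :: "'i \<Rightarrow> real poly poly"
  assumes L: "linear_functional f (2 * k) L" and I: "finite I" and p: "\<And>i. i \<in> I \<Longrightarrow> p i \<in> polys_le k"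
    and indep: "\<And>c. (\<And>q. q \<in> polys_le k \<Longrightarrow> L (residue_class f (2 * k) ((\<Sum>i\<in>I. smult [:c i:] (p i)) * q)) = 0)
      \<Longrightarrow> \<forall>i\<in>I. c i = 0"
  shows "card I \<le> form_rank (R_le f k) (moment_form f k L)"
proof (rule ccontr)
  assume big: "\<not> ?thesis"
  interpret fs: vector_space "\<lambda>(c::real) (\<phi> :: real poly poly set \<Rightarrow> real) v. c * \<phi> v"
    by (rule vector_space_functionals)
  obtain T where T: "finite T" "card T = form_rank (R_le f k) (moment_form f k L)"
    "moment_form f k L ` R_le f k \<subseteq> fs.span T"
    using form_rank_basis[OF L] by blast
  have "\<exists>a. moment_form f k L (residue_class f k (p i)) = (\<Sum>t\<in>T. (\<lambda>v. a t * t v))" if "i \<in> I" for i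
  proof -
    have "moment_form f k L (residue_class f k (p i)) \<in> fs.span T"
      using T(3) p[OF that] by (auto simp: R_le_def)
    then have "moment_form f k L (residue_class f k (p i)) \<in> range (\<lambda>a. \<Sum>t\<in>T. (\<lambda>v. a t * t v))"
      unfolding fs.span_finite[OF T(1)] .
    then show ?thesis by (elim rangeE) (rule exI)
  qed
  then have "\<forall>i\<in>I. \<exists>a. moment_form f k L (residue_class f k (p i)) = (\<Sum>t\<in>T. (\<lambda>v. a t * t v))" by blast
  from bchoice[OF this] obtain a where
    a: "\<And>i. i \<in> I \<Longrightarrow> moment_form f k L (residue_class f k (p i)) = (\<Sum>t\<in>T. (\<lambda>v. a i t * t v))" by blast
  obtain c where c: "\<exists>i\<in>I. c i \<noteq> 0" "\<forall>t\<in>T. (\<Sum>i\<in>I. c i * a i t) = 0"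
    using homogeneous_system_nontrivial_solution[OF T(1) I, of a] big T(2) by auto
  have "L (residue_class f (2 * k) ((\<Sum>i\<in>I. smult [:c i:] (p i)) * q)) = 0" if q: "q \<in> polys_le k" for q
  proof -
    let ?v = "residue_class f k q"
    have "L (residue_class f (2 * k) ((\<Sum>i\<in>I. smult [:c i:] (p i)) * q))
        = (\<Sum>i\<in>I. c i * moment_form f k L (residue_class f k (p i)) ?v)"
      by (rule moment_form_sum[OF L p q, symmetric])
    also have "\<dots> = (\<Sum>i\<in>I. \<Sum>t\<in>T. (c i * a i t) * t ?v)"
      by (intro sum.cong refl) (simp add: a sum_functions_apply sum_distrib_left mult.assoc)
    also have "\<dots> = (\<Sum>t\<in>T. \<Sum>i\<in>I. (c i * a i t) * t ?v)" by (rule sum.swap)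
    also have "\<dots> = 0" using c(2) by (simp add: sum_distrib_right[symmetric])
    finally show ?thesis .
  qed
  then have "\<forall>i\<in>I. c i = 0" by (rule indep)
  with c(1) show False by blast
qed

text \<open>The form factors through the evaluations at the atoms.\<close>

lemma form_rank_le_card_atoms:
  assumes S: "finite S" "S \<subseteq> real_points f"
    and rep: "\<And>p q. p \<in> polys_le k \<Longrightarrow> q \<in> polys_le k \<Longrightarrow>
      L (residue_class f (2 * k) (p * q)) = (\<Sum>A\<in>S. x A * (eval2 p A * eval2 q A))"
  shows "form_rank (R_le f k) (moment_form f k L) \<le> card S"
proof -
  interpret fs: vector_space "\<lambda>(c::real) (\<phi> :: real poly poly set \<Rightarrow> real) v. c * \<phi> v"
    by (rule vector_space_functionals)
  \<comment> \<open>Evaluation of a residue class at a point of the curve does not depend on the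
    chosen representative.\<close>
  define e where "e A v = (if v \<in> R_le f k then eval2 (SOME q. q \<in> v) A else 0)" for A v
  have e: "e A (residue_class f k q) = eval2 q A" if "q \<in> polys_le k" "A \<in> S" for q A
  proof -
    have "(SOME r. r \<in> residue_class f k q) \<in> residue_class f k q"
      using self_mem_residue_class by (rule someI)
    then have "eval2 (SOME r. r \<in> residue_class f k q) A = eval2 q A"
      by (rule mem_residue_class_eval2) (use that S(2) in blast)
    then show ?thesis using that(1) by (simp add: e_def R_le_def)
  qed
  have "moment_form f k L ` R_le f k \<subseteq> fs.span (e ` S)"
  proof
    fix t assume "t \<in> moment_form f k L ` R_le f k"
    then obtain p where p: "p \<in> polys_le k" and t: "t = moment_form f k L (residue_class f k p)"
      by (auto simp: R_le_def)
    have "t = (\<Sum>A\<in>S. (\<lambda>v. (x A * eval2 p A) * e A v))"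
    proof
      fix v
      show "t v = (\<Sum>A\<in>S. (\<lambda>v. (x A * eval2 p A) * e A v)) v"
      proof (cases "v \<in> R_le f k")
        case True
        then obtain q where q: "q \<in> polys_le k" "v = residue_class f k q" by (auto simp: R_le_def)
        have "t v = L (residue_class f (2 * k) (p * q))"
          unfolding t q(2) by (rule moment_form_residue_class[OF p q(1)])
        also have "\<dots> = (\<Sum>A\<in>S. x A * (eval2 p A * eval2 q A))" by (rule rep[OF p q(1)])
        also have "\<dots> = (\<Sum>A\<in>S. (x A * eval2 p A) * e A v)"
          by (intro sum.cong refl) (simp add: e[OF q(1)] q(2))
        finally show ?thesis by (simp only: sum_functions_apply)
      next
        case False
        then show ?thesis by (simp add: sum_functions_apply moment_form_def t e_def)
      qed
    qed
    also have "\<dots> \<in> fs.span (e ` S)"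
      by (intro fs.span_sum fs.span_scale fs.span_base) auto
    finally show "t \<in> fs.span (e ` S)" .
  qed
  then have "form_rank (R_le f k) (moment_form f k L) \<le> card (e ` S)"
    unfolding form_rank_def by (rule fs.dim_le_card) (rule finite_imageI[OF S(1)])
  also have "\<dots> \<le> card S" by (rule card_image_le[OF S(1)])
  finally show ?thesis .
qed

section \<open>Moment functionals have almost flat extensions\<close>

text \<open>Two independent relations contradict \<open>bezout\<close>: a form through all but two
  of the points would be forced through these two as well. Auxiliary points \<open>E\<close> of the
  curve bring the total to \<open>3 * d + 1\<close>, so that the case of fewer points needs no
  separate argument.\<close>

lemma evaluations_almost_independent:
  assumes d: "d \<ge> 1" and S: "finite S" "S \<subseteq> real_points f" "card S \<le> 3 * d + 1"
  shows "\<exists>S0\<subseteq>S. card S \<le> card S0 + 1 \<and>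
    (\<forall>c. (\<forall>p\<in>polys_le d. (\<Sum>A\<in>S0. c A * eval2 p A) = 0) \<longrightarrow> (\<forall>A\<in>S0. c A = 0))"
proof (cases "\<forall>c. (\<forall>p\<in>polys_le d. (\<Sum>A\<in>S. c A * eval2 p A) = 0) \<longrightarrow> (\<forall>A\<in>S. c A = 0)")
  case True
  then show ?thesis by (intro exI[of _ S]) auto
next
  case False
  then obtain c A0 where c: "\<forall>p\<in>polys_le d. (\<Sum>A\<in>S. c A * eval2 p A) = 0" "A0 \<in> S" "c A0 \<noteq> 0" by blast
  have "\<forall>A\<in>S - {A0}. c' A = 0" if c': "\<forall>p\<in>polys_le d. (\<Sum>A\<in>S - {A0}. c' A * eval2 p A) = 0" for c'
  proof (rule ccontr)
    assume "\<not> ?thesis"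
    then obtain A1 where A1: "A1 \<in> S - {A0}" "c' A1 \<noteq> 0" by blast
    have "infinite (real_points f - S)" using infinite_points S(1) by (rule Diff_infinite_finite[rotated])
    then obtain E where E: "finite E" "card E = 3 * d + 1 - card S" "E \<subseteq> real_points f - S"
      using infinite_arbitrarily_large by blast
    \<comment> \<open>Together with \<open>E\<close> these are \<open>3 * d - 1\<close> points, few
      enough for a form of degree \<open>d\<close>.\<close>
    let ?K = "S - {A0} - {A1}"
    have disj: "S \<inter> E = {}" "?K \<inter> E = {}" using E(3) by auto
    have cardS: "card S = card ?K + 2"
      using S(1) c(2) A1(1) card_Suc_Diff1[of S A0] card_Suc_Diff1[of "S - {A0}" A1] by simp
    have "card (?K \<union> E) = card ?K + card E" using S(1) E(1) disj(2) by (intro card_Un_disjoint) auto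
    then have "card (?K \<union> E) < 3 * d" using cardS E(2) S(3) by linarith
    moreover have "finite (?K \<union> E)" using S(1) E(1) by simp
    ultimately obtain q where q: "q \<in> polys_le d" "\<not> f dvd q" "\<forall>A\<in>?K \<union> E. hev d q (aff A) = 0"
      using ex_form_through[of "?K \<union> E" d aff] d by blast
    have qK: "eval2 q A = 0" if "A \<in> ?K \<union> E" for A using q(3) that hev_aff[OF q(1)] by metis
    have "(\<Sum>A\<in>S - {A0}. c' A * eval2 q A) = c' A1 * eval2 q A1"
      using qK S(1) A1(1) by (subst sum.remove[of _ A1]) auto
    then have q1: "eval2 q A1 = 0" using c' q(1) A1(2) by auto
    have "eval2 q A = 0" if "A \<in> S - {A0}" for A using that q1 qK by (cases "A = A1") auto
    then have "(\<Sum>A\<in>S. c A * eval2 q A) = c A0 * eval2 q A0"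
      using S(1) c(2) by (simp add: sum.remove[of S A0])
    then have "eval2 q A0 = 0" using c q(1) by auto
    with q1 qK have zero: "eval2 q A = 0" if "A \<in> S \<union> E" for A using that by blast
    have "card (S \<union> E) + card ({} :: (real \<times> real) set) \<le> 3 * d"
    proof (rule bezout[OF q(1,2), where v = aff])
      show "aff ` (S \<union> E) \<subseteq> C" using S(2) E(3) by (auto simp: aff_in_C)
    qed (use S(1) E(1) zero noncollinear_aff hev_aff[OF q(1)] in auto)
    moreover have "card (S \<union> E) = 3 * d + 1"
      using S(1,3) E(1,2) disj(1) by (subst card_Un_disjoint) auto
    ultimately show False by simp
  qed
  moreover have "card S \<le> card (S - {A0}) + 1" using card_Suc_Diff1[OF S(1) c(2)] by simp
  ultimately show ?thesis by (intro exI[of _ "S - {A0}"]) auto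
qed

lemma ex_dual_polys:
  fixes S0 :: "(real \<times> real) set"
  assumes "finite S0" and indep: "\<And>c. \<forall>p\<in>polys_le d. (\<Sum>A\<in>S0. c A * eval2 p A) = 0 \<Longrightarrow> \<forall>A\<in>S0. c A = 0"
  shows "\<exists>p. (\<forall>A. p A \<in> polys_le d) \<and> (\<forall>A\<in>S0. \<forall>B\<in>S0. eval2 (p A) B = (if A = B then 1 else 0))"
proof -
  have comb: "eval2 (comb (mons d) c) A = (\<Sum>s\<in>mons d. c s * eval2 (mon s) A)" for c A
    by (simp add: comb_def eval2_sum)
  have "\<forall>A\<in>S0. c A = 0" if c: "\<And>s. s \<in> mons d \<Longrightarrow> (\<Sum>A\<in>S0. c A * eval2 (mon s) A) = 0" for c
  proof (rule indep, rule ballI)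
    fix p :: "real poly poly"
    assume "p \<in> polys_le d"
    then have "(\<Sum>A\<in>S0. c A * eval2 p A) = (\<Sum>A\<in>S0. \<Sum>s\<in>mons d. cf p s * (c A * eval2 (mon s) A))"
      using comb[of "cf p"] by (simp add: comb_cf sum_distrib_left mult_ac)
    also have "\<dots> = (\<Sum>s\<in>mons d. cf p s * (\<Sum>A\<in>S0. c A * eval2 (mon s) A))"
      unfolding sum_distrib_left by (rule sum.swap)
    finally show "(\<Sum>A\<in>S0. c A * eval2 p A) = 0" using c by simp
  qed
  then obtain e where e: "\<forall>A\<in>S0. \<forall>B\<in>S0. (\<Sum>s\<in>mons d. eval2 (mon s) A * e B s) = (if A = B then 1 else 0)"
    using dual_vectors_of_independent_rows[OF assms(1) finite_mons, where a = "\<lambda>A s. eval2 (mon s) A"] by blast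
  show ?thesis
  proof (intro exI[of _ "\<lambda>A. comb (mons d) (e A)"] conjI allI ballI)
    show "comb (mons d) (e A) \<in> polys_le d" for A by (rule comb_in_polys_le) simp
    fix A B assume "A \<in> S0" "B \<in> S0"
    then have "(\<Sum>s\<in>mons d. eval2 (mon s) B * e A s) = (if B = A then 1 else 0)" using e by blast
    then show "eval2 (comb (mons d) (e A)) B = (if A = B then 1 else 0)"
      by (simp add: comb mult.commute eq_commute)
  qed
qed

text \<open>The same atoms define the extension. Its rank is at most their number, and the rank of
  the given form is at least the number of the independent evaluations, which is smaller by at most
  one.\<close>

lemma atomic_almost_flat_extension:
  assumes d: "d \<ge> 1" and L: "linear_functional f (2 * d) L"
    and S: "finite S" "S \<subseteq> real_points f" "card S \<le> 3 * d + 1" and x: "\<And>A. A \<in> S \<Longrightarrow> x A > 0"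
    and rep: "\<And>p. p \<in> polys_le (2 * d) \<Longrightarrow> L (residue_class f (2 * d) p) = (\<Sum>A\<in>S. x A * eval2 p A)"
  shows "\<exists>L'. almost_flat_extension f d L L'"
proof -
  define L' where "L' u = (\<Sum>A\<in>S. x A * eval2 (SOME p. p \<in> u) A)" for u
  have L': "L' (residue_class f k p) = (\<Sum>A\<in>S. x A * eval2 p A)" for k p
  proof -
    have "(SOME r. r \<in> residue_class f k p) \<in> residue_class f k p"
      using self_mem_residue_class by (rule someI)
    then have "eval2 (SOME r. r \<in> residue_class f k p) A = eval2 p A" if "A \<in> S" for A
      using that S(2) mem_residue_class_eval2 by blast
    then show ?thesis by (simp add: L'_def)
  qed
  have "linear_functional f (2 * d + 4) L'"
    by (simp add: linear_functional_def L' eval2_add eval2_smult algebra_simps sum.distrib sum_distrib_left)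
  moreover have "\<forall>p\<in>polys_le (2 * d). L' (residue_class f (2 * d + 4) p) = L (residue_class f (2 * d) p)"
    by (simp add: L' rep)
  moreover have "form_rank (R_le f (d + 2)) (moment_form f (d + 2) L') \<le> form_rank (R_le f d) (moment_form f d L) + 1"
  proof -
    obtain S0 where S0: "S0 \<subseteq> S" "card S \<le> card S0 + 1"
      "\<And>c. \<forall>p\<in>polys_le d. (\<Sum>A\<in>S0. c A * eval2 p A) = 0 \<Longrightarrow> \<forall>A\<in>S0. c A = 0"
      using evaluations_almost_independent[OF d S] by blast
    have fin0: "finite S0" using S0(1) S(1) finite_subset by blast
    obtain p where p: "\<And>A. p A \<in> polys_le d"
      "\<And>A B. A \<in> S0 \<Longrightarrow> B \<in> S0 \<Longrightarrow> eval2 (p A) B = (if A = B then 1 else 0)"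
      using ex_dual_polys[OF fin0 S0(3)] by blast
    have "\<forall>A\<in>S0. c A = 0"
      if c: "\<And>q. q \<in> polys_le d \<Longrightarrow> L (residue_class f (2 * d) ((\<Sum>A\<in>S0. smult [:c A:] (p A)) * q)) = 0" for c
    proof
      fix B assume B: "B \<in> S0"
      let ?g = "\<Sum>A\<in>S0. smult [:c A:] (p A)"
      have g: "?g \<in> polys_le d" by (intro polys_le_sum polys_le_smult p)
      \<comment> \<open>Testing the combination against itself gives a sum of squares with positive
        weights.\<close>
      have "(\<Sum>A\<in>S. x A * (eval2 ?g A * eval2 ?g A)) = 0"
        using c[OF g] rep[OF product_in_polys_le[OF g g]] by (simp add: eval2_mult)
      then have "x B * (eval2 ?g B * eval2 ?g B) = 0"
        using B S0(1) S(1) x by (subst (asm) sum_nonneg_eq_0_iff) (auto simp: less_imp_le)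
      then have "eval2 ?g B = 0" using x[of B] B S0(1) by auto
      moreover have "eval2 ?g B = (\<Sum>A\<in>S0. if A = B then c A else 0)"
        unfolding eval2_sum by (intro sum.cong) (auto simp: p(2) B)
      ultimately show "c B = 0" using B fin0 by simp
    qed
    then have "card S0 \<le> form_rank (R_le f d) (moment_form f d L)"
      by (rule card_le_form_rank[OF L fin0 p(1)])
    moreover have "form_rank (R_le f (d + 2)) (moment_form f (d + 2) L') \<le> card S"
      by (rule form_rank_le_card_atoms[OF S(1,2)]) (simp add: L' eval2_mult)
    ultimately show ?thesis using S0(2) by linarith
  qed
  moreover have "psd_form (R_le f (d + 2)) (moment_form f (d + 2) L')"
    unfolding psd_form_def
  proof
    fix u assume "u \<in> R_le f (d + 2)"
    then obtain p where p: "p \<in> polys_le (d + 2)" "u = residue_class f (d + 2) p" by (auto simp: R_le_def)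
    have "moment_form f (d + 2) L' u u = (\<Sum>A\<in>S. x A * (eval2 p A * eval2 p A))"
      using moment_form_residue_class[OF p(1) p(1)] by (simp add: p(2) L' eval2_mult)
    also have "\<dots> \<ge> 0" by (rule sum_nonneg) (rule mult_nonneg_nonneg[OF less_imp_le[OF x] zero_le_square])
    finally show "moment_form f (d + 2) L' u u \<ge> 0" .
  qed
  ultimately show ?thesis unfolding almost_flat_extension_def by blast
qed

end

section \<open>Flat functionals are atomic\<close>

text \<open>Constants as ring elements: a product with \<open>scal c\<close> takes part in ring
  normalization, unlike \<open>smult\<close>.\<close>

definition scal :: "real \<Rightarrow> real poly poly" where
  "scal c = [:[:c:]:]"

lemma scal_mult: "scal c * p = smult [:c:] p"
  by (simp add: scal_def)

lemma scal_1: "scal 1 = 1"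
  unfolding scal_def by (simp only: one_pCons)

lemma scal_inverse: "c \<noteq> 0 \<Longrightarrow> scal (1 / c) * (scal c * p) = p"
proof -
  assume "c \<noteq> 0"
  then have "scal (1 / c) * scal c = scal 1" by (simp add: scal_def)
  then show ?thesis by (simp add: scal_1 mult.assoc[symmetric])
qed

text \<open>
  In this locale \<open>\<Lambda>\<close> is a positive functional on all polynomials, and the set of polynomials of
  \<open>\<Lambda>\<close>-norm zero turns out to be a real radical ideal of finite codimension, hence the ideal of
  finitely many points.
\<close>

locale positive_functional =
  fixes \<Lambda> :: "real poly poly \<Rightarrow> real" and k :: nat
  assumes \<Lambda>_add: "\<Lambda> (p + q) = \<Lambda> p + \<Lambda> q"
    and \<Lambda>_smult: "\<Lambda> (smult [:c:] p) = c * \<Lambda> p"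
    and \<Lambda>_square: "\<Lambda> (p * p) \<ge> 0"
    and \<Lambda>_finite: "\<exists>h\<in>polys_le k. \<Lambda> ((p - h) * (p - h)) = 0"
begin

section \<open>The null ideal of a positive functional\<close>

definition J :: "real poly poly set" where
  "J = {p. \<Lambda> (p * p) = 0}"

lemma \<Lambda>_0 [simp]: "\<Lambda> 0 = 0"
  using \<Lambda>_smult[of 0 0] by simp

lemma \<Lambda>_minus: "\<Lambda> (- p) = - \<Lambda> p"
  using \<Lambda>_add[of p "- p"] by simp

lemma \<Lambda>_diff: "\<Lambda> (p - q) = \<Lambda> p - \<Lambda> q"
  using \<Lambda>_add[of p "- q"] by (simp add: \<Lambda>_minus)

lemma \<Lambda>_sum: "\<Lambda> (\<Sum>i\<in>I. g i) = (\<Sum>i\<in>I. \<Lambda> (g i))"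
  by (induction I rule: infinite_finite_induct) (auto simp: \<Lambda>_add)

lemma cauchy_schwarz_0:
  assumes "p \<in> J"
  shows "\<Lambda> (p * q) = 0"
proof -
  have "\<Lambda> (p * r) \<ge> 0" for r
  proof (rule quadratic_nonneg_near_0)
    fix e :: real
    have "(p + smult [:e:] r) * (p + smult [:e:] r) = p * p + (smult [:2 * e:] (p * r) + smult [:e * e:] (r * r))"
    proof -
      have "scal (2 * e) = scal e + scal e" "scal (e * e) = scal e * scal e" by (simp_all add: scal_def)
      then show ?thesis unfolding scal_mult[symmetric] by (simp add: algebra_simps)
    qed
    then have "\<Lambda> ((p + smult [:e:] r) * (p + smult [:e:] r)) = 2 * e * \<Lambda> (p * r) + e * e * \<Lambda> (r * r)"
      using assms by (simp only: \<Lambda>_add \<Lambda>_smult) (simp add: J_def)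
    then show "0 \<le> 2 * \<Lambda> (p * r) * e + \<Lambda> (r * r) * e\<^sup>2"
      using \<Lambda>_square[of "p + smult [:e:] r"] by (simp add: power2_eq_square mult_ac)
  qed
  from this[of q] this[of "- q"] show ?thesis by (simp add: \<Lambda>_minus)
qed

lemma J_mult: "p \<in> J \<Longrightarrow> q * p \<in> J"
  using cauchy_schwarz_0[of p "q * (q * p)"] by (simp add: J_def mult_ac)

lemma J_add: "p \<in> J \<Longrightarrow> q \<in> J \<Longrightarrow> p + q \<in> J"
  using cauchy_schwarz_0[of p "p + q"] cauchy_schwarz_0[of q "p + q"]
  by (simp add: J_def distrib_right \<Lambda>_add)

lemma J_0: "0 \<in> J"
  by (simp add: J_def)

lemma J_sum: "(\<And>i. i \<in> I \<Longrightarrow> g i \<in> J) \<Longrightarrow> (\<Sum>i\<in>I. g i) \<in> J"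
  by (induction I rule: infinite_finite_induct) (auto intro: J_add J_0)

lemma \<Lambda>_J: "p \<in> J \<Longrightarrow> \<Lambda> p = 0"
  using cauchy_schwarz_0[of p 1] by simp

lemma J_sum_of_squares:
  assumes "p * p + q * q \<in> J"
  shows "q \<in> J"
proof -
  have "\<Lambda> (p * p) + \<Lambda> (q * q) = 0" using \<Lambda>_J[OF assms] by (simp add: \<Lambda>_add)
  then show ?thesis using \<Lambda>_square[of p] \<Lambda>_square[of q] by (simp add: J_def)
qed

lemma J_square: "q * q \<in> J \<Longrightarrow> q \<in> J"
  using J_sum_of_squares[of 0 q] by simp

text \<open>\<open>H\<close> stands for the substitution of either coordinate. Modulo
  \<open>J\<close> its powers reduce to degree at most \<open>k\<close>, so sufficiently many of
  them are dependent.\<close>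

lemma ex_annihilating_poly:
  assumes H_add: "\<And>u v. H (u + v) = H u + H v" and H_smult: "\<And>c u. H (smult c u) = smult [:c:] (H u)"
  shows "\<exists>u :: real poly. u \<noteq> 0 \<and> H u \<in> J"
proof -
  have H_sum: "H (\<Sum>i\<in>I. smult (c i) (g i)) = (\<Sum>i\<in>I. smult [:c i:] (H (g i)))" for I :: "nat set" and c g
  proof -
    have "H 0 = 0" using H_smult[of 0 0] by simp
    then show ?thesis by (induction I rule: infinite_finite_induct) (auto simp: H_add H_smult)
  qed
  have "\<forall>i. \<exists>h. h \<in> polys_le k \<and> H (monom 1 i) - h \<in> J" using \<Lambda>_finite by (auto simp: J_def)
  then obtain h where h: "\<And>i. h i \<in> polys_le k" "\<And>i. H (monom 1 i) - h i \<in> J" by metis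
  define I where "I = {..card (mons k)}"
  obtain c where c: "\<exists>i\<in>I. c i \<noteq> 0" "(\<Sum>i\<in>I. smult [:c i:] (h i)) = 0"
    using polys_dependent[of I k h] h(1) by (auto simp: I_def)
  define u where "u = (\<Sum>i\<in>I. smult (c i) (monom 1 i))"
  have "H u = (\<Sum>i\<in>I. smult [:c i:] (H (monom 1 i))) - (\<Sum>i\<in>I. smult [:c i:] (h i))"
    by (simp add: u_def H_sum c(2))
  also have "\<dots> = (\<Sum>i\<in>I. scal (c i) * (H (monom 1 i) - h i))"
    by (simp add: scal_mult sum_subtractf smult_diff_right)
  also have "\<dots> \<in> J" by (intro J_sum J_mult h(2))
  finally have "H u \<in> J" .
  moreover obtain i where i: "i \<in> I" "c i \<noteq> 0" using c(1) by blast
  have "coeff u i = (\<Sum>j\<in>I. if j = i then c j else 0)"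
    unfolding u_def coeff_sum by (intro sum.cong) auto
  then have "coeff u i \<noteq> 0" using i by (simp add: I_def)
  then have "u \<noteq> 0" by auto
  ultimately show ?thesis by blast
qed

text \<open>The ideal is real radical: repeated factors drop out through squares, and a pair of
  nonreal roots contributes a sum of two squares, one of them of a nonzero constant. The cofactor
  \<open>w\<close> carries the factors already split off.\<close>

lemma real_roots_annihilate:
  assumes H_add: "\<And>u v. H (u + v) = H u + H v" and H_mult: "\<And>u v. H (u * v) = H u * H v"
    and H_const: "\<And>c. H [:c:] = scal c"
  shows "u \<noteq> 0 \<Longrightarrow> H u * w \<in> J \<Longrightarrow> H (\<Prod>a\<in>{x. poly u x = 0}. [:- a, 1 :: real:]) * w \<in> J"
proof (induction "degree u" arbitrary: u w rule: less_induct)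
  case less
  have cancel: "z \<in> J" if "scal c * z \<in> J" "c \<noteq> 0" for c z
    using J_mult[OF that(1), of "scal (1 / c)"] scal_inverse[OF that(2), of z] by simp
  show ?case
  proof (cases "degree u = 0")
    case True
    then obtain c where c: "u = [:c:]" using degree_eq_zeroE by blast
    with less.prems(1) have "c \<noteq> 0" by auto
    then have "w \<in> J" using less.prems(2) cancel by (simp add: c H_const)
    then have "H [:1:] * w \<in> J" by (rule J_mult)
    then show ?thesis using \<open>c \<noteq> 0\<close> by (simp add: c one_pCons)
  next
    case False
    then have "degree (map_poly complex_of_real u) \<ge> 1" by (simp add: degree_map_poly)
    then obtain z where z: "poly (map_poly complex_of_real u) z = 0" using ex_root_complex by blast
    show ?thesis
    proof (cases "Im z = 0")
      case True
      define a where "a = Re z"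
      have "z = of_real a" using True by (simp add: a_def complex_eq_iff)
      then have "poly u a = 0" using z by (simp add: poly_map_of_real)
      then obtain v where v: "u = [:- a, 1:] * v" by (auto simp: poly_eq_0_iff_dvd elim: dvdE)
      with less.prems(1) have v0: "v \<noteq> 0" by auto
      then have deg: "degree v < degree u" unfolding v by (subst degree_mult_eq) auto
      have "H v * (H [:- a, 1:] * w) \<in> J"
        using less.prems(2) unfolding v H_mult by (simp only: mult_ac)
      from less.hyps[OF deg v0 this]
      have IH: "H (\<Prod>a\<in>{x. poly v x = 0}. [:- a, 1:]) * (H [:- a, 1:] * w) \<in> J" .
      have roots: "{x. poly u x = 0} = insert a {x. poly v x = 0}" by (auto simp: v)
      have fin: "finite {x. poly v x = 0}" using v0 by (rule poly_roots_finite)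
      show ?thesis
      proof (cases "a \<in> {x. poly v x = 0}")
        case True
        \<comment> \<open>The root is repeated. Multiplying by the remaining factors completes a
          square, and \<open>J_square\<close> takes its root.\<close>
        define P where "P = (\<Prod>a\<in>{x. poly v x = 0} - {a}. [:- a, 1:])"
        have prod: "(\<Prod>a\<in>{x. poly v x = 0}. [:- a, 1:]) = [:- a, 1:] * P"
          unfolding P_def using True fin by (simp add: prod.remove)
        have "(H P * w) * (H (\<Prod>a\<in>{x. poly v x = 0}. [:- a, 1:]) * (H [:- a, 1:] * w)) \<in> J"
          using IH by (rule J_mult)
        then have "(H [:- a, 1:] * H P * w) * (H [:- a, 1:] * H P * w) \<in> J"
          unfolding prod H_mult by (simp add: mult_ac)
        then have "H [:- a, 1:] * H P * w \<in> J" by (rule J_square)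
        moreover have "H (\<Prod>a\<in>{x. poly u x = 0}. [:- a, 1:]) = H [:- a, 1:] * H P"
          using True roots prod by (simp only: H_mult[symmetric] insert_absorb)
        ultimately show ?thesis by simp
      next
        case False
        then have "(\<Prod>a\<in>{x. poly u x = 0}. [:- a, 1:]) = [:- a, 1:] * (\<Prod>a\<in>{x. poly v x = 0}. [:- a, 1:])"
          unfolding roots using fin by simp
        then have "H (\<Prod>a\<in>{x. poly u x = 0}. [:- a, 1:]) = H [:- a, 1:] * H (\<Prod>a\<in>{x. poly v x = 0}. [:- a, 1:])"
          by (simp only: H_mult)
        then show ?thesis using IH by (simp add: mult_ac)
      qed
    next
      case False
      define a b where "a = Re z" and "b = Im z"
      define q where "q = [:- a, 1:] * [:- a, 1:] + [:b:] * [:b:]"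
      have q: "q = [:a\<^sup>2 + b\<^sup>2, - 2 * a, 1:]" by (simp add: q_def power2_eq_square)
      have qpos: "poly q x > 0" for x
      proof -
        have "poly q x = (x - a)\<^sup>2 + b\<^sup>2" by (simp add: q_def power2_eq_square algebra_simps)
        then show ?thesis using False by (simp add: b_def sum_power2_gt_zero_iff add_nonneg_pos)
      qed
      have degq: "degree q = 2" by (simp add: q)
      have hom: "map_poly complex_of_real (g * h + r) = map_poly of_real g * map_poly of_real h + map_poly of_real r" for g h r
        by (simp add: poly_eq_iff coeff_map_poly coeff_mult)
      have "q dvd u"
      proof -
        \<comment> \<open>The remainder is linear with real coefficients and vanishes at a nonreal
          number, so it is 0.\<close>
        define r where "r = u mod q"
        have "q \<noteq> 0" using degq by auto
        then have "degree r < 2" using degree_mod_less[of q u] degq by (auto simp: r_def)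
        then have "degree r \<le> 1" by simp
        define r0 r1 where "r0 = coeff r 0" and "r1 = coeff r 1"
        have r: "r = [:r0, r1:]"
        proof (rule poly_eqI)
          fix n
          show "coeff r n = coeff [:r0, r1:] n"
            using \<open>degree r \<le> 1\<close> coeff_eq_0[of r n]
            by (cases n rule: nat.exhaust[case_names 0 Suc]; cases "n - 1")
              (auto simp: r0_def r1_def coeff_pCons split: nat.splits)
        qed
        have "u = (u div q) * q + r" by (simp add: r_def)
        then have "poly (map_poly complex_of_real u) z
            = poly (map_poly of_real (u div q)) z * poly (map_poly of_real q) z + poly (map_poly of_real r) z"
          using hom[of "u div q" q r] by simp
        moreover have "poly (map_poly complex_of_real q) z = 0"
          by (simp add: q map_poly_pCons a_def b_def complex_eq_iff power2_eq_square algebra_simps)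
        ultimately have "complex_of_real r0 + z * of_real r1 = 0"
          using z by (simp add: r map_poly_pCons)
        then have "r1 = 0" "r0 = 0" using False by (auto simp: complex_eq_iff)
        then have "u mod q = 0" using r by (simp add: r_def)
        then show ?thesis by (simp add: mod_eq_0_iff_dvd)
      qed
      then obtain v where v: "u = q * v" by (elim dvdE)
      with less.prems(1) have v0: "v \<noteq> 0" "q \<noteq> 0" by auto
      then have deg: "degree v < degree u" unfolding v using degq by (subst degree_mult_eq) auto
      have "H v * (H q * w) \<in> J" using less.prems(2) by (simp add: v H_mult mult_ac)
      from less.hyps[OF deg v0(1) this]
      have IH: "H (\<Prod>a\<in>{x. poly v x = 0}. [:- a, 1:]) * (H q * w) \<in> J" .
      have roots: "{x. poly u x = 0} = {x. poly v x = 0}" using qpos by (auto simp: v less_le)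
      define Z where "Z = H (\<Prod>a\<in>{x. poly v x = 0}. [:- a, 1:]) * w"
      have "Z * (H (\<Prod>a\<in>{x. poly v x = 0}. [:- a, 1:]) * (H q * w)) \<in> J" using IH by (rule J_mult)
      moreover have "Z * (H (\<Prod>a\<in>{x. poly v x = 0}. [:- a, 1:]) * (H q * w))
          = (H [:- a, 1:] * Z) * (H [:- a, 1:] * Z) + (scal b * Z) * (scal b * Z)"
        unfolding q_def H_add H_mult H_const Z_def by (simp add: algebra_simps)
      ultimately have "scal b * Z \<in> J" using J_sum_of_squares by metis
      then have "Z \<in> J" using cancel False by (simp add: b_def)
      then show ?thesis by (simp add: Z_def roots)
    qed
  qed
qed

lemma linear_factors_dvd:
  fixes g :: "real poly"
  assumes "finite S" "\<And>a. a \<in> S \<Longrightarrow> poly g a = 0"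
  shows "(\<Prod>a\<in>S. [:- a, 1:]) dvd g"
  using assms
proof (induction S arbitrary: g rule: finite_induct)
  case (insert a S)
  obtain h where h: "g = [:- a, 1:] * h" using insert.prems[of a] by (auto simp: poly_eq_0_iff_dvd elim: dvdE)
  have "poly h b = 0" if "b \<in> S" for b
    using insert.prems[of b] that insert.hyps by (auto simp: h)
  then have "(\<Prod>a\<in>S. [:- a, 1:]) dvd h" by (rule insert.IH)
  then show ?case
    unfolding prod.insert[OF insert.hyps] h by (rule mult_dvd_mono[OF dvd_refl])
qed simp

lemma ex_lagrange_polys:
  assumes "finite (S :: real set)"
  shows "\<exists>l :: real \<Rightarrow> real poly. \<forall>a\<in>S. \<forall>b\<in>S. poly (l a) b = (if a = b then 1 else 0)"
proof (intro exI ballI)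
  fix a b assume "a \<in> S" "b \<in> S"
  then show "poly (smult (1 / (\<Prod>c\<in>S - {a}. a - c)) (\<Prod>c\<in>S - {a}. [:- c, 1:])) b = (if a = b then 1 else 0)"
    using assms by (auto simp: poly_prod prod_zero_iff)
qed

text \<open>
  The Lagrange polynomials of the real roots of an annihilating polynomial of a coordinate are
  idempotents modulo \<open>J\<close> on which the coordinate acts as a scalar.
\<close>

lemma ex_coordinate_idempotents:
  assumes H_add: "\<And>u v. H (u + v) = H u + H v" and H_mult: "\<And>u v. H (u * v) = H u * H v"
    and H_const: "\<And>c. H [:c:] = scal c"
  shows "\<exists>S l. finite S \<and> (\<forall>a\<in>S. \<forall>b\<in>S. poly (l a) b = (if a = b then 1 else 0)) \<and>
    (\<forall>a\<in>S. H [:- a, 1:] * H (l a) \<in> J) \<and> (\<Sum>a\<in>S. H (l a)) - 1 \<in> J"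
proof -
  have H_smult: "H (smult c u) = smult [:c:] (H u)" for c u
    using H_mult[of "[:c:]" u] by (simp add: H_const scal_mult)
  obtain u where u: "u \<noteq> 0" "H u \<in> J"
    using ex_annihilating_poly[of H, OF H_add H_smult] by blast
  define S where "S = {x. poly u x = 0}"
  have S: "finite S" unfolding S_def using u(1) by (rule poly_roots_finite)
  have prod: "H (\<Prod>a\<in>S. [:- a, 1:]) \<in> J"
    using real_roots_annihilate[of H, OF H_add H_mult H_const u(1), of 1] u(2) by (simp add: S_def)
  have vanish: "H g \<in> J" if "\<And>a. a \<in> S \<Longrightarrow> poly g a = 0" for g
  proof -
    have "(\<Prod>a\<in>S. [:- a, 1:]) dvd g" using S that by (rule linear_factors_dvd)
    then obtain h where "g = (\<Prod>a\<in>S. [:- a, 1:]) * h" by (elim dvdE)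
    then have "H g = H h * H (\<Prod>a\<in>S. [:- a, 1:])" by (simp add: H_mult mult.commute)
    then show ?thesis using J_mult[OF prod] by simp
  qed
  obtain l :: "real \<Rightarrow> real poly" where l: "\<forall>a\<in>S. \<forall>b\<in>S. poly (l a) b = (if a = b then 1 else 0)"
    using ex_lagrange_polys[OF S] by blast
  have "H [:- a, 1:] * H (l a) \<in> J" if a: "a \<in> S" for a
    unfolding H_mult[symmetric] using l a by (intro vanish) auto
  moreover have "(\<Sum>a\<in>S. H (l a)) - 1 \<in> J"
  proof -
    have H0: "H 0 = 0" using H_const[of 0] by (simp add: scal_def)
    have H1: "H [:-1:] = - 1" using H_const[of "-1"] by (simp add: scal_def one_pCons)
    have "(\<Sum>a\<in>S. H (l a)) = H (\<Sum>a\<in>S. l a)"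
      using S by (induction S rule: finite_induct) (auto simp: H0 H_add)
    then have "(\<Sum>a\<in>S. H (l a)) - 1 = H ((\<Sum>a\<in>S. l a) + [:-1:])" by (simp add: H_add H1)
    moreover have "poly ((\<Sum>a\<in>S. l a) + [:-1:]) b = 0" if b: "b \<in> S" for b
    proof -
      have "poly (\<Sum>a\<in>S. l a) b = (\<Sum>a\<in>S. if a = b then 1 else 0)"
        unfolding poly_sum using l b by (intro sum.cong) auto
      then show ?thesis using S b by simp
    qed
    ultimately show ?thesis using vanish by simp
  qed
  ultimately show ?thesis using S l by blast
qed

text \<open>Products of the idempotents of both coordinates form a partition of unity modulo
  \<open>J\<close>, and a polynomial acts on each of them by its value at a point. The weights are
  the values of \<open>\<Lambda>\<close> at these idempotents.\<close>

lemma atomic: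
  "\<exists>S w. finite S \<and> (\<forall>A\<in>S. w A \<ge> 0) \<and> (\<forall>p. \<Lambda> p = (\<Sum>A\<in>S. w A * eval2 p A))"
proof -
  define HX :: "real poly \<Rightarrow> real poly poly" where "HX u = [:u:]" for u
  define HY :: "real poly \<Rightarrow> real poly poly" where "HY = map_poly (\<lambda>c. [:c:])"
  have HX: "HX (u + v) = HX u + HX v" "HX (u * v) = HX u * HX v" "HX [:c:] = scal c" for u v c
    by (simp_all add: HX_def scal_def)
  have HY: "HY (u + v) = HY u + HY v" "HY (u * v) = HY u * HY v" "HY [:c:] = scal c" for u v c
  proof -
    show "HY (u + v) = HY u + HY v" by (simp add: HY_def poly_eq_iff coeff_map_poly coeff_pCons split: nat.splits)
    have sum0: "[:\<Sum>i\<in>I. g i:] = (\<Sum>i\<in>I. [:g i:])" for I :: "nat set" and g :: "nat \<Rightarrow> real"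
    proof (induction I rule: infinite_finite_induct)
      case (insert x F)
      have "[:g x + sum g F:] = [:g x:] + [:sum g F:]" by simp
      with insert show ?case by simp
    qed auto
    show "HY (u * v) = HY u * HY v"
      by (rule poly_eqI) (simp add: HY_def coeff_map_poly coeff_mult sum0 mult.commute)
    show "HY [:c:] = scal c" by (simp add: HY_def scal_def map_poly_pCons)
  qed
  obtain SX l where X: "finite SX" "\<forall>a\<in>SX. \<forall>b\<in>SX. poly (l a) b = (if a = b then 1 else 0)"
    "\<forall>a\<in>SX. HX [:- a, 1:] * HX (l a) \<in> J" "(\<Sum>a\<in>SX. HX (l a)) - 1 \<in> J"
    using ex_coordinate_idempotents[of HX, OF HX] by blast
  obtain SY m where Y: "finite SY" "\<forall>a\<in>SY. \<forall>b\<in>SY. poly (m a) b = (if a = b then 1 else 0)"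
    "\<forall>a\<in>SY. HY [:- a, 1:] * HY (m a) \<in> J" "(\<Sum>a\<in>SY. HY (m a)) - 1 \<in> J"
    using ex_coordinate_idempotents[of HY, OF HY] by blast
  define E where "E A = HX (l (fst A)) * HY (m (snd A))" for A
  have evalX: "eval2 (HX u) A = poly u (fst A)" for u and A :: "real \<times> real"
    by (simp add: HX_def eval2_def)
  have evalY: "eval2 (HY u) A = poly u (snd A)" for u and A :: "real \<times> real"
  proof -
    have "eval2 (HY u) (fst A, snd A) = (\<Sum>j\<le>degree u. coeff u j * snd A ^ j)"
      unfolding eval2_altdef HY_def by (subst degree_map_poly) (simp_all add: coeff_map_poly)
    then show ?thesis by (simp add: poly_altdef)
  qed
  have act: "p * E A - smult [:eval2 p A:] (E A) \<in> J" if A: "A \<in> SX \<times> SY" for A p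
  proof -
    obtain a b where ab: "A = (a, b)" "a \<in> SX" "b \<in> SY" using A by auto
    \<comment> \<open>The difference \<open>p - p(A)\<close> is written as a combination of
      \<open>y - b\<close> and \<open>x - a\<close>, each of which annihilates \<open>E A\<close>
      modulo \<open>J\<close>.\<close>
    have "[:- [:b:], 1:] dvd p - [:poly p [:b:]:]"
      by (subst poly_eq_0_iff_dvd[symmetric]) simp
    then obtain t where t: "p - [:poly p [:b:]:] = [:- [:b:], 1:] * t" by (elim dvdE)
    have "[:- a, 1:] dvd poly p [:b:] - [:eval2 p A:]"
      by (subst poly_eq_0_iff_dvd[symmetric]) (simp add: eval2_def ab)
    then obtain s where s: "poly p [:b:] - [:eval2 p A:] = [:- a, 1:] * s" by (elim dvdE)
    have "p - scal (eval2 p A) = (p - [:poly p [:b:]:]) + [:poly p [:b:] - [:eval2 p A:]:]"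
      by (simp add: scal_def)
    also have "\<dots> = HY [:- b, 1:] * t + HX [:- a, 1:] * HX s"
      unfolding t s HX(2)[symmetric] by (simp add: HX_def HY_def map_poly_pCons one_pCons)
    finally have "p * E A - smult [:eval2 p A:] (E A) = (HY [:- b, 1:] * t + HX [:- a, 1:] * HX s) * E A"
      by (simp add: scal_mult[symmetric] left_diff_distrib[symmetric])
    also have "\<dots> = (t * HX (l a)) * (HY [:- b, 1:] * HY (m b)) + (HX s * HY (m b)) * (HX [:- a, 1:] * HX (l a))"
      by (simp add: E_def ab algebra_simps)
    also have "\<dots> \<in> J" by (rule J_add[OF J_mult J_mult]) (use X(3) Y(3) ab in auto)
    finally show ?thesis .
  qed
  have "(\<Sum>A\<in>SX \<times> SY. E A) - 1 \<in> J"
  proof -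
    have "(\<Sum>A\<in>SX \<times> SY. E A) = (\<Sum>a\<in>SX. HX (l a)) * (\<Sum>b\<in>SY. HY (m b))"
      by (simp add: E_def sum_product sum.cartesian_product split_beta)
    then have "(\<Sum>A\<in>SX \<times> SY. E A) - 1 = (\<Sum>b\<in>SY. HY (m b)) * ((\<Sum>a\<in>SX. HX (l a)) - 1) + ((\<Sum>b\<in>SY. HY (m b)) - 1)"
      by (simp add: algebra_simps)
    also have "\<dots> \<in> J" using X(4) Y(4) by (intro J_add J_mult)
    finally show ?thesis .
  qed
  note partition = this
  have "\<Lambda> p = (\<Sum>A\<in>SX \<times> SY. \<Lambda> (E A) * eval2 p A)" for p
  proof -
    have "p * ((\<Sum>A\<in>SX \<times> SY. E A) - 1) \<in> J" using partition by (rule J_mult)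
    then have "\<Lambda> (p * ((\<Sum>A\<in>SX \<times> SY. E A) - 1)) = 0" by (rule \<Lambda>_J)
    then have "\<Lambda> p = \<Lambda> (\<Sum>A\<in>SX \<times> SY. p * E A)"
      by (simp add: right_diff_distrib \<Lambda>_diff sum_distrib_left)
    also have "\<dots> = (\<Sum>A\<in>SX \<times> SY. \<Lambda> (p * E A))" by (rule \<Lambda>_sum)
    also have "\<dots> = (\<Sum>A\<in>SX \<times> SY. \<Lambda> (E A) * eval2 p A)"
    proof (rule sum.cong[OF refl])
      fix A assume "A \<in> SX \<times> SY"
      from \<Lambda>_J[OF act[OF this, of p]] show "\<Lambda> (p * E A) = \<Lambda> (E A) * eval2 p A"
        by (simp add: \<Lambda>_diff \<Lambda>_smult mult.commute)
    qed
    finally show ?thesis .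
  qed
  moreover have "\<Lambda> (E A) \<ge> 0" if A: "A \<in> SX \<times> SY" for A
  proof -
    \<comment> \<open>Acting on itself by the value 1, \<open>E A\<close> is idempotent modulo
      \<open>J\<close>, so its weight is the value of a square.\<close>
    have "eval2 (E A) A = 1"
      using X(2) Y(2) A by (auto simp: E_def eval2_mult evalX evalY)
    then have "\<Lambda> (E A * E A) = \<Lambda> (E A)"
      using \<Lambda>_J[OF act[OF A, of "E A"]] by (simp add: \<Lambda>_diff \<Lambda>_smult)
    then show ?thesis using \<Lambda>_square[of "E A"] by simp
  qed
  ultimately have "finite (SX \<times> SY) \<and> (\<forall>A\<in>SX \<times> SY. \<Lambda> (E A) \<ge> 0) \<and>
      (\<forall>p. \<Lambda> p = (\<Sum>A\<in>SX \<times> SY. \<Lambda> (E A) * eval2 p A))"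
    using finite_cartesian_product[OF X(1) Y(1)] by (intro conjI ballI allI)
  then show ?thesis by (rule_tac exI)+
qed

end

section \<open>The flat extension theorem\<close>

definition shift_x :: "nat \<times> nat \<Rightarrow> nat \<times> nat" where
  "shift_x s = (Suc (fst s), snd s)"

definition shift_y :: "nat \<times> nat \<Rightarrow> nat \<times> nat" where
  "shift_y s = (fst s, Suc (snd s))"

lemma mon_shift_x: "mon (1, 0) * mon s = mon (shift_x s)"
  and mon_shift_y: "mon (0, 1) * mon s = mon (shift_y s)"
  by (simp_all add: mon_mult shift_x_def shift_y_def)

text \<open>
  Curto and Fialkow's flat extension theorem: multiplication by the coordinates, followed by
  reduction to degree at most \<open>k\<close>, gives operators \<open>Tx\<close> and \<open>Ty\<close> that are symmetric and commute
  modulo the radical of the form; evaluating polynomials at them extends \<open>\<phi>\<close> to all polynomials.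
\<close>

locale flat_functional =
  fixes \<phi> :: "real poly poly \<Rightarrow> real" and k :: nat
  assumes lin: "linear_on (2 * (k + 1)) \<phi>"
    and psd: "p \<in> polys_le (k + 1) \<Longrightarrow> \<phi> (p * p) \<ge> 0"
    and flat: "p \<in> polys_le (k + 1) \<Longrightarrow> \<exists>q\<in>polys_le k. \<forall>r\<in>polys_le (k + 1). \<phi> ((p - q) * r) = 0"
begin

abbreviation "P \<equiv> (polys_le k :: real poly poly set)"
abbreviation "P' \<equiv> (polys_le (k + 1) :: real poly poly set)"

lemma P_subset: "p \<in> P \<Longrightarrow> p \<in> P'"
  using polys_le_mono[of k "k + 1" p] by simp

lemma prod_mem: "p \<in> P' \<Longrightarrow> q \<in> P' \<Longrightarrow> p * q \<in> polys_le (2 * (k + 1))"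
  using polys_le_mult[of p "k + 1" q "k + 1"] by (simp add: mult_2)

lemma \<phi>_add_left: "p \<in> P' \<Longrightarrow> q \<in> P' \<Longrightarrow> r \<in> P' \<Longrightarrow> \<phi> ((p + q) * r) = \<phi> (p * r) + \<phi> (q * r)"
  by (simp only: distrib_right linear_on_add[OF lin] prod_mem)

lemma \<phi>_diff_left: "p \<in> P' \<Longrightarrow> q \<in> P' \<Longrightarrow> r \<in> P' \<Longrightarrow> \<phi> ((p - q) * r) = \<phi> (p * r) - \<phi> (q * r)"
  by (simp only: left_diff_distrib linear_on_diff[OF lin] prod_mem)

lemma \<phi>_sum_left:
  assumes "\<And>i. i \<in> I \<Longrightarrow> g i \<in> P'" "r \<in> P'"
  shows "\<phi> ((\<Sum>i\<in>I. smult [:c i:] (g i)) * r) = (\<Sum>i\<in>I. c i * \<phi> (g i * r))"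
proof -
  have "\<phi> (\<Sum>i\<in>I. smult [:c i:] (g i * r)) = (\<Sum>i\<in>I. c i * \<phi> (g i * r))"
    using assms by (intro linear_on_sum[OF lin] prod_mem)
  then show ?thesis by (simp add: sum_distrib_right)
qed

lemma x_mem: "p \<in> P \<Longrightarrow> mon (1, 0) * p \<in> P'"
  and y_mem: "p \<in> P \<Longrightarrow> mon (0, 1) * p \<in> P'"
  using polys_le_mult[OF mon_in_polys_le, of "(1, 0)" 1 p k] polys_le_mult[OF mon_in_polys_le, of "(0, 1)" 1 p k]
  by (simp_all add: mons_def)

definition red :: "nat \<times> nat \<Rightarrow> real poly poly" where
  "red s = (SOME q. q \<in> P \<and> (\<forall>r\<in>P'. \<phi> ((mon s - q) * r) = 0))"

text \<open>Flatness provides a reduction of each polynomial separately. Choosing it on monomials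
  and extending linearly makes the operators linear on the nose.\<close>

definition \<pi> :: "real poly poly \<Rightarrow> real poly poly" where
  "\<pi> p = (\<Sum>s\<in>mons (k + 1). smult [:cf p s:] (red s))"

lemma red: "s \<in> mons (k + 1) \<Longrightarrow> red s \<in> P \<and> (\<forall>r\<in>P'. \<phi> ((mon s - red s) * r) = 0)"
  unfolding red_def by (rule someI_ex) (use flat[OF mon_in_polys_le, of s] in blast)

lemma \<pi>_mem: "\<pi> p \<in> P"
  unfolding \<pi>_def by (intro polys_le_sum polys_le_smult) (use red in blast)

lemma \<phi>_\<pi>: "p \<in> P' \<Longrightarrow> r \<in> P' \<Longrightarrow> \<phi> (\<pi> p * r) = \<phi> (p * r)"
proof -
  assume p: "p \<in> P'" and r: "r \<in> P'"
  have red': "\<phi> (red s * r) = \<phi> (mon s * r)" if s: "s \<in> mons (k + 1)" for s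
    using red[OF s] \<phi>_diff_left[OF mon_in_polys_le[OF s] P_subset r, of "red s"] r by auto
  have "\<phi> (\<pi> p * r) = (\<Sum>s\<in>mons (k + 1). cf p s * \<phi> (red s * r))"
    unfolding \<pi>_def by (rule \<phi>_sum_left) (use red P_subset r in blast)+
  also have "\<dots> = (\<Sum>s\<in>mons (k + 1). cf p s * \<phi> (mon s * r))" using red' by simp
  also have "\<dots> = \<phi> (comb (mons (k + 1)) (cf p) * r)"
    unfolding comb_def by (rule \<phi>_sum_left[symmetric]) (use mon_in_polys_le r in blast)+
  finally show ?thesis using comb_cf[OF p] by simp
qed

lemma \<phi>_\<pi>_right: "p \<in> P' \<Longrightarrow> r \<in> P' \<Longrightarrow> \<phi> (r * \<pi> p) = \<phi> (r * p)"
  using \<phi>_\<pi>[of p r] by (simp add: mult.commute)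

lemma \<pi>_sum: "\<pi> (\<Sum>i\<in>I. smult [:c i:] (g i)) = (\<Sum>i\<in>I. smult [:c i:] (\<pi> (g i)))"
proof (rule poly_eq_cfI)
  fix t
  have "cf (\<pi> (\<Sum>i\<in>I. smult [:c i:] (g i))) t = (\<Sum>s\<in>mons (k + 1). \<Sum>i\<in>I. c i * (cf (g i) s * cf (red s) t))"
    by (simp add: \<pi>_def cf_sum sum_distrib_right mult.assoc)
  also have "\<dots> = (\<Sum>i\<in>I. \<Sum>s\<in>mons (k + 1). c i * (cf (g i) s * cf (red s) t))" by (rule sum.swap)
  finally show "cf (\<pi> (\<Sum>i\<in>I. smult [:c i:] (g i))) t = cf (\<Sum>i\<in>I. smult [:c i:] (\<pi> (g i))) t"
    by (simp add: \<pi>_def cf_sum sum_distrib_left)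
qed

section \<open>Multiplication operators and polynomials in them\<close>

definition Tx :: "real poly poly \<Rightarrow> real poly poly" where "Tx p = \<pi> (mon (1, 0) * p)"
definition Ty :: "real poly poly \<Rightarrow> real poly poly" where "Ty p = \<pi> (mon (0, 1) * p)"

lemma T_mem: "Tx p \<in> P" "Ty p \<in> P"
  by (simp_all add: Tx_def Ty_def \<pi>_mem)

lemma Tx_sum: "Tx (\<Sum>i\<in>I. smult [:c i:] (g i)) = (\<Sum>i\<in>I. smult [:c i:] (Tx (g i)))"
  and Ty_sum: "Ty (\<Sum>i\<in>I. smult [:c i:] (g i)) = (\<Sum>i\<in>I. smult [:c i:] (Ty (g i)))"
  unfolding Tx_def Ty_def \<pi>_sum[symmetric] by (simp_all add: sum_distrib_left)

lemma \<phi>_Tx: "p \<in> P \<Longrightarrow> r \<in> P' \<Longrightarrow> \<phi> (Tx p * r) = \<phi> (mon (1, 0) * p * r)"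
  and \<phi>_Ty: "p \<in> P \<Longrightarrow> r \<in> P' \<Longrightarrow> \<phi> (Ty p * r) = \<phi> (mon (0, 1) * p * r)"
  unfolding Tx_def Ty_def by (intro \<phi>_\<pi> x_mem y_mem; assumption)+

lemma Tx_sym: "p \<in> P \<Longrightarrow> q \<in> P \<Longrightarrow> \<phi> (Tx p * q) = \<phi> (p * Tx q)"
  using \<phi>_Tx[of p q] \<phi>_Tx[of q p] P_subset by (simp add: mult_ac)

lemma Ty_sym: "p \<in> P \<Longrightarrow> q \<in> P \<Longrightarrow> \<phi> (Ty p * q) = \<phi> (p * Ty q)"
  using \<phi>_Ty[of p q] \<phi>_Ty[of q p] P_subset by (simp add: mult_ac)

text \<open>Both sides equal the value at \<open>x * p * (y * q)\<close>. Distributing the operators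
  over both arguments keeps each factor in \<open>P'\<close>, where the reduction can be
  undone.\<close>

lemma T_commute:
  assumes p: "p \<in> P" and q: "q \<in> P"
  shows "\<phi> (Ty (Tx p) * q) = \<phi> (Tx (Ty p) * q)"
proof -
  have "\<phi> (Ty (Tx p) * q) = \<phi> (Tx p * Ty q)" by (rule Ty_sym[OF T_mem(1) q])
  also have "\<dots> = \<phi> (mon (1, 0) * p * Ty q)" by (rule \<phi>_Tx[OF p P_subset[OF T_mem(2)]])
  also have "\<dots> = \<phi> (mon (1, 0) * p * (mon (0, 1) * q))"
    unfolding Ty_def by (rule \<phi>_\<pi>_right[OF y_mem[OF q] x_mem[OF p]])
  also have "\<dots> = \<phi> (mon (0, 1) * p * (mon (1, 0) * q))" by (simp add: mult_ac)
  also have "\<dots> = \<phi> (mon (0, 1) * p * Tx q)"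
    unfolding Tx_def by (rule \<phi>_\<pi>_right[OF x_mem[OF q] y_mem[OF p], symmetric])
  also have "\<dots> = \<phi> (Ty p * Tx q)" by (rule \<phi>_Ty[OF p P_subset[OF T_mem(1)], symmetric])
  also have "\<dots> = \<phi> (Tx (Ty p) * q)" by (rule Tx_sym[OF T_mem(2) q, symmetric])
  finally show ?thesis .
qed

text \<open>All \<open>Ty\<close> are applied before all \<open>Tx\<close>. An order has to be
  fixed, because the operators commute only modulo the radical.\<close>

fun \<theta>mon :: "nat \<Rightarrow> nat \<Rightarrow> real poly poly" where
  "\<theta>mon 0 0 = 1"
| "\<theta>mon 0 (Suc j) = Ty (\<theta>mon 0 j)"
| "\<theta>mon (Suc i) j = Tx (\<theta>mon i j)"

definition \<theta> :: "real poly poly \<Rightarrow> real poly poly" where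
  "\<theta> p = (\<Sum>s | cf p s \<noteq> 0. smult [:cf p s:] (\<theta>mon (fst s) (snd s)))"

lemma \<theta>mon_mem: "\<theta>mon i j \<in> P"
  by (induction i j rule: \<theta>mon.induct) (auto simp: one_in_polys_le T_mem)

lemma \<theta>_eq: "p \<in> polys_le n \<Longrightarrow> \<theta> p = (\<Sum>s\<in>mons n. smult [:cf p s:] (\<theta>mon (fst s) (snd s)))"
  unfolding \<theta>_def by (rule sum.mono_neutral_left) (auto simp: polys_le_iff simp del: split_paired_All)

lemma \<theta>_mem: "\<theta> p \<in> P"
  unfolding \<theta>_def by (intro polys_le_sum polys_le_smult \<theta>mon_mem)

lemma \<theta>_add: "\<theta> (p + q) = \<theta> p + \<theta> q"
proof -
  obtain m n where "p \<in> polys_le m" "q \<in> polys_le n" using ex_polys_le by meson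
  then have pq: "p \<in> polys_le (max m n)" "q \<in> polys_le (max m n)"
    using polys_le_mono[of m "max m n"] polys_le_mono[of n "max m n"] by auto
  show ?thesis
    unfolding \<theta>_eq[OF pq(1)] \<theta>_eq[OF pq(2)] \<theta>_eq[OF polys_le_add[OF pq]] sum.distrib[symmetric]
    by (intro sum.cong refl poly_eq_cfI) (simp add: distrib_right)
qed

lemma \<theta>_smult: "\<theta> (smult [:c:] p) = smult [:c:] (\<theta> p)"
proof -
  obtain n where p: "p \<in> polys_le n" using ex_polys_le by blast
  show ?thesis
    unfolding \<theta>_eq[OF p] \<theta>_eq[OF polys_le_smult[OF p]]
    by (intro poly_eq_cfI) (simp add: cf_sum sum_distrib_left mult.assoc)
qed

lemma \<theta>_sum: "\<theta> (\<Sum>i\<in>I. smult [:c i:] (g i)) = (\<Sum>i\<in>I. smult [:c i:] (\<theta> (g i)))"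
proof -
  have "\<theta> 0 = 0" using \<theta>_smult[of 0 0] by simp
  then show ?thesis by (induction I rule: infinite_finite_induct) (auto simp: \<theta>_add \<theta>_smult)
qed

lemma \<theta>_mon: "\<theta> (mon s) = \<theta>mon (fst s) (snd s)"
proof -
  have "{t. cf (mon s) t \<noteq> 0} = {s}" by (auto simp: cf_mon)
  moreover have "smult [:1:] p = p" for p :: "real poly poly"
    using scal_mult[of 1 p] by (simp only: scal_1 mult_1)
  ultimately show ?thesis by (simp add: \<theta>_def cf_mon)
qed

lemma \<theta>_x: "\<theta> (mon (1, 0) * p) = Tx (\<theta> p)"
proof -
  obtain n where p: "p \<in> polys_le n" using ex_polys_le by blast
  have "mon (1, 0) * p = mon (1, 0) * comb (mons n) (cf p)" using comb_cf[OF p] by simp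
  also have "\<dots> = (\<Sum>s\<in>mons n. smult [:cf p s:] (mon (shift_x s)))" by (simp only: mult_comb mon_shift_x)
  finally have "\<theta> (mon (1, 0) * p) = (\<Sum>s\<in>mons n. smult [:cf p s:] (\<theta> (mon (shift_x s))))"
    by (simp only: \<theta>_sum)
  also have "\<dots> = Tx (\<Sum>s\<in>mons n. smult [:cf p s:] (\<theta>mon (fst s) (snd s)))"
    by (simp add: Tx_sum \<theta>_mon shift_x_def)
  finally show ?thesis using \<theta>_eq[OF p] by simp
qed

text \<open>By its recursion \<open>\<theta>mon\<close> adds \<open>Ty\<close> innermost;
  commutation moves it to the outside, at the cost of an equation that holds only under
  \<open>\<phi>\<close>.\<close>

lemma \<theta>mon_Suc_y: "q \<in> P \<Longrightarrow> \<phi> (\<theta>mon i (Suc j) * q) = \<phi> (Ty (\<theta>mon i j) * q)"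
proof (induction i arbitrary: q)
  case (Suc i)
  have "\<phi> (\<theta>mon (Suc i) (Suc j) * q) = \<phi> (\<theta>mon i (Suc j) * Tx q)"
    using Tx_sym[OF \<theta>mon_mem Suc.prems] by simp
  also have "\<dots> = \<phi> (Ty (\<theta>mon i j) * Tx q)" by (rule Suc.IH[OF T_mem(1)])
  also have "\<dots> = \<phi> (Tx (Ty (\<theta>mon i j)) * q)" by (rule Tx_sym[OF T_mem(2) Suc.prems, symmetric])
  also have "\<dots> = \<phi> (Ty (Tx (\<theta>mon i j)) * q)" by (rule T_commute[OF \<theta>mon_mem Suc.prems, symmetric])
  finally show ?case by simp
qed simp

lemma \<theta>_y: "q \<in> P \<Longrightarrow> \<phi> (\<theta> (mon (0, 1) * p) * q) = \<phi> (Ty (\<theta> p) * q)"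
proof -
  assume q: "q \<in> P"
  obtain n where p: "p \<in> polys_le n" using ex_polys_le by blast
  have "mon (0, 1) * p = mon (0, 1) * comb (mons n) (cf p)" using comb_cf[OF p] by simp
  also have "\<dots> = (\<Sum>s\<in>mons n. smult [:cf p s:] (mon (shift_y s)))" by (simp only: mult_comb mon_shift_y)
  finally have "\<theta> (mon (0, 1) * p) = (\<Sum>s\<in>mons n. smult [:cf p s:] (\<theta> (mon (shift_y s))))"
    by (simp only: \<theta>_sum)
  then have "\<phi> (\<theta> (mon (0, 1) * p) * q) = (\<Sum>s\<in>mons n. cf p s * \<phi> (\<theta> (mon (shift_y s)) * q))"
    using \<phi>_sum_left[of "mons n" "\<lambda>s. \<theta> (mon (shift_y s))" q "cf p"] \<theta>_mem P_subset q by simp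
  also have "\<dots> = (\<Sum>s\<in>mons n. cf p s * \<phi> (Ty (\<theta>mon (fst s) (snd s)) * q))"
    by (simp add: \<theta>_mon shift_y_def \<theta>mon_Suc_y[OF q])
  also have "\<dots> = \<phi> ((\<Sum>s\<in>mons n. smult [:cf p s:] (Ty (\<theta>mon (fst s) (snd s)))) * q)"
    using T_mem(2) P_subset q by (intro \<phi>_sum_left[symmetric]) auto
  finally show ?thesis using \<theta>_eq[OF p] by (simp add: Ty_sum)
qed

section \<open>The extended form and its functional\<close>

definition B :: "real poly poly \<Rightarrow> real poly poly \<Rightarrow> real" where
  "B p q = \<phi> (\<theta> p * \<theta> q)"

lemma B_commute: "B p q = B q p"
  by (simp add: B_def mult.commute)

lemma B_add: "B (p + q) r = B p r + B q r"
  unfolding B_def \<theta>_add by (intro \<phi>_add_left P_subset \<theta>_mem)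

lemma B_smult: "B (smult [:c:] p) r = c * B p r"
  using linear_on_smult[OF lin prod_mem[OF P_subset[OF \<theta>_mem] P_subset[OF \<theta>_mem]], of c p r]
  by (simp add: B_def \<theta>_smult)

lemma B_sum: "B (\<Sum>i\<in>I. smult [:c i:] (g i)) r = (\<Sum>i\<in>I. c i * B (g i) r)"
proof -
  have "B 0 r = 0" using B_smult[of 0 0 r] by simp
  then show ?thesis by (induction I rule: infinite_finite_induct) (auto simp: B_add B_smult)
qed

lemma B_x: "B (mon (1, 0) * p) q = B p (mon (1, 0) * q)"
  unfolding B_def \<theta>_x by (rule Tx_sym[OF \<theta>_mem \<theta>_mem])

lemma B_y: "B (mon (0, 1) * p) q = B p (mon (0, 1) * q)"
proof -
  have "B (mon (0, 1) * p) q = \<phi> (Ty (\<theta> p) * \<theta> q)" unfolding B_def by (rule \<theta>_y[OF \<theta>_mem])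
  also have "\<dots> = \<phi> (\<theta> p * Ty (\<theta> q))" by (rule Ty_sym[OF \<theta>_mem \<theta>_mem])
  also have "\<dots> = \<phi> (Ty (\<theta> q) * \<theta> p)" by (simp add: mult.commute)
  also have "\<dots> = B (mon (0, 1) * q) p" unfolding B_def by (rule \<theta>_y[OF \<theta>_mem, symmetric])
  finally show ?thesis by (simp add: B_commute)
qed

lemma B_mon: "B (mon (i, j) * p) q = B p (mon (i, j) * q)"
proof (induction i arbitrary: p q)
  case 0
  show ?case
  proof (induction j arbitrary: p q)
    case (Suc j)
    have s: "mon (0, Suc j) = mon (0, 1) * mon (0, j)" by (simp add: mon_mult)
    have "B (mon (0, 1) * (mon (0, j) * p)) q = B p (mon (0, j) * (mon (0, 1) * q))"
      unfolding B_y by (rule Suc.IH)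
    then show ?case unfolding s by (simp only: mult_ac)
  qed (simp add: mon_0)
next
  case (Suc i)
  have s: "mon (Suc i, j) = mon (1, 0) * mon (i, j)" by (simp add: mon_mult)
  have "B (mon (1, 0) * (mon (i, j) * p)) q = B p (mon (i, j) * (mon (1, 0) * q))"
    unfolding B_x by (rule Suc.IH)
  then show ?case unfolding s by (simp only: mult_ac)
qed

text \<open>Multiplications are self-adjoint, so \<open>B p q\<close> depends only on the product
  \<open>p * q\<close> and comes from a functional on polynomials.\<close>

lemma B_mult: "B (g * p) q = B p (g * q)"
proof -
  obtain n where g: "g \<in> polys_le n" using ex_polys_le by blast
  have expand: "g * r = (\<Sum>s\<in>mons n. smult [:cf g s:] (mon s * r))" for r
  proof -
    have "g * r = comb (mons n) (cf g) * r" using comb_cf[OF g] by simp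
    then show ?thesis by (simp add: comb_def sum_distrib_right)
  qed
  have m: "B (mon s * p) q = B (mon s * q) p" for s
    using B_mon[of "fst s" "snd s" p q] by (simp add: B_commute)
  have "B (g * p) q = (\<Sum>s\<in>mons n. cf g s * B (mon s * p) q)" unfolding expand[of p] by (rule B_sum)
  also have "\<dots> = (\<Sum>s\<in>mons n. cf g s * B (mon s * q) p)" by (simp only: m)
  also have "\<dots> = B (g * q) p" unfolding expand[of q] by (rule B_sum[symmetric])
  finally show ?thesis by (simp add: B_commute)
qed

text \<open>The operators are moved one at a time to the other argument, where the reduction is
  undone. Total degree \<open>k + 1\<close> is possible because the monomial left after removing one
  factor lies in \<open>P\<close>.\<close>

lemma \<phi>_\<theta>_mon: "i + j \<le> k + 1 \<Longrightarrow> r \<in> P \<Longrightarrow> \<phi> (\<theta>mon i j * r) = \<phi> (mon (i, j) * r)"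
proof (induction i j arbitrary: r rule: \<theta>mon.induct)
  case 1
  then show ?case by (simp add: mon_0)
next
  case (2 j)
  have j: "mon (0, j) \<in> P" "0 + j \<le> k + 1" using 2(2) by (auto simp: mons_def intro: mon_in_polys_le)
  have "\<phi> (\<theta>mon 0 (Suc j) * r) = \<phi> (\<theta>mon 0 j * Ty r)"
    unfolding \<theta>mon.simps by (rule Ty_sym[OF \<theta>mon_mem 2(3)])
  also have "\<dots> = \<phi> (mon (0, j) * Ty r)" by (rule 2(1)[OF j(2) T_mem(2)])
  also have "\<dots> = \<phi> (mon (0, j) * (mon (0, 1) * r))"
    unfolding Ty_def by (rule \<phi>_\<pi>_right[OF y_mem[OF 2(3)] P_subset[OF j(1)]])
  also have "mon (0, j) * (mon (0, 1) * r) = mon (0, Suc j) * r"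
    unfolding mult.assoc[symmetric] by (simp add: mon_mult)
  finally show ?case .
next
  case (3 i j)
  have ij: "mon (i, j) \<in> P" "i + j \<le> k + 1" using 3(2) by (auto simp: mons_def intro: mon_in_polys_le)
  have "\<phi> (\<theta>mon (Suc i) j * r) = \<phi> (\<theta>mon i j * Tx r)"
    unfolding \<theta>mon.simps by (rule Tx_sym[OF \<theta>mon_mem 3(3)])
  also have "\<dots> = \<phi> (mon (i, j) * Tx r)" by (rule 3(1)[OF ij(2) T_mem(1)])
  also have "\<dots> = \<phi> (mon (i, j) * (mon (1, 0) * r))"
    unfolding Tx_def by (rule \<phi>_\<pi>_right[OF x_mem[OF 3(3)] P_subset[OF ij(1)]])
  also have "mon (i, j) * (mon (1, 0) * r) = mon (Suc i, j) * r"
    unfolding mult.assoc[symmetric] by (simp add: mon_mult)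
  finally show ?case .
qed

lemma \<phi>_\<theta>: "p \<in> P' \<Longrightarrow> r \<in> P' \<Longrightarrow> \<phi> (\<theta> p * r) = \<phi> (p * r)"
proof -
  assume p: "p \<in> P'" and r: "r \<in> P'"
  have "\<phi> (\<theta> p * r) = \<phi> (\<theta> p * \<pi> r)" by (rule \<phi>_\<pi>_right[OF r P_subset[OF \<theta>_mem], symmetric])
  also have "\<dots> = (\<Sum>s\<in>mons (k + 1). cf p s * \<phi> (\<theta>mon (fst s) (snd s) * \<pi> r))"
    unfolding \<theta>_eq[OF p] by (intro \<phi>_sum_left P_subset \<theta>mon_mem \<pi>_mem)
  also have "\<dots> = (\<Sum>s\<in>mons (k + 1). cf p s * \<phi> (mon s * \<pi> r))"
    by (intro sum.cong refl) (simp add: \<phi>_\<theta>_mon[OF _ \<pi>_mem] mons_def)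
  also have "\<dots> = \<phi> (comb (mons (k + 1)) (cf p) * \<pi> r)"
    unfolding comb_def by (rule \<phi>_sum_left[symmetric]) (use mon_in_polys_le P_subset[OF \<pi>_mem] in blast)+
  also have "\<dots> = \<phi> (p * \<pi> r)" using comb_cf[OF p] by simp
  also have "\<dots> = \<phi> (p * r)" by (rule \<phi>_\<pi>_right[OF r p])
  finally show ?thesis .
qed

lemma B_eq: "p \<in> P' \<Longrightarrow> q \<in> P' \<Longrightarrow> B p q = \<phi> (p * q)"
proof -
  assume p: "p \<in> P'" and q: "q \<in> P'"
  have "B p q = \<phi> (p * \<theta> q)" unfolding B_def by (rule \<phi>_\<theta>[OF p P_subset[OF \<theta>_mem]])
  also have "\<dots> = \<phi> (\<theta> q * p)" by (simp add: mult.commute)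
  also have "\<dots> = \<phi> (q * p)" by (rule \<phi>_\<theta>[OF q p])
  finally show ?thesis by (simp add: mult.commute)
qed

definition \<Lambda> :: "real poly poly \<Rightarrow> real" where
  "\<Lambda> p = B p 1"

lemma \<Lambda>_prod: "\<Lambda> (p * q) = B p q"
  using B_mult[of q p 1] by (simp add: \<Lambda>_def mult.commute)

lemma \<Lambda>_eq: "p \<in> polys_le (2 * (k + 1)) \<Longrightarrow> \<Lambda> p = \<phi> p"
proof (rule linear_on_eqI[OF _ lin])
  show "linear_on (2 * (k + 1)) \<Lambda>" by (simp add: linear_on_def \<Lambda>_def B_add B_smult)
  fix s assume s: "s \<in> mons (2 * (k + 1))"
  \<comment> \<open>A monomial of degree at most \<open>2 * (k + 1)\<close> is split into two of
    degree at most \<open>k + 1\<close>, for which \<open>B\<close> is known.\<close>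
  define a where "a = min (fst s) (k + 1)"
  define b where "b = min (snd s) (k + 1 - a)"
  have ab: "(a, b) \<in> mons (k + 1)" "(fst s - a, snd s - b) \<in> mons (k + 1)" "a \<le> fst s" "b \<le> snd s"
    using s by (auto simp: mons_def a_def b_def)
  then have "mon s = mon (a, b) * mon (fst s - a, snd s - b)" by (simp add: mon_mult)
  then show "\<Lambda> (mon s) = \<phi> (mon s)"
    using ab by (simp add: \<Lambda>_prod B_eq mon_in_polys_le)
qed

sublocale positive_functional \<Lambda> k
proof
  show "\<Lambda> (p + q) = \<Lambda> p + \<Lambda> q" "\<Lambda> (smult [:c:] p) = c * \<Lambda> p" for p q c
    by (simp_all add: \<Lambda>_def B_add B_smult)
  show "\<Lambda> (p * p) \<ge> 0" for p
    unfolding \<Lambda>_prod B_def by (rule psd[OF P_subset[OF \<theta>_mem]])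
  show "\<exists>h\<in>P. \<Lambda> ((p - h) * (p - h)) = 0" for p
  proof (rule bexI[OF _ \<theta>_mem])
    let ?q = "p - \<theta> p"
    have neg: "?q = p + smult [:-1:] (\<theta> p)" unfolding smult_minus_1 by simp
    have "B ?q ?q = B p ?q - B (\<theta> p) ?q" by (subst (1) neg) (simp only: B_add B_smult)
    also have "B (\<theta> p) ?q = B p ?q"
      unfolding B_def by (rule \<phi>_\<theta>[OF P_subset[OF \<theta>_mem] P_subset[OF \<theta>_mem]])
    finally have "B ?q ?q = 0" by simp
    then show "\<Lambda> (?q * ?q) = 0" by (simp only: \<Lambda>_prod)
  qed
qed

text \<open>The last conjunct, interpolation in degree \<open>k\<close> on the atoms, will place
  them on the curve: it lowers the degree of one factor of \<open>f * f\<close>.\<close>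

lemma flat_atomic:
  "\<exists>S w. finite S \<and> (\<forall>A\<in>S. w A > 0) \<and>
    (\<forall>p\<in>polys_le (2 * (k + 1)). \<phi> p = (\<Sum>A\<in>S. w A * eval2 p A)) \<and>
    (\<forall>g. \<exists>h\<in>P. \<forall>A\<in>S. eval2 h A = eval2 g A)"
proof -
  obtain S w where S: "finite S" "\<forall>A\<in>S. w A \<ge> 0" "\<forall>p. \<Lambda> p = (\<Sum>A\<in>S. w A * eval2 p A)"
    using atomic by blast
  define S' where "S' = {A \<in> S. w A > 0}"
  have fin: "finite S'" using S(1) by (simp add: S'_def)
  have rep: "\<Lambda> p = (\<Sum>A\<in>S'. w A * eval2 p A)" for p
  proof -
    have "\<Lambda> p = (\<Sum>A\<in>S. w A * eval2 p A)" using S(3) by blast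
    also have "\<dots> = (\<Sum>A\<in>S'. w A * eval2 p A)"
      using S(1,2) unfolding S'_def by (intro sum.mono_neutral_right) (auto simp: order.order_iff_strict)
    finally show ?thesis .
  qed
  have pos: "w A > 0" if "A \<in> S'" for A using that by (simp add: S'_def)
  have "\<exists>h\<in>P. \<forall>A\<in>S'. eval2 h A = eval2 g A" for g
  proof -
    obtain h where h: "h \<in> P" "\<Lambda> ((g - h) * (g - h)) = 0" using \<Lambda>_finite by blast
    have "\<forall>A\<in>S'. w A * (eval2 (g - h) A * eval2 (g - h) A) = 0"
    proof (subst sum_nonneg_eq_0_iff[symmetric])
      show "(\<Sum>A\<in>S'. w A * (eval2 (g - h) A * eval2 (g - h) A)) = 0"
        using h(2) by (simp add: rep eval2_mult)
      show "0 \<le> w A * (eval2 (g - h) A * eval2 (g - h) A)" if "A \<in> S'" for A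
        by (rule mult_nonneg_nonneg[OF less_imp_le[OF pos[OF that]] zero_le_square])
    qed (rule fin)
    then have "eval2 (g - h) A = 0" if "A \<in> S'" for A using that pos[OF that] by auto
    with h(1) show ?thesis by (intro bexI[of _ h]) (simp_all add: eval2_diff)
  qed
  moreover have "\<phi> p = (\<Sum>A\<in>S'. w A * eval2 p A)" if "p \<in> polys_le (2 * (k + 1))" for p
    using rep[of p] \<Lambda>_eq[OF that] by simp
  ultimately show ?thesis using fin pos by blast
qed

end

section \<open>Almost flat extensions come from moment functionals\<close>

context real_cubic
begin

text \<open>If neither step were flat, a new independent polynomial would appear in degree
  \<open>d + 1\<close> and another in degree \<open>d + 2\<close>, and the rank would grow by
  two.\<close>

lemma almost_flat_extension_flat:
  assumes L: "linear_functional f (2 * d) L" and ext: "almost_flat_extension f d L L'"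
  defines "\<phi> \<equiv> \<lambda>p. L' (residue_class f (2 * d + 4) p)"
  shows "\<exists>k. d \<le> k \<and> k \<le> d + 1 \<and>
    (\<forall>p\<in>polys_le (k + 1). \<exists>q\<in>polys_le k. \<forall>r\<in>polys_le (k + 1). \<phi> ((p - q) * r) = 0)"
proof (rule ccontr)
  assume none: "\<not> ?thesis"
  then have none: "\<exists>p\<in>polys_le (k + 1). \<forall>q\<in>polys_le k. \<exists>r\<in>polys_le (k + 1). \<phi> ((p - q) * r) \<noteq> 0"
    if "k = d \<or> k = d + 1" for k using that by auto
  obtain p1 where p1: "p1 \<in> polys_le (d + 1)"
    "\<And>q. q \<in> polys_le d \<Longrightarrow> \<exists>r\<in>polys_le (d + 1). \<phi> ((p1 - q) * r) \<noteq> 0"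
    using none[of d] by blast
  obtain p2 where p2: "p2 \<in> polys_le (d + 2)"
    "\<And>q. q \<in> polys_le (d + 1) \<Longrightarrow> \<exists>r\<in>polys_le (d + 2). \<phi> ((p2 - q) * r) \<noteq> 0"
    using none[of "d + 1"] by auto
  have four: "2 * (d + 2) = 2 * d + 4" by simp
  have L': "linear_functional f (2 * (d + 2)) L'"
    and res: "\<forall>p\<in>polys_le (2 * d). \<phi> p = L (residue_class f (2 * d) p)"
    and rank: "form_rank (R_le f (d + 2)) (moment_form f (d + 2) L') \<le> form_rank (R_le f d) (moment_form f d L) + 1"
    using ext unfolding almost_flat_extension_def \<phi>_def four by blast+
  have lin: "linear_on (2 * (d + 2)) \<phi>"
    using linear_functional_linear_on[OF L'] unfolding \<phi>_def four .
  obtain T :: "(real poly poly set \<Rightarrow> real) set" and b where T: "finite T"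
    "card T = form_rank (R_le f d) (moment_form f d L)" "\<And>t. t \<in> T \<Longrightarrow> b t \<in> polys_le d"
    and Tind: "\<And>c. \<forall>q\<in>polys_le d. L (residue_class f (2 * d) ((\<Sum>t\<in>T. smult [:c t:] (b t)) * q)) = 0 \<Longrightarrow> \<forall>t\<in>T. c t = 0"
    using form_rank_realized[OF L] by blast
  define I where "I = T <+> (UNIV :: bool set)"
  define g where "g i = (case i of Inl t \<Rightarrow> b t | Inr u \<Rightarrow> if u then p2 else p1)" for i
  have b2: "b t \<in> polys_le (d + 2)" if "t \<in> T" for t
    by (rule polys_le_mono[OF _ T(3)[OF that]]) simp
  have p12: "p1 \<in> polys_le (d + 2)" by (rule polys_le_mono[OF _ p1(1)]) simp
  have "card I \<le> form_rank (R_le f (d + 2)) (moment_form f (d + 2) L')"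
  proof (rule card_le_form_rank[OF L'])
    show "finite I" using T(1) by (simp add: I_def)
    show "g i \<in> polys_le (d + 2)" if "i \<in> I" for i
      using that b2 p12 p2(1) by (auto simp: I_def g_def)
    fix c assume c: "\<And>q. q \<in> polys_le (d + 2) \<Longrightarrow>
      L' (residue_class f (2 * (d + 2)) ((\<Sum>i\<in>I. smult [:c i:] (g i)) * q)) = 0"
    define G where "G = (\<Sum>t\<in>T. smult [:c (Inl t):] (b t))"
    have G: "G \<in> polys_le d" unfolding G_def by (intro polys_le_sum polys_le_smult T(3))
    have sum: "(\<Sum>i\<in>I. smult [:c i:] (g i)) = G + (smult [:c (Inr True):] p2 + smult [:c (Inr False):] p1)"
      using T(1) by (simp add: I_def sum.Plus g_def G_def UNIV_bool add_ac)
    have zero: "\<phi> ((G + (smult [:c (Inr True):] p2 + smult [:c (Inr False):] p1)) * q) = 0"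
      if "q \<in> polys_le (d + 2)" for q
      using c[OF that] unfolding sum \<phi>_def four .
    \<comment> \<open>A nonzero coefficient of \<open>p\<close> would make \<open>p\<close>
      congruent to a polynomial of lower degree modulo the radical, against non-flatness. It is
      applied to \<open>p2\<close> first, because what remains then has degree at most
      \<open>d + 1\<close>.\<close>
    have key: "a = 0" if p: "p \<in> polys_le (Suc n)" and n: "n \<le> d + 1" and H: "H \<in> polys_le n"
      and nf: "\<And>q. q \<in> polys_le n \<Longrightarrow> \<exists>r\<in>polys_le (Suc n). \<phi> ((p - q) * r) \<noteq> 0"
      and z: "\<And>q. q \<in> polys_le (d + 2) \<Longrightarrow> \<phi> ((H + smult [:a:] p) * q) = 0" for a p n H
    proof (rule ccontr)
      assume a: "a \<noteq> 0"
      define q where "q = smult [:- 1 / a:] H"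
      obtain r where r: "r \<in> polys_le (Suc n)" "\<phi> ((p - q) * r) \<noteq> 0"
        using nf[of q] polys_le_smult[OF H] by (auto simp: q_def)
      have r2: "r \<in> polys_le (d + 2)" and pd: "p \<in> polys_le (d + 2)" and Hd: "H \<in> polys_le (d + 2)"
        using n polys_le_mono[OF _ r(1), of "d + 2"] polys_le_mono[OF _ p, of "d + 2"] polys_le_mono[OF _ H, of "d + 2"]
        by auto
      have "H + smult [:a:] p = smult [:a:] (p - q)"
        by (rule poly_eq_cfI) (use a in \<open>simp add: q_def algebra_simps del: smult_diff_right\<close>)
      then have "(H + smult [:a:] p) * r = smult [:a:] ((p - q) * r)" by simp
      moreover have "(p - q) * r \<in> polys_le (2 * (d + 2))"
        unfolding q_def by (intro product_in_polys_le polys_le_diff polys_le_smult pd Hd r2)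
      ultimately have "a * \<phi> ((p - q) * r) = 0" using z[OF r2] linear_on_smult[OF lin] by simp
      with a r(2) show False by simp
    qed
    have "G + smult [:c (Inr False):] p1 \<in> polys_le (d + 1)"
      using polys_le_mono[OF _ G, of "d + 1"] by (intro polys_le_add polys_le_smult p1(1)) auto
    then have c2: "c (Inr True) = 0"
      using key[of p2 "d + 1" "G + smult [:c (Inr False):] p1" "c (Inr True)"] p2 zero by (simp add: add_ac)
    then have zero': "\<phi> ((G + smult [:c (Inr False):] p1) * q) = 0" if "q \<in> polys_le (d + 2)" for q
      using zero[OF that] by simp
    then have c1: "c (Inr False) = 0"
      using key[of p1 d G "c (Inr False)"] p1 G by simp
    have "L (residue_class f (2 * d) (G * q)) = 0" if q: "q \<in> polys_le d" for q
    proof -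
      have "\<phi> (G * q) = 0" using zero'[OF polys_le_mono[OF _ q]] c1 by simp
      then show ?thesis using res product_in_polys_le[OF G q] by simp
    qed
    then have "\<forall>t\<in>T. c (Inl t) = 0" using Tind[of "\<lambda>t. c (Inl t)"] unfolding G_def by blast
    with c1 c2 show "\<forall>i\<in>I. c i = 0" by (auto simp: I_def UNIV_bool)
  qed
  moreover have "card I = card T + 2" using T(1) by (simp add: I_def card_Plus)
  ultimately show False using rank T(2) by linarith
qed

lemma moment_functional_of_almost_flat_extension:
  assumes d: "d \<ge> 1" and L: "linear_functional f (2 * d) L" and ext: "almost_flat_extension f d L L'"
  shows "moment_functional f (2 * d) L"
proof -
  define \<phi> where "\<phi> p = L' (residue_class f (2 * d + 4) p)" for p
  have four: "2 * (d + 2) = 2 * d + 4" by simp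
  have L': "linear_functional f (2 * d + 4) L'"
    and res: "\<forall>p\<in>polys_le (2 * d). \<phi> p = L (residue_class f (2 * d) p)"
    and psd: "psd_form (R_le f (d + 2)) (moment_form f (d + 2) L')"
    using ext unfolding almost_flat_extension_def \<phi>_def by blast+
  have lin: "linear_on (2 * d + 4) \<phi>"
    using linear_functional_linear_on[OF L'] unfolding \<phi>_def .
  obtain k where k: "d \<le> k" "k \<le> d + 1"
    "\<forall>p\<in>polys_le (k + 1). \<exists>q\<in>polys_le k. \<forall>r\<in>polys_le (k + 1). \<phi> ((p - q) * r) = 0"
    using almost_flat_extension_flat[OF L ext] unfolding \<phi>_def by blast
  interpret flat_functional \<phi> k
  proof
    show "linear_on (2 * (k + 1)) \<phi>" using lin by (rule linear_on_mono) (use k(2) in simp)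
    fix p :: "real poly poly"
    assume p: "p \<in> polys_le (k + 1)"
    then have p2: "p \<in> polys_le (d + 2)" using k(2) by (intro polys_le_mono[OF _ p]) simp
    then have "residue_class f (d + 2) p \<in> R_le f (d + 2)" by (simp add: R_le_def)
    with psd have "moment_form f (d + 2) L' (residue_class f (d + 2) p) (residue_class f (d + 2) p) \<ge> 0"
      unfolding psd_form_def by blast
    then show "\<phi> (p * p) \<ge> 0"
      unfolding moment_form_residue_class[OF p2 p2] \<phi>_def four .
    show "\<exists>q\<in>polys_le k. \<forall>r\<in>polys_le (k + 1). \<phi> ((p - q) * r) = 0" using k(3) p by blast
  qed
  obtain S w where S: "finite S" "\<forall>A\<in>S. w A > 0"
    "\<forall>p\<in>polys_le (2 * (k + 1)). \<phi> p = (\<Sum>A\<in>S. w A * eval2 p A)"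
    "\<forall>g. \<exists>h\<in>polys_le k. \<forall>A\<in>S. eval2 h A = eval2 g A"
    using flat_atomic by blast
  \<comment> \<open>The degree of \<open>f * f\<close> may be too large. With \<open>h\<close> in
    place of one factor it is at most \<open>k + 3\<close>, which is within
    \<open>2 * (k + 1)\<close> because \<open>k \<ge> 1\<close>; at the atoms nothing
    changes.\<close>
  obtain h where h: "h \<in> polys_le k" "\<forall>A\<in>S. eval2 h A = eval2 f A" using S(4) by blast
  have fh: "f * h \<in> polys_le (2 * (k + 1))"
    using polys_le_mult[OF f_in_polys_le h(1)] by (rule polys_le_mono[rotated]) (use d k(1) in simp)
  then have "f * h \<in> polys_le (2 * d + 4)" by (rule polys_le_mono[rotated]) (use k(2) in simp)
  then have "\<phi> (f * h) = 0" unfolding \<phi>_def by (rule linear_functional_multiple[OF L']) simp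
  then have "(\<Sum>A\<in>S. w A * (eval2 f A * eval2 f A)) = 0"
    using S(3) fh h(2) by (simp add: eval2_mult)
  moreover have "0 \<le> w A * (eval2 f A * eval2 f A)" if "A \<in> S" for A
    using S(2) that by (intro mult_nonneg_nonneg zero_le_square) (auto intro: less_imp_le)
  ultimately have "\<forall>A\<in>S. w A * (eval2 f A * eval2 f A) = 0"
    using sum_nonneg_eq_0_iff[OF S(1), of "\<lambda>A. w A * (eval2 f A * eval2 f A)"] by blast
  then have "S \<subseteq> real_points f" using S(2) by (force simp: real_points_def)
  moreover have "L (residue_class f (2 * d) p) = (\<Sum>A\<in>S. w A * eval2 p A)" if p: "p \<in> polys_le (2 * d)" for p
  proof -
    have "p \<in> polys_le (2 * (k + 1))" using p by (rule polys_le_mono[rotated]) (use k(1) in simp)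
    then have "\<phi> p = (\<Sum>A\<in>S. w A * eval2 p A)" using S(3) by blast
    moreover have "\<phi> p = L (residue_class f (2 * d) p)" using res p by blast
    ultimately show ?thesis by (rule trans[OF sym, rotated])
  qed
  ultimately show ?thesis
    using S(1,2) by (intro atomic_moment_functional[of S w]) (auto intro: less_imp_le)
qed

end

theorem theorem4:
  fixes f :: "real poly poly" and d :: nat and L :: "real poly poly set \<Rightarrow> real"
  assumes "d \<ge> 1"
    and "plane_cubic f"
    and "totally_real f"
    and "smooth_projectivization f"
    and "linear_functional f (2 * d) L"
  shows "moment_functional f (2 * d) L \<longleftrightarrow> (\<exists>L'. almost_flat_extension f d L L')"
proof -
  interpret real_cubic f by unfold_locales (fact assms)+
  show ?thesis
  proof
    assume "moment_functional f (2 * d) L"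
    from few_atoms_of_moment_functional[OF assms(1,5) this]
    show "\<exists>L'. almost_flat_extension f d L L'"
      using atomic_almost_flat_extension[OF assms(1,5)] by blast
  next
    assume "\<exists>L'. almost_flat_extension f d L L'"
    then show "moment_functional f (2 * d) L"
      using moment_functional_of_almost_flat_extension[OF assms(1,5)] by blast
  qed
qed

end
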